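(* Let $\xi$ be a random variable with distribution function $F$, where $F$ satisfies the standing assumptions given in the context, and let $\alpha>0$. Suppose that $\mathbb{E}\,e^{\alpha\xi}<\infty$. Then there exist $\beta\in(0,\alpha)$ and a measurable function $K_\beta:[0,\infty)\times[0,\infty)\to[0,\infty)$ such that: (i) for all $b,b'\ge0$ there exists a successful coupling of the processes $(B^{b}_t)_{t\ge0}$ and $(B^{b'}_t)_{t\ge0}$ whose coupling time $\tau(b,b')$ satisfies $\mathbb{E}\,\exp(\beta\,\tau(b,b'))\le K_\beta(b,b')$; (ii) for every $b\ge 0$ the quantity $\widetilde K_\beta(b)=\int_0^\infty K_\beta(b,b')\,\mathrm{d}\widetilde F(b')$ is finite, and for every $t\ge0$ $$\left\|\mathscr{P}^{b}_t-\widetilde{\mathscr{P}}\right\|_{TV}\le \widetilde K_\beta(b)\,e^{-\beta t}.$$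
   Context: Standing assumptions on $F$: $F$ is the distribution function of a strictly positive random variable $\xi$ (the length of a renewal period) with $\mu=\mathbb{E}\,\xi<\infty$. $F$ has no singular continuous component (jumps are allowed), and it has a positive density almost everywhere on $(0,\infty)$, i.e. $F'(s)$ exists and $F'(s)>0$ for Lebesgue-almost every $s>0$. In particular $F$ is non-lattice and $F(b)<1$ for all $b\ge0$. Backward renewal time process $(B^b_t)_{t\ge 0}$ with initial state $b\ge0$: let $t_1$ be a random variable with distribution function $$F_b(s)=\frac{F(s+b)-F(b)}{1-F(b)},\qquad s\ge 0,$$ let $\xi_2,\xi_3,\dots$ be i.i.d. with distribution function $F$, independent of $t_1$, and set $t_k=t_{k-1}+\xi_k$ for $k\ge2$. Define $B^b_t=b+t$ for $0\le t<t_1$, and $B^b_t=t-t_k$ for $t_k\le t<t_{k+1}$, $k\ge1$. (Thus $B^b_t$ is the time elapsed since the last renewal, the last renewal before time $0$ having occurred at time $-b$.) It is a Markov process on $[0,\infty)$. Let $\mathscr{P}^b_t$ denote the distribution of $B^b_t$. Stationary distribution: $\widetilde{\mathscr{P}}$ is the probability measure on $[0,\infty)$ with distribution function $\widetilde F$ given by $1-\widetilde F(s)=\mu^{-1}\int_s^\infty(1-F(u))\,\mathrm{d}u$, $s\ge0$. Total variation distance: $\|\mathscr{P}_1-\mathscr{P}_2\|_{TV}=\sup_A|\mathscr{P}_1(A)-\mathscr{P}_2(A)|$, the supremum being over Borel sets $A$. Successful coupling of $(B^b_t)$ and $(B^{b'}_t)$: a pair of processes $(Z_t,Z'_t)_{t\ge0}$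 defined on one probability space, with $Z_0=b$, $Z'_0=b'$, such that (1) for every $t\ge0$, $Z_t$ has the same distribution as $B^b_t$ and $Z'_t$ has the same distribution as $B^{b'}_t$ (only one-dimensional marginal distributions are required to agree); (2) the coupling time $\tau(b,b')=\inf\{t>0: Z_t=Z'_t\}$ is a random variable with $\mathbb{E}\,\tau(b,b')<\infty$; (3) almost surely $Z_t=Z'_t$ for all $t\ge\tau(b,b')$. *)

theory Defs
  imports "HOL-Probability.Probability"
begin

text \<open>Probability measures given by a distribution function are rendered by \<open>interval_measure\<close>,
  so the distribution functions of measures on \<open>[0, \<infinity>)\<close> are extended by 0 to the
  negative half-line.\<close>

text \<open>The measure is the sum of an absolutely continuous measure (with density \<open>f\<close>) and of a
  measure carried by a countable set \<open>J\<close>: the third part of the Lebesgue decomposition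
  vanishes.\<close>

definition no_singular_continuous_component :: "real measure \<Rightarrow> bool" where
  "no_singular_continuous_component D \<longleftrightarrow>
     (\<exists>(f :: real \<Rightarrow> ennreal) (J :: real set). f \<in> borel_measurable borel \<and> countable J \<and>
        (\<forall>A\<in>sets borel. emeasure D A = (\<integral>\<^sup>+x\<in>A. f x \<partial>lborel) + emeasure D (A \<inter> J)))"

definition residual_cdf :: "(real \<Rightarrow> real) \<Rightarrow> real \<Rightarrow> real \<Rightarrow> real" where
  "residual_cdf F b s = (if s < 0 then 0 else (F (s + b) - F b) / (1 - F b))"

text \<open>The joint law of \<open>(t\<^sub>1, \<xi>\<^sub>2, \<xi>\<^sub>3, \<dots>)\<close>. Indices are shifted by one: coordinate 0 is the
  first (residual) period, coordinate \<open>k\<close> is the \<open>(k + 1)\<close>-st period.\<close>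

definition period_lengths :: "(real \<Rightarrow> real) \<Rightarrow> real \<Rightarrow> (nat \<Rightarrow> real) measure" where
  "period_lengths F b =
     Pi\<^sub>M UNIV (\<lambda>k. if k = 0 then interval_measure (residual_cdf F b) else interval_measure F)"

definition renewal_time :: "(nat \<Rightarrow> real) \<Rightarrow> nat \<Rightarrow> real" where
  "renewal_time x k = (\<Sum>i<k. x i)"

text \<open>The index \<open>k\<close> with \<open>t\<^sub>k \<le> t < t\<^sub>k\<^sub>+\<^sub>1\<close> exists almost surely; on the exceptional null set,
  where the renewal times accumulate before \<open>t\<close>, the value is irrelevant.\<close>

definition backward_renewal_time :: "real \<Rightarrow> real \<Rightarrow> (nat \<Rightarrow> real) \<Rightarrow> real" where
  "backward_renewal_time b t x =
     (if t < renewal_time x 1 then b + t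
      else t - renewal_time x (LEAST k. t < renewal_time x (Suc k)))"

definition backward_renewal_law :: "(real \<Rightarrow> real) \<Rightarrow> real \<Rightarrow> real \<Rightarrow> real measure" where
  "backward_renewal_law F b t = distr (period_lengths F b) borel (backward_renewal_time b t)"

definition stationary_cdf :: "(real \<Rightarrow> real) \<Rightarrow> real \<Rightarrow> real \<Rightarrow> real" where
  "stationary_cdf F \<mu> s = (if s < 0 then 0 else 1 - (LINT u:{s..}|lborel. 1 - F u) / \<mu>)"

definition stationary_law :: "(real \<Rightarrow> real) \<Rightarrow> real \<Rightarrow> real measure" where
  "stationary_law F \<mu> = interval_measure (stationary_cdf F \<mu>)"

definition tv_dist :: "real measure \<Rightarrow> real measure \<Rightarrow> real" where
  "tv_dist P Q = (SUP A\<in>sets borel. \<bar>measure P A - measure Q A\<bar>)"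

text \<open>The infimum is taken in \<open>[0, \<infinity>]\<close>, so it is \<open>\<infinity>\<close> if the processes never meet.\<close>

definition coupling_time :: "(real \<Rightarrow> 'w \<Rightarrow> real) \<Rightarrow> (real \<Rightarrow> 'w \<Rightarrow> real) \<Rightarrow> 'w \<Rightarrow> ennreal" where
  "coupling_time Z Z' \<omega> = (INF t\<in>{t. t > 0 \<and> Z t \<omega> = Z' t \<omega>}. ennreal t)"

definition successful_coupling ::
    "(real \<Rightarrow> real) \<Rightarrow> real \<Rightarrow> real \<Rightarrow> 'w measure \<Rightarrow> (real \<Rightarrow> 'w \<Rightarrow> real) \<Rightarrow> (real \<Rightarrow> 'w \<Rightarrow> real) \<Rightarrow> bool"
  where
  "successful_coupling F b b' N Z Z' \<longleftrightarrow>
     prob_space N \<and>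
     (\<forall>t\<ge>0. Z t \<in> borel_measurable N \<and> Z' t \<in> borel_measurable N) \<and>
     (\<forall>\<omega>\<in>space N. Z 0 \<omega> = b \<and> Z' 0 \<omega> = b') \<and>
     (\<forall>t\<ge>0. distr N borel (Z t) = backward_renewal_law F b t \<and>
             distr N borel (Z' t) = backward_renewal_law F b' t) \<and>
     coupling_time Z Z' \<in> borel_measurable N \<and>
     (\<integral>\<^sup>+\<omega>. coupling_time Z Z' \<omega> \<partial>N) < \<infinity> \<and>
     (AE \<omega> in N. \<forall>t\<ge>0. ennreal t \<ge> coupling_time Z Z' \<omega> \<longrightarrow> Z t \<omega> = Z' t \<omega>)"

text \<open>\<open>exp (\<beta> x)\<close> for \<open>x \<in> [0, \<infinity>]\<close> and \<open>\<beta> > 0\<close>.\<close>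

definition exp_scaled :: "real \<Rightarrow> ennreal \<Rightarrow> ennreal" where
  "exp_scaled \<beta> x = (if x = \<infinity> then \<infinity> else ennreal (exp (\<beta> * enn2real x)))"

text \<open>Statements about the existence of a coupling have to choose a type of sample points.
  Taking pairs of paths, \<open>real \<Rightarrow> real \<times> real\<close>, loses no generality: a coupling on any
  space can be pushed forward along \<open>\<omega> \<mapsto> (\<lambda>t. (Z t \<omega>, Z' t \<omega>))\<close>, with the largest
  sigma-algebra that makes this map measurable, and all the conditions above depend on the
  paths only.\<close>

end

theory Submission imports Defs begin

text \<open>
  Conditioning on the first renewal gives a renewal equation for the law of \<open>B\<^sup>b\<^sub>t\<close>; uniqueness of
  its bounded solutions yields the Markov property. The function
  \<open>V b = E (e\<^bsup>\<alpha>(\<xi> - b)\<^esup> | \<xi> > b)\<close> is a Lyapunov function: outside its sublevel sets it contracts on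
  average, and on a sublevel set a renewal occurs soon with probability at least 1/2, after which two further
  periods with a positive density spread the law over \<open>[0, 1]\<close>. The contraction argument of
  Hairer and Mattingly for Harris' theorem then bounds the total variation distance
  of the laws of \<open>B\<^sup>b\<^sub>t\<close> and \<open>B\<^bsup>b'\<^esup>\<^sub>t\<close> by \<open>C (V b + V b') e\<^bsup>-\<kappa>t\<^esup>\<close>.

  A successful coupling only has to match one-dimensional marginals. For a single uniform variable \<open>u\<close>
  take at each time \<open>t\<close> a maximal coupling whose two components agree exactly when the
  total variation distance \<open>d t\<close> is at most \<open>u\<close>. Since \<open>d\<close> is decreasing (Markov property) and
  right-continuous, the components stay together after they have met, and the coupling time exceeds \<open>t\<close> with
  probability at most \<open>d t\<close>.
\<close>

subsection \<open>Bounded Borel functions\<close>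

text \<open>\<open>V\<close> is unbounded, while the operators \<open>evol t\<close> are handled on
  bounded Borel functions. Estimates on \<open>V\<close> are therefore proved for
  \<open>min V n\<close> with bounds free of \<open>n\<close>, and reach \<open>V\<close> by
  monotone convergence. The one tool for renewal equations is that convolution with the period law
  contracts in the supremum norm weighted by \<open>exp (- t)\<close>; it gives uniqueness, the
  drift constant, and the fact that renewal times do not accumulate. The assumption on
  \<open>F'\<close> concerns the distribution function, but spreading needs the density
  \<open>f\<close> of the absolutely continuous part; a change of variables along \<open>F\<close>
  shows that \<open>f\<close> vanishes at most on a null set of the positive half-line. Since
  \<open>f\<close> is bounded below only off a set of small measure, one period leaves gaps in the
  law; the convolution of two fills them. The coupling costs half of the rate: if the distance is at
  most \<open>B * exp (- 2 * \<beta> * t)\<close>, then \<open>exp (\<beta> * \<tau>)\<close> is at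
  most \<open>max 1 (sqrt (B / u))\<close>, which is integrable in \<open>u\<close>. Bounding
  \<open>1 + 2 * sqrt B\<close> by \<open>2 + B\<close> keeps \<open>K\<close> affine in
  \<open>V b + V b'\<close>, hence integrable under the stationary law.\<close>

definition bounded_borel :: "(real \<Rightarrow> real) \<Rightarrow> bool" where
  "bounded_borel g \<longleftrightarrow> g \<in> borel_measurable borel \<and> (\<exists>M. \<forall>x. \<bar>g x\<bar> \<le> M)"

lemma bounded_borelD:
  assumes "bounded_borel g"
  shows "g \<in> borel_measurable borel" and "\<exists>M. \<forall>x. \<bar>g x\<bar> \<le> M"
  using assms by (auto simp: bounded_borel_def)

lemma (in real_distribution) measure_UNIV [simp]: "measure M UNIV = 1"
  using prob_space by simp

lemma (in finite_measure) integrable_bounded: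
  fixes g :: "'a \<Rightarrow> real"
  assumes "g \<in> borel_measurable M" "\<And>x. \<bar>g x\<bar> \<le> B"
  shows "integrable M g"
  using assms by (intro integrable_const_bound[of _ B]) auto

lemma bounded_borel_const[simp]: "bounded_borel (\<lambda>_. c)"
  by (auto simp: bounded_borel_def)

lemma bounded_borel_add: 
  assumes "bounded_borel g" "bounded_borel h" shows "bounded_borel (\<lambda>x. g x + h x)"
proof -
  from assms obtain A B where "\<And>x. \<bar>g x\<bar> \<le> A" "\<And>x. \<bar>h x\<bar> \<le> B" by (auto simp: bounded_borel_def)
  then have "\<bar>g x + h x\<bar> \<le> A + B" for x by (meson abs_triangle_ineq add_mono order.trans)
  with assms show ?thesis by (auto simp: bounded_borel_def)
qed

lemma bounded_borel_minus: "bounded_borel g \<Longrightarrow> bounded_borel (\<lambda>x. - g x)"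
  by (auto simp: bounded_borel_def)

lemma bounded_borel_diff: "bounded_borel g \<Longrightarrow> bounded_borel h \<Longrightarrow> bounded_borel (\<lambda>x. g x - h x)"
  using bounded_borel_add[of g "\<lambda>x. - h x"] bounded_borel_minus[of h] by simp

lemma bounded_borel_indicator[simp]: "A \<in> sets borel \<Longrightarrow> bounded_borel (indicator A)"
  by (auto simp: bounded_borel_def indicator_def intro!: exI[of _ 1])

lemma interval_measure_cdf:
  assumes "real_distribution N" shows "interval_measure (cdf N) = N"
proof -
  interpret N: real_distribution N by fact
  have *: "\<And>x y. x \<le> y \<Longrightarrow> cdf N x \<le> cdf N y" "\<And>a. continuous (at_right a) (cdf N)"
    "(cdf N \<longlongrightarrow> 0) at_bot" "(cdf N \<longlongrightarrow> 1) at_top"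
    by (auto intro: N.cdf_nondecreasing N.cdf_is_right_cont N.cdf_lim_at_bot N.cdf_lim_at_top_prob)
  show ?thesis
    by (rule cdf_unique[OF real_distribution_interval_measure assms]) (simp_all add: * cdf_interval_measure)
qed

subsection \<open>Decomposition at the first renewal\<close>

text \<open>Checked on cylinders: a finite index set splits into its part at 0 and its preimage
  under \<open>Suc\<close>, and the product of probabilities splits in the same way. The factors may
  differ because the first period has the residual law.\<close>

lemma distr_case_nat_PiM:
  fixes M :: "nat \<Rightarrow> 'a measure"
  assumes M: "\<And>n. prob_space (M n)"
  shows "distr (M 0 \<Otimes>\<^sub>M Pi\<^sub>M UNIV (\<lambda>n. M (Suc n))) (Pi\<^sub>M UNIV M) (\<lambda>(s, \<omega>). case_nat s \<omega>) = Pi\<^sub>M UNIV M"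
    (is "?D = _")
proof (rule product_prob_space.PiM_eq)
  interpret P: product_prob_space M UNIV
    using M by (simp add: product_prob_space_def product_sigma_finite_def product_prob_space_axioms_def
        prob_space_imp_sigma_finite)
  show "product_prob_space M" ..
  interpret S: product_prob_space "\<lambda>n. M (Suc n)" UNIV
    using M by (simp add: product_prob_space_def product_sigma_finite_def product_prob_space_axioms_def
        prob_space_imp_sigma_finite)
  interpret M0: prob_space "M 0" by (rule M)
  interpret MS: pair_prob_space "M 0" "Pi\<^sub>M UNIV (\<lambda>n. M (Suc n))" ..
  have meas[measurable]: "(\<lambda>(s, \<omega>). case_nat s \<omega>) \<in> (M 0 \<Otimes>\<^sub>M Pi\<^sub>M UNIV (\<lambda>n. M (Suc n))) \<rightarrow>\<^sub>M Pi\<^sub>M UNIV M"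
  proof (rule measurable_PiM_single')
    fix i :: nat
    show "(\<lambda>x. (case x of (s, \<omega>) \<Rightarrow> case_nat s \<omega>) i) \<in> M 0 \<Otimes>\<^sub>M Pi\<^sub>M UNIV (\<lambda>n. M (Suc n)) \<rightarrow>\<^sub>M M i"
      by (cases i) (simp_all add: case_prod_beta)
  qed (auto simp: space_pair_measure space_PiM PiE_iff split: nat.split)
  fix J E assume J: "finite J" "J \<subseteq> (UNIV :: nat set)" "\<And>j. j \<in> J \<Longrightarrow> E j \<in> sets (M j)"
  let ?X = "prod_emb UNIV M J (\<Pi>\<^sub>E j\<in>J. E j)"
  have E_space: "\<And>j x. j \<in> J \<Longrightarrow> x \<in> E j \<Longrightarrow> x \<in> space (M j)"
    using J(3)[THEN sets.sets_into_space] by (auto simp: space_PiM Pi_iff subset_eq)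
  let ?A = "if 0 \<in> J then E 0 else space (M 0)"
  let ?B = "prod_emb UNIV (\<lambda>n. M (Suc n)) (Suc -` J) (\<Pi>\<^sub>E j\<in>Suc -` J. E (Suc j))"
  have vim: "(\<lambda>(s, \<omega>). case_nat s \<omega>) -` ?X \<inter> space (M 0 \<Otimes>\<^sub>M Pi\<^sub>M UNIV (\<lambda>n. M (Suc n))) = ?A \<times> ?B"
    using J E_space
    by (auto simp: space_pair_measure space_PiM PiE_iff prod_emb_def all_conj_distrib
      split: nat.split nat.split_asm)
  have "emeasure ?D ?X = emeasure (M 0 \<Otimes>\<^sub>M Pi\<^sub>M UNIV (\<lambda>n. M (Suc n))) (?A \<times> ?B)"
    unfolding vim[symmetric] using J by (intro emeasure_distr meas sets_PiM_I) auto
  also have "\<dots> = emeasure (M 0) ?A * emeasure (Pi\<^sub>M UNIV (\<lambda>n. M (Suc n))) ?B"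
  proof (rule S.P.emeasure_pair_measure_Times)
    show "?A \<in> sets (M 0)" using J by auto
    show "?B \<in> sets (Pi\<^sub>M UNIV (\<lambda>n. M (Suc n)))"
      using J by (intro sets_PiM_I finite_vimageI) auto
  qed
  also have "emeasure (Pi\<^sub>M UNIV (\<lambda>n. M (Suc n))) ?B = (\<Prod>j\<in>Suc -` J. emeasure (M (Suc j)) (E (Suc j)))"
    using J by (intro S.emeasure_PiM_emb) (simp_all add: finite_vimageI)
  also have "\<dots> = (\<Prod>j\<in>J - {0}. emeasure (M j) (E j))"
  proof (rule prod.reindex_bij_betw[of Suc])
    show "bij_betw Suc (Suc -` J) (J - {0})"
      by (rule bij_betwI[where g="\<lambda>j. j - 1"]) auto
  qed
  also have "emeasure (M 0) ?A * (\<Prod>j\<in>J - {0}. emeasure (M j) (E j)) = (\<Prod>j\<in>J. emeasure (M j) (E j))"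
  proof (cases "0 \<in> J")
    case True
    then show ?thesis using prod.remove[OF J(1) True, of "\<lambda>j. emeasure (M j) (E j)"] by simp
  next
    case False
    then show ?thesis using prob_space.emeasure_space_1[OF M] by simp
  qed
  finally show "emeasure ?D ?X = (\<Prod>j\<in>J. emeasure (M j) (E j))" .
qed simp_all

lemma borel_measurable_renewal_time[measurable]:
  assumes "\<And>k. sets (M k) = sets borel"
  shows "(\<lambda>x. renewal_time x k) \<in> borel_measurable (Pi\<^sub>M UNIV M)"
proof -
  have [measurable_cong]: "\<And>k. sets (M k) = sets borel" by fact
  show ?thesis unfolding renewal_time_def by measurable
qed

lemma borel_measurable_backward_renewal_time:
  assumes "\<And>k. sets (M k) = sets borel"
  shows "(\<lambda>(t, x). backward_renewal_time b t x) \<in> borel_measurable (borel \<Otimes>\<^sub>M Pi\<^sub>M UNIV M)"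
proof -
  have [measurable]: "\<And>k. (\<lambda>x. renewal_time x k) \<in> borel_measurable (Pi\<^sub>M UNIV M)"
    by (rule borel_measurable_renewal_time) fact
  have "(\<lambda>p. renewal_time (snd p) (LEAST k. fst p < renewal_time (snd p) (Suc k)))
      \<in> borel_measurable (borel \<Otimes>\<^sub>M Pi\<^sub>M UNIV M)"
    by (rule measurable_compose_countable[where f="\<lambda>k p. renewal_time (snd p) k"]) measurable
  then show ?thesis
    unfolding backward_renewal_time_def case_prod_beta by measurable
qed

text \<open>Prepending a period that has already ended moves the index chosen by
  \<open>LEAST\<close> by one. This is only true if some index qualifies, since otherwise
  \<open>LEAST\<close> is unspecified; hence the second assumption, which later holds almost
  surely.\<close>

lemma backward_renewal_time_case_nat:
  assumes "s \<le> t" and "\<exists>k. t - s < renewal_time x (Suc k)"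
  shows "backward_renewal_time b t (case_nat s x) = backward_renewal_time 0 (t - s) x"
proof -
  have shift: "renewal_time (case_nat s x) (Suc k) = s + renewal_time x k" for k
    unfolding renewal_time_def by (simp add: sum.lessThan_Suc_shift del: sum.lessThan_Suc)
  have zero: "renewal_time y 0 = 0" for y by (simp add: renewal_time_def)
  from assms(2) obtain k where "t - s < renewal_time x (Suc k)" by blast
  then have "t < renewal_time (case_nat s x) (Suc (Suc k))" by (simp add: shift)
  moreover have "\<not> t < renewal_time (case_nat s x) (Suc 0)"
    using assms(1) by (simp add: shift zero)
  ultimately have "(LEAST k. t < renewal_time (case_nat s x) (Suc k))
      = Suc (LEAST k. t < renewal_time (case_nat s x) (Suc (Suc k)))"
    by (rule Least_Suc)
  also have "(LEAST k. t < renewal_time (case_nat s x) (Suc (Suc k))) = (LEAST k. t - s < renewal_time x (Suc k))"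
    by (simp add: shift algebra_simps)
  finally have "(LEAST k. t < renewal_time (case_nat s x) (Suc k)) = Suc (LEAST k. t - s < renewal_time x (Suc k))" .
  moreover have "(LEAST k. t - s < renewal_time x (Suc k)) = 0" if "t - s < renewal_time x 1"
    using that by (intro Least_equality) auto
  ultimately show ?thesis
    using assms(1) by (auto simp: backward_renewal_time_def shift zero)
qed

section \<open>Residual periods and the joint law of the periods\<close>

locale renewal = real_distribution D for D :: "real measure" +
  assumes pos: "AE s in D. 0 < s"
    and tail: "\<And>b. cdf D b < 1"
begin

lemma measure_Ioi: "measure D {b<..} = 1 - cdf D b"
proof -
  have "measure D (UNIV - {..b}) = 1 - cdf D b"
    using prob_compl[of "{..b}"] by (simp add: cdf_def)
  moreover have "UNIV - {..b} = {b<..}" by auto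
  ultimately show ?thesis by simp
qed

lemma measure_Ioi_pos: "measure D {b<..} > 0"
  using tail[of b] by (simp add: measure_Ioi)

text \<open>The initial state \<open>b\<close> may be any real number: for \<open>b < 0\<close> the first renewal is delayed by \<open>- b\<close>.
  The state space of the chain is therefore all of \<open>\<real>\<close>, without side conditions.\<close>

definition residual :: "real \<Rightarrow> real measure" where
  "residual b = distr (uniform_measure D {b<..}) borel (\<lambda>s. s - b)"

lemma real_distribution_residual: "real_distribution (residual b)"
proof -
  have "emeasure D {b<..} \<noteq> 0"
    using measure_Ioi_pos[of b] by (simp add: emeasure_eq_measure)
  then interpret U: prob_space "uniform_measure D {b<..}"
    by (intro prob_space_uniform_measure) auto
  have "prob_space (residual b)"
    unfolding residual_def by (rule U.prob_space_distr) auto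
  then show ?thesis by (simp add: real_distribution_def real_distribution_axioms_def residual_def)
qed

lemma cdf_residual: "cdf (residual b) = residual_cdf (cdf D) b"
proof
  fix s :: real
  have "cdf (residual b) s = measure (uniform_measure D {b<..}) {..s + b}"
    unfolding cdf_def residual_def
    by (subst measure_distr) (auto intro!: arg_cong2[where f=measure])
  also have "\<dots> = measure D ({b<..} \<inter> {..s + b}) / measure D {b<..}"
    by (rule measure_uniform_measure) (use measure_Ioi_pos[of b] in \<open>auto simp: emeasure_eq_measure\<close>)
  also have "measure D ({b<..} \<inter> {..s + b}) = (if s < 0 then 0 else cdf D (s + b) - cdf D b)"
  proof (cases "s \<le> 0")
    case True
    then have "{b<..} \<inter> {..s + b} = {}" by auto
    with True show ?thesis by auto
  next
    case False
    then have "{b<..} \<inter> {..s + b} = {b<..s + b}" by auto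
    then show ?thesis using False cdf_diff_eq[of b "s + b"] by simp
  qed
  finally show "cdf (residual b) s = residual_cdf (cdf D) b s"
    by (simp add: residual_cdf_def measure_Ioi)
qed

lemma interval_measure_residual_cdf: "interval_measure (residual_cdf (cdf D) b) = residual b"
  using interval_measure_cdf[OF real_distribution_residual, of b] by (simp add: cdf_residual)

lemma integral_residual:
  fixes g :: "real \<Rightarrow> real"
  assumes [measurable]: "g \<in> borel_measurable borel"
  shows "(LINT s|residual b. g s) = (LINT s|D. indicator {b<..} s * g (s - b)) / (1 - cdf D b)"
proof -
  have "(LINT s|residual b. g s) = (LINT s|uniform_measure D {b<..}. g (s - b))"
    unfolding residual_def by (subst integral_distr) auto
  also have "\<dots> = (LINT s|D. (indicator {b<..} s / measure D {b<..}) *\<^sub>R g (s - b))"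
    unfolding uniform_measure_def
  proof (subst integral_density[symmetric])
    show "(LINT s|density D (\<lambda>x. indicator {b<..} x / emeasure D {b<..}). g (s - b))
     = (LINT x|density D (\<lambda>x. ennreal (indicator {b<..} x / measure D {b<..})). g (x - b))"
      using measure_Ioi_pos[of b] divide_ennreal[of 1 "measure D {b<..}"]
      by (intro arg_cong2[where f="lebesgue_integral"] arg_cong2[where f=density] refl)
         (auto simp: fun_eq_iff emeasure_eq_measure indicator_def)
  qed auto
  also have "\<dots> = (LINT s|D. (indicator {b<..} s * g (s - b)) / measure D {b<..})"
    by simp
  also have "\<dots> = (LINT s|D. indicator {b<..} s * g (s - b)) / measure D {b<..}"
    by (rule integral_divide_zero)
  finally show ?thesis by (simp add: measure_Ioi)
qed

abbreviation periods :: "(nat \<Rightarrow> real) measure" where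
  "periods \<equiv> Pi\<^sub>M UNIV (\<lambda>_. D)"

lemma residual_0: "residual 0 = D"
proof (rule cdf_unique[OF real_distribution_residual])
  show "real_distribution D" ..
  have 0: "cdf D s = 0" if "s \<le> 0" for s
    unfolding cdf_def using pos that
    by (subst prob_eq_0) (auto elim!: eventually_mono)
  show "cdf (residual 0) = cdf D"
    by (auto simp: cdf_residual residual_cdf_def fun_eq_iff 0)
qed

lemma period_lengths_eq: "period_lengths (cdf D) b = Pi\<^sub>M UNIV (\<lambda>k. if k = 0 then residual b else D)"
  unfolding period_lengths_def interval_measure_residual_cdf
    interval_measure_cdf[OF real_distribution_axioms] ..

lemma period_lengths_0: "period_lengths (cdf D) 0 = periods"
  unfolding period_lengths_eq residual_0 if_cancel ..

sublocale periods: prob_space periods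
  by (rule prob_space_PiM) (rule prob_space_axioms)

lemma period_lengths_iter:
  "period_lengths (cdf D) b
    = distr (residual b \<Otimes>\<^sub>M periods) (period_lengths (cdf D) b) (\<lambda>(s, \<omega>). case_nat s \<omega>)"
proof -
  interpret R: real_distribution "residual b" by (rule real_distribution_residual)
  show ?thesis unfolding period_lengths_eq
    using distr_case_nat_PiM[of "\<lambda>k. if k = 0 then residual b else D"]
    by (simp add: prob_space_axioms R.prob_space_axioms cong del: if_weak_cong)
qed

lemma space_periods[simp]: "space periods = UNIV"
  by (auto simp: space_PiM)

lemma measure_periods_UNIV[simp]: "measure periods UNIV = 1"
  using periods.prob_space by simp

lemma sets_period_lengths[measurable_cong]: "sets (period_lengths (cdf D) b) = sets (Pi\<^sub>M UNIV (\<lambda>_. borel))"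
  unfolding period_lengths_eq by (intro sets_PiM_cong) (auto simp: residual_def)

lemma sets_periods: "sets periods = sets (Pi\<^sub>M UNIV (\<lambda>_. borel))"
  by (intro sets_PiM_cong) auto

lemma space_period_lengths[simp]: "space (period_lengths (cdf D) b) = UNIV"
  using sets_eq_imp_space_eq[OF sets_period_lengths] by (simp add: space_PiM)

lemma prob_space_period_lengths: "prob_space (period_lengths (cdf D) b)"
  unfolding period_lengths_eq
  using real_distribution_residual real_distribution.axioms(1) prob_space_axioms
  by (intro prob_space_PiM) auto

lemma measurable_case_nat_borel[measurable]:
  "(\<lambda>(s, \<omega>). case_nat s \<omega>) \<in> borel \<Otimes>\<^sub>M Pi\<^sub>M UNIV (\<lambda>_. borel :: real measure) \<rightarrow>\<^sub>M Pi\<^sub>M UNIV (\<lambda>_. borel)"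
proof (rule measurable_PiM_single')
  fix i :: nat
  show "(\<lambda>x. (case x of (s, \<omega>) \<Rightarrow> case_nat s \<omega>) i) \<in> borel \<Otimes>\<^sub>M Pi\<^sub>M UNIV (\<lambda>_. borel :: real measure) \<rightarrow>\<^sub>M borel"
    by (cases i) (simp_all add: case_prod_beta)
qed (auto simp: space_pair_measure space_PiM PiE_iff split: nat.split)

lemma integral_period_lengths_iter:
  fixes h :: "(nat \<Rightarrow> real) \<Rightarrow> real"
  assumes [measurable]: "h \<in> borel_measurable (Pi\<^sub>M UNIV (\<lambda>_. borel))" and bound: "\<And>x. \<bar>h x\<bar> \<le> B"
  shows "(LINT x|period_lengths (cdf D) b. h x)
    = (LINT s|residual b. LINT \<omega>|periods. h (case_nat s \<omega>))"
proof -
  interpret R: real_distribution "residual b" by (rule real_distribution_residual)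
  interpret RP: pair_prob_space "residual b" periods ..
  have [measurable_cong]: "sets periods = sets (Pi\<^sub>M UNIV (\<lambda>_. borel))" by (rule sets_periods)
  have [measurable_cong]: "sets (residual b) = sets borel" by simp
  have "(LINT x|period_lengths (cdf D) b. h x)
     = (LINT p|(residual b \<Otimes>\<^sub>M periods). h (case p of (s, \<omega>) \<Rightarrow> case_nat s \<omega>))"
    by (subst period_lengths_iter, subst integral_distr) measurable
  also have "\<dots> = (LINT s|residual b. LINT \<omega>|periods. h (case_nat s \<omega>))"
    by (subst RP.integral_fst'[symmetric])
       (auto intro!: RP.P.integrable_bounded[of _ B] bound)
  finally show ?thesis .
qed

section \<open>Comparison and uniqueness for the renewal equation\<close>

definition laplace1 :: real where "laplace1 = (LINT s|D. exp (- s))"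

lemma integrable_exp_neg: "integrable D (\<lambda>s. exp (- s))"
  using pos by (intro integrable_const_bound[of _ 1]) (auto elim!: eventually_mono)

lemma laplace1_less_1: "laplace1 < 1"
proof -
  have "0 < (LINT s|D. 1 - exp (- s))"
  proof -
    have "(LINT s|D. 0) < (LINT s|D. 1 - exp (- s))"
    proof (rule integral_less_AE_space)
      show "AE s in D. 0 < 1 - exp (- s)" using pos by eventually_elim simp
    qed (use integrable_exp_neg emeasure_space_1 in auto)
    then show ?thesis by simp
  qed
  also have "\<dots> = 1 - laplace1"
    unfolding laplace1_def using integrable_exp_neg by (subst Bochner_Integration.integral_diff) auto
  finally show ?thesis by simp
qed

text \<open>In the supremum norm weighted by \<open>exp (- t)\<close>, convolution with
  \<open>D\<close> has norm at most the Laplace transform of \<open>D\<close> at 1, which is below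
  1. So the weighted supremum \<open>S\<close> satisfies \<open>S \<le> a + S * laplace1\<close>.
  The bound \<open>M\<close> only makes \<open>S\<close> finite and drops out of the conclusion,
  which yields estimates uniform over truncations.\<close>

lemma renewal_comparison:
  fixes z :: "real \<Rightarrow> real"
  assumes [measurable]: "z \<in> borel_measurable borel"
    and nonneg: "\<And>t. 0 \<le> t \<Longrightarrow> 0 \<le> z t" and bounded: "\<And>t. 0 \<le> t \<Longrightarrow> z t \<le> M" and "0 \<le> a"
    and sub: "\<And>t. 0 \<le> t \<Longrightarrow> z t \<le> a + (LINT s|D. (if s \<le> t then z (t - s) else 0))"
    and "0 \<le> t"
  shows "z t \<le> exp t * a / (1 - laplace1)"
proof -
  define S where "S = (SUP t\<in>{0..}. exp (- t) * z t)"
  have bdd: "bdd_above ((\<lambda>t. exp (- t) * z t) ` {0..})"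
  proof (rule bdd_aboveI2)
    fix u :: real assume "u \<in> {0..}"
    then have "exp (- u) * z u \<le> 1 * M"
      using nonneg[of u] bounded[of u] by (intro mult_mono) auto
    then show "exp (- u) * z u \<le> M" by simp
  qed
  have le_S: "exp (- u) * z u \<le> S" if "0 \<le> u" for u
    unfolding S_def using that by (intro cSUP_upper bdd) auto
  then have z_le: "z u \<le> S * exp u" if "0 \<le> u" for u
    using that by (simp add: exp_minus field_simps)
  have "0 \<le> S" using le_S[of 0] nonneg[of 0] by simp
  have "S \<le> a + S * laplace1"
    unfolding S_def[symmetric]
  proof (subst S_def, rule cSUP_least)
    fix u :: real assume "u \<in> {0..}"
    then have u: "0 \<le> u" by simp
    have "(LINT s|D. (if s \<le> u then z (u - s) else 0)) \<le> (LINT s|D. S * exp u * exp (- s))"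
    proof (rule integral_mono)
      have "\<bar>if s \<le> u then z (u - s) else 0\<bar> \<le> M" for s
        using nonneg[of "u - s"] bounded[of "u - s"] nonneg[of 0] bounded[of 0] by auto
      then show "integrable D (\<lambda>s. if s \<le> u then z (u - s) else 0)"
        by (intro integrable_bounded[of _ M]) auto
      show "(if s \<le> u then z (u - s) else 0) \<le> S * exp u * exp (- s)" for s
        using z_le[of "u - s"] \<open>0 \<le> S\<close> by (auto simp: exp_diff exp_minus field_simps)
    qed (use integrable_exp_neg in auto)
    also have "\<dots> = S * exp u * laplace1" by (simp add: laplace1_def)
    finally have "z u \<le> a + S * exp u * laplace1" using sub[OF u] by linarith
    then have "exp (- u) * z u \<le> exp (- u) * (a + S * exp u * laplace1)"
      by (intro mult_left_mono) auto
    also have "\<dots> = exp (- u) * a + S * laplace1" by (simp add: algebra_simps exp_minus)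
    also have "exp (- u) * a \<le> 1 * a" using u \<open>0 \<le> a\<close> by (intro mult_right_mono) auto
    finally show "exp (- u) * z u \<le> a + S * laplace1" by simp
  qed simp
  then have "S \<le> a / (1 - laplace1)"
    using laplace1_less_1 by (simp add: field_simps)
  then have "S * exp t \<le> a / (1 - laplace1) * exp t" by (intro mult_right_mono) auto
  with z_le[OF \<open>0 \<le> t\<close>] show ?thesis by (simp add: mult.commute)
qed

text \<open>The comparison applied to the absolute value of \<open>z\<close> with
  \<open>a = 0\<close>. For \<open>z\<close> the difference of two bounded solutions this is
  uniqueness.\<close>

lemma renewal_homogeneous_eq_0:
  fixes z :: "real \<Rightarrow> real"
  assumes [measurable]: "z \<in> borel_measurable borel" and bounded: "\<And>t. \<bar>z t\<bar> \<le> M"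
    and eq: "\<And>t. 0 \<le> t \<Longrightarrow> z t = (LINT s|D. (if s \<le> t then z (t - s) else 0))" and "0 \<le> t"
  shows "z t = 0"
proof -
  have "\<bar>z t\<bar> \<le> exp t * 0 / (1 - laplace1)"
  proof (rule renewal_comparison[of "\<lambda>t. \<bar>z t\<bar>" M])
    fix u :: real assume "0 \<le> u"
    have "\<bar>(LINT s|D. (if s \<le> u then z (u - s) else 0))\<bar> \<le> (LINT s|D. \<bar>if s \<le> u then z (u - s) else 0\<bar>)"
      by (rule integral_abs_bound)
    with eq[OF \<open>0 \<le> u\<close>] show "\<bar>z u\<bar> \<le> 0 + (LINT s|D. (if s \<le> u then \<bar>z (u - s)\<bar> else 0))"
      by (simp add: if_distrib cong: if_cong)
  qed (use assms(1,2,4) in auto)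
  then show ?thesis by simp
qed

text \<open>The probability \<open>z t\<close> that all renewal times stay below \<open>t\<close>
  solves the homogeneous renewal equation, by conditioning on the first period, and therefore
  vanishes.\<close>

lemma AE_periods_exceed: "AE x in periods. \<exists>k. t < renewal_time x (Suc k)"
proof -
  have [measurable_cong]: "sets periods = sets (Pi\<^sub>M UNIV (\<lambda>_. borel))" by (rule sets_periods)
  have [measurable]: "\<And>k. (\<lambda>x. renewal_time x k) \<in> borel_measurable (Pi\<^sub>M UNIV (\<lambda>_. borel))"
    by (rule borel_measurable_renewal_time) simp
  define z where "z t = (LINT x|periods. indicator {x. \<forall>k. renewal_time x k \<le> t} x :: real)" for t
  have shift: "renewal_time (case_nat s x) (Suc k) = s + renewal_time x k" for k s x
    unfolding renewal_time_def by (simp add: sum.lessThan_Suc_shift del: sum.lessThan_Suc)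
  have zero: "renewal_time x 0 = 0" for x by (simp add: renewal_time_def)
  have z_bound: "\<bar>z u\<bar> \<le> 1" for u
    unfolding z_def by (rule order.trans[OF integral_abs_bound]) simp
  \<comment> \<open>Because the index 0 is included in the event, \<open>z\<close> vanishes on
    negative arguments, and the convolution restricts itself to \<open>s \<le> u\<close>.\<close>
  have z_neg: "z u = 0" if "u < 0" for u
  proof -
    have "{x. \<forall>k. renewal_time x k \<le> u} = {}"
      using that zero by (auto intro!: exI[of _ 0] simp: not_le)
    then show ?thesis by (simp add: z_def)
  qed
  have "z t = 0" if "0 \<le> t" for t
  proof (rule renewal_homogeneous_eq_0[OF _ z_bound _ that])
    have "(\<lambda>u. LINT x|periods. (if \<forall>k. renewal_time x k \<le> u then 1 else 0 :: real)) \<in> borel_measurable borel"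
      by measurable
    then show "z \<in> borel_measurable borel"
      by (simp add: z_def[abs_def] indicator_def of_bool_def)
    fix u :: real assume u: "0 \<le> u"
    have "(\<forall>k. renewal_time (case_nat s x) k \<le> u) \<longleftrightarrow> (\<forall>k. renewal_time x k \<le> u - s)" for s x
    proof
      assume *: "\<forall>k. renewal_time x k \<le> u - s"
      show "\<forall>k. renewal_time (case_nat s x) k \<le> u"
      proof
        fix k show "renewal_time (case_nat s x) k \<le> u"
          using u * by (cases k) (auto simp: shift zero algebra_simps)
      qed
    qed (metis shift add.commute le_diff_eq)
    then have *: "indicator {x. \<forall>k. renewal_time x k \<le> u} (case_nat s x)
        = (indicator {x. \<forall>k. renewal_time x k \<le> u - s} x :: real)" for s x
      by (simp add: indicator_def)
    have "z u = (LINT s|D. z (u - s))"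
      unfolding z_def *[symmetric]
      by (rule integral_period_lengths_iter[of _ 1 0, unfolded period_lengths_0 residual_0]) auto
    also have "\<dots> = (LINT s|D. (if s \<le> u then z (u - s) else 0))"
      by (intro Bochner_Integration.integral_cong) (auto simp: z_neg)
    finally show "z u = (LINT s|D. (if s \<le> u then z (u - s) else 0))" .
  qed
  with z_neg have "z t = 0" by (cases "t < 0") auto
  then have "measure periods {x. \<forall>k. renewal_time x k \<le> t} = 0"
    by (simp add: z_def)
  moreover have "{x \<in> space periods. \<forall>k. renewal_time x k \<le> t} \<in> sets periods" by measurable
  ultimately have "AE x in periods. x \<notin> {x. \<forall>k. renewal_time x k \<le> t}"
    by (subst (asm) periods.prob_eq_0) auto
  moreover have "\<exists>k. t < renewal_time x (Suc k)" if "\<not> (\<forall>k. renewal_time x k \<le> t)" "0 \<le> t" for x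
  proof -
    from that obtain k where "t < renewal_time x k" by (auto simp: not_le)
    with that(2) zero[of x] show ?thesis by (cases k) auto
  qed
  ultimately show ?thesis
  proof (cases "0 \<le> t")
    case False
    have "AE x in periods. 0 < x 0"
      using AE_PiM_component[of UNIV "\<lambda>_. D" 0 "\<lambda>s. 0 < s"] pos prob_space_axioms by simp
    then show ?thesis
      by eventually_elim (use False in \<open>auto intro!: exI[of _ 0] simp: renewal_time_def\<close>)
  qed (auto elim!: eventually_mono)
qed

section \<open>Transition operators and the first-step equation\<close>

definition evol :: "real \<Rightarrow> (real \<Rightarrow> real) \<Rightarrow> real \<Rightarrow> real" where
  "evol t g b = (LINT x|backward_renewal_law (cdf D) b t. g x)"

lemma measurable_backward[measurable]: "(\<lambda>(t, x). backward_renewal_time b t x) \<in> borel_measurable (borel \<Otimes>\<^sub>M Pi\<^sub>M UNIV (\<lambda>_. borel))"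
  by (rule borel_measurable_backward_renewal_time) simp

lemma real_distribution_law: "real_distribution (backward_renewal_law (cdf D) b t)"
proof -
  interpret L: prob_space "period_lengths (cdf D) b" by (rule prob_space_period_lengths)
  have "prob_space (backward_renewal_law (cdf D) b t)"
    unfolding backward_renewal_law_def by (rule L.prob_space_distr) measurable
  then show ?thesis
    by (simp add: real_distribution_def real_distribution_axioms_def backward_renewal_law_def)
qed

lemma evol_eq:
  assumes [measurable]: "g \<in> borel_measurable borel"
  shows "evol t g b = (LINT x|period_lengths (cdf D) b. g (backward_renewal_time b t x))"
  unfolding evol_def backward_renewal_law_def by (subst integral_distr) measurable

lemma evol_0_eq:
  assumes "g \<in> borel_measurable borel"
  shows "evol t g 0 = (LINT x|periods. g (backward_renewal_time 0 t x))"
  using evol_eq[OF assms, of t 0] by (simp add: period_lengths_0)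

lemma measurable_evol_0[measurable (raw)]:
  assumes [measurable]: "g \<in> borel_measurable borel" "f \<in> borel_measurable N"
  shows "(\<lambda>x. evol (f x) g 0) \<in> borel_measurable N"
proof -
  have [measurable_cong]: "sets periods = sets (Pi\<^sub>M UNIV (\<lambda>_. borel))" by (rule sets_periods)
  have "(\<lambda>t. LINT x|periods. g (backward_renewal_time 0 t x)) \<in> borel_measurable borel"
    by measurable
  then have "(\<lambda>t. evol t g 0) \<in> borel_measurable borel"
    by (simp add: evol_0_eq)
  from measurable_compose[OF assms(2) this] show ?thesis .
qed

lemma abs_evol_le:
  assumes "\<And>x. \<bar>g x\<bar> \<le> M" shows "\<bar>evol t g b\<bar> \<le> M"
proof -
  interpret L: real_distribution "backward_renewal_law (cdf D) b t" by (rule real_distribution_law)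
  have "0 \<le> M" using assms[of 0] by linarith
  have "\<bar>evol t g b\<bar> \<le> (LINT x|backward_renewal_law (cdf D) b t. \<bar>g x\<bar>)"
    unfolding evol_def by (rule integral_abs_bound)
  also have "\<dots> \<le> (LINT x|backward_renewal_law (cdf D) b t. M)"
    by (rule integral_mono') (use assms \<open>0 \<le> M\<close> in auto)
  finally show ?thesis by simp
qed

text \<open>Before the end \<open>s\<close> of the current period the age grows deterministically;
  from \<open>s\<close> on the process is a fresh one started at age 0 with time
  \<open>t - s\<close> left. The restart identity fails only on the null set where the renewal times
  accumulate.\<close>

lemma evol_residual:
  assumes "bounded_borel g" "0 \<le> t"
  shows "evol t g b = (LINT s|residual b. (if t < s then g (b + t) else evol (t - s) g 0))"
proof -
  interpret R: real_distribution "residual b" by (rule real_distribution_residual)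
  have [measurable_cong]: "sets periods = sets (Pi\<^sub>M UNIV (\<lambda>_. borel))" by (rule sets_periods)
  from assms obtain B where B: "\<And>x. \<bar>g x\<bar> \<le> B" by (auto simp: bounded_borel_def)
  have [measurable]: "g \<in> borel_measurable borel" by (rule bounded_borelD) fact
  have "evol t g b = (LINT s|residual b. LINT \<omega>|periods. g (backward_renewal_time b t (case_nat s \<omega>)))"
    unfolding evol_eq[OF \<open>g \<in> borel_measurable borel\<close>]
    by (rule integral_period_lengths_iter[of _ B]) (measurable, rule B)
  also have "\<dots> = (LINT s|residual b. (if t < s then g (b + t) else evol (t - s) g 0))"
  proof (intro Bochner_Integration.integral_cong refl)
    fix s
    show "(LINT \<omega>|periods. g (backward_renewal_time b t (case_nat s \<omega>)))
        = (if t < s then g (b + t) else evol (t - s) g 0)"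
    proof (cases "t < s")
      case True
      then have "backward_renewal_time b t (case_nat s \<omega>) = b + t" for \<omega>
        by (simp add: backward_renewal_time_def renewal_time_def)
      with True show ?thesis by simp
    next
      case False
      have "(LINT \<omega>|periods. g (backward_renewal_time b t (case_nat s \<omega>)))
        = (LINT \<omega>|periods. g (backward_renewal_time 0 (t - s) \<omega>))"
      proof (rule integral_cong_AE)
        show "AE \<omega> in periods. g (backward_renewal_time b t (case_nat s \<omega>)) = g (backward_renewal_time 0 (t - s) \<omega>)"
          using AE_periods_exceed[of "t - s"]
          by eventually_elim (use False backward_renewal_time_case_nat in auto)
      qed measurable
      with False show ?thesis by (simp add: evol_0_eq)
    qed
  qed
  finally show ?thesis .
qed

text \<open>Here \<open>s\<close> is the full length of the current period, which began at time
  \<open>- b\<close>. Integrating against the fixed measure \<open>D\<close> instead of the residual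
  law leaves \<open>b\<close> only in the integrand and the denominator, so measurability in
  \<open>b\<close> can be read off.\<close>

lemma first_step:
  assumes "bounded_borel g" "0 \<le> t"
  shows "evol t g b
    = (LINT s|D. (if s \<le> b then 0 else if b + t < s then g (b + t) else evol (b + t - s) g 0)) / (1 - cdf D b)"
proof -
  have [measurable]: "g \<in> borel_measurable borel" by (rule bounded_borelD) fact
  have "(LINT s|residual b. (if t < s then g (b + t) else evol (t - s) g 0))
    = (LINT s|D. indicator {b<..} s * (if t < s - b then g (b + t) else evol (t - (s - b)) g 0)) / (1 - cdf D b)"
    by (rule integral_residual) measurable
  also have "(LINT s|D. indicator {b<..} s * (if t < s - b then g (b + t) else evol (t - (s - b)) g 0))
    = (LINT s|D. (if s \<le> b then 0 else if b + t < s then g (b + t) else evol (b + t - s) g 0))"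
    by (intro Bochner_Integration.integral_cong) (auto simp: indicator_def algebra_simps)
  finally show ?thesis using evol_residual[OF assms] by simp
qed

lemma first_step_0:
  assumes "bounded_borel g" "0 \<le> t"
  shows "evol t g 0 = (LINT s|D. (if t < s then g t else evol (t - s) g 0))"
  using evol_residual[OF assms, of 0] unfolding residual_0 by (simp cong: if_cong)

end

subsection \<open>Markov property and drift\<close>

context renewal
begin

lemma borel_measurable_cdf[measurable]: "cdf D \<in> borel_measurable borel"
  by (intro borel_measurable_mono monoI cdf_nondecreasing)

lemma cdf_0[simp]: "cdf D 0 = 0"
  unfolding cdf_def using pos by (subst prob_eq_0) (auto elim!: eventually_mono)

lemma bounded_borel_evol:
  assumes "bounded_borel g" "0 \<le> t"
  shows "bounded_borel (evol t g)"
  unfolding bounded_borel_def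
proof
  have [measurable]: "g \<in> borel_measurable borel" by (rule bounded_borelD) fact
  have "(\<lambda>b. (LINT s|D. (if s \<le> b then 0 else if b + t < s then g (b + t) else evol (b + t - s) g 0))
      / (1 - cdf D b)) \<in> borel_measurable borel"
    by measurable
  also have "(\<lambda>b. (LINT s|D. (if s \<le> b then 0 else if b + t < s then g (b + t) else evol (b + t - s) g 0))
      / (1 - cdf D b)) = evol t g"
    using first_step[OF assms] by (simp add: fun_eq_iff)
  finally show "evol t g \<in> borel_measurable borel" .
  show "\<exists>M. \<forall>x. \<bar>evol t g x\<bar> \<le> M"
    using bounded_borelD(2)[OF assms(1)] abs_evol_le by metis
qed

lemma integrable_law:
  assumes "bounded_borel g"
  shows "integrable (backward_renewal_law (cdf D) b t) g"
proof -
  interpret L: real_distribution "backward_renewal_law (cdf D) b t" by (rule real_distribution_law)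
  from assms obtain M where "\<And>x. \<bar>g x\<bar> \<le> M" by (auto simp: bounded_borel_def)
  then show ?thesis
    using bounded_borelD(1)[OF assms] by (intro L.integrable_bounded[of _ M]) auto
qed

lemma evol_mono:
  assumes "bounded_borel g" "bounded_borel h" "\<And>x. g x \<le> h x"
  shows "evol t g b \<le> evol t h b"
  unfolding evol_def by (intro integral_mono integrable_law assms)

lemma evol_diff: "bounded_borel g \<Longrightarrow> bounded_borel h \<Longrightarrow> evol t (\<lambda>x. g x - h x) b = evol t g b - evol t h b"
  unfolding evol_def by (intro Bochner_Integration.integral_diff integrable_law)

lemma evol_minus: "evol t (\<lambda>x. - g x) b = - evol t g b"
  unfolding evol_def by simp

lemma evol_const[simp]: "evol t (\<lambda>_. c) b = c"
proof -
  interpret L: real_distribution "backward_renewal_law (cdf D) b t" by (rule real_distribution_law)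
  show ?thesis by (simp add: evol_def)
qed

lemma evol_at_0:
  assumes "bounded_borel g" shows "evol 0 g b = g b"
proof -
  interpret R: real_distribution "residual b" by (rule real_distribution_residual)
  have "AE s in residual b. 0 < s"
    unfolding residual_def
    by (subst AE_distr_iff) (auto intro!: AE_uniform_measureI)
  then have "(LINT s|residual b. (if 0 < s then g (b + 0) else evol (0 - s) g 0)) = (LINT s|residual b. g b)"
    using bounded_borelD(1)[OF assms]
    by (intro integral_cong_AE) (auto elim!: eventually_mono)
  then show ?thesis using evol_residual[OF assms, of 0 b] by simp
qed

lemma integral_tail_const: "(LINT s|D. (if b < s then c else 0)) = c * (1 - cdf D b)"
proof -
  have "(LINT s|D. (if b < s then c else 0)) = (LINT s|D. c * indicator {b<..} s)"
    by (intro Bochner_Integration.integral_cong) auto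
  then show ?thesis by (simp add: measure_Ioi)
qed

text \<open>Both terms are expanded at the first renewal. Where the current period outlasts time
  \<open>t\<close> the contributions agree, since conditioning on \<open>s > b\<close> and then on
  \<open>s > b + t\<close> is conditioning on the latter. What remains are the periods ending in
  between, after which only the process started at 0 enters.\<close>

lemma evol_evol_diff:
  assumes g: "bounded_borel g" and t: "0 \<le> t" and h: "0 \<le> h"
  shows "(evol t (evol h g) b - evol (t + h) g b) * (1 - cdf D b)
    = (LINT s|D. (if b < s \<and> s \<le> b + t then evol (b + t - s) (evol h g) 0 - evol (b + t - s + h) g 0 else 0))"
proof -
  note [measurable] = bounded_borelD(1)[OF g] bounded_borelD(1)[OF bounded_borel_evol[OF g h]]
  obtain M where M: "\<And>x. \<bar>g x\<bar> \<le> M" using g by (auto simp: bounded_borel_def)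
  note M2 = abs_evol_le[of "evol h g" M, OF abs_evol_le[of g M, OF M]]
  have "0 \<le> M" using M[of 0] by linarith
  define X where "X s = (if s \<le> b then 0 else if b + t + h < s then g (b + t + h) else evol (b + t + h - s) g 0)" for s
  define Y where "Y s = (if s \<le> b then 0 else if b + t < s then evol h g (b + t) else evol (b + t - s) (evol h g) 0)" for s
  \<comment> \<open>\<open>X1\<close> and \<open>Y1\<close> are the parts with
    \<open>s > b + t\<close>. Their integrals coincide by the first-step equation at age
    \<open>b + t\<close> with time \<open>h\<close>.\<close>
  define X1 where "X1 s = (if s \<le> b + t then 0 else X s)" for s
  define Y1 where "Y1 s = (if b + t < s then evol h g (b + t) else 0)" for s
  have [measurable]: "X \<in> borel_measurable borel" "Y \<in> borel_measurable borel"
    "X1 \<in> borel_measurable borel" "Y1 \<in> borel_measurable borel"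
    unfolding X1_def[abs_def] Y1_def[abs_def] X_def[abs_def] Y_def[abs_def] by measurable
  have bnd: "\<bar>X s\<bar> \<le> M" "\<bar>Y s\<bar> \<le> M" for s
    using M M2 abs_evol_le[of g M, OF M] \<open>0 \<le> M\<close> by (auto simp: X_def Y_def)
  moreover have "\<bar>X1 s\<bar> \<le> M" "\<bar>Y1 s\<bar> \<le> M" for s
    using bnd abs_evol_le[of g M, OF M] \<open>0 \<le> M\<close> by (auto simp: X1_def Y1_def)
  ultimately have int: "integrable D X" "integrable D Y" "integrable D X1" "integrable D Y1"
    by (auto intro!: integrable_bounded[of _ M])
  have "(LINT s|D. X1 s) = evol h g (b + t) * (1 - cdf D (b + t))"
    unfolding first_step[OF g h] X1_def X_def using t tail[of "b + t"]
    by (auto intro!: Bochner_Integration.integral_cong)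
  also have "\<dots> = (LINT s|D. Y1 s)"
    by (simp add: Y1_def integral_tail_const)
  finally have eq: "(LINT s|D. X1 s) = (LINT s|D. Y1 s)" .
  have "(LINT s|D. Y s) = evol t (evol h g) b * (1 - cdf D b)"
    "(LINT s|D. X s) = evol (t + h) g b * (1 - cdf D b)"
    using first_step[OF bounded_borel_evol[OF g h] t, of b] first_step[OF g, of "t + h" b] t h tail[of b]
    by (auto simp: X_def[abs_def] Y_def[abs_def] add.assoc cong: if_cong)
  then have "(evol t (evol h g) b - evol (t + h) g b) * (1 - cdf D b) = (LINT s|D. Y s) - (LINT s|D. X s)"
    by (simp add: algebra_simps)
  also have "\<dots> = (LINT s|D. Y s - Y1 s) - (LINT s|D. X s - X1 s)"
    using int eq by simp
  also have "\<dots> = (LINT s|D. (Y s - Y1 s) - (X s - X1 s))"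
    using int by (intro Bochner_Integration.integral_diff[symmetric]) auto
  also have "\<dots> = (LINT s|D. (if b < s \<and> s \<le> b + t then evol (b + t - s) (evol h g) 0 - evol (b + t - s + h) g 0 else 0))"
    using t h by (intro Bochner_Integration.integral_cong refl)
      (auto simp: X_def Y_def X1_def Y1_def algebra_simps)
  finally show ?thesis .
qed

text \<open>For the start 0 the preceding identity is a homogeneous renewal equation for the
  difference \<open>z\<close>, so \<open>z\<close> vanishes; for a general start the integrand on
  its right side is then 0.\<close>

theorem evol_semigroup:
  assumes g: "bounded_borel g" and t: "0 \<le> t" and h: "0 \<le> h"
  shows "evol t (evol h g) b = evol (t + h) g b"
proof -
  note [measurable] = bounded_borelD(1)[OF g] bounded_borelD(1)[OF bounded_borel_evol[OF g h]]
  obtain M where M: "\<And>x. \<bar>g x\<bar> \<le> M" using g by (auto simp: bounded_borel_def)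
  define z where "z u = evol u (evol h g) 0 - evol (u + h) g 0" for u
  have z0: "z u = 0" if "0 \<le> u" for u
  proof (rule renewal_homogeneous_eq_0[OF _ _ _ that])
    show [measurable]: "z \<in> borel_measurable borel" unfolding z_def[abs_def] by measurable
    show "\<bar>z v\<bar> \<le> 2 * M" for v
      using abs_evol_le[of g M "v + h" 0, OF M] abs_evol_le[of "evol h g" M v 0, OF abs_evol_le[of g M, OF M]]
      unfolding z_def by linarith
    fix v :: real assume v: "0 \<le> v"
    have "z v = (LINT s|D. (if 0 < s \<and> s \<le> v then z (v - s) else 0))"
      using evol_evol_diff[OF g v h, of 0] by (simp add: z_def cong: if_cong)
    also have "\<dots> = (LINT s|D. (if s \<le> v then z (v - s) else 0))"
    proof (rule integral_cong_AE)
      show "AE s in D. (if 0 < s \<and> s \<le> v then z (v - s) else 0) = (if s \<le> v then z (v - s) else 0)"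
        using pos by eventually_elim simp
    qed measurable
    finally show "z v = (LINT s|D. (if s \<le> v then z (v - s) else 0))" .
  qed
  have "(evol t (evol h g) b - evol (t + h) g b) * (1 - cdf D b) = (LINT s|D. 0)"
    unfolding evol_evol_diff[OF g t h]
    using z0 by (intro Bochner_Integration.integral_cong) (auto simp: z_def)
  with tail[of b] show ?thesis by simp
qed

end

section \<open>Lyapunov function and drift inequality\<close>

locale exp_renewal = renewal +
  fixes \<alpha> :: real
  assumes alpha_pos: "0 < \<alpha>" and integrable_exp: "integrable D (\<lambda>s. exp (\<alpha> * s))"
begin

definition V :: "real \<Rightarrow> real" where
  "V b = (LINT s|D. (if b < s then exp (\<alpha> * (s - b)) else 0)) / (1 - cdf D b)"

lemma integrable_exp_tail: "integrable D (\<lambda>s. if b < s then exp (\<alpha> * (s - b)) else 0)"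
proof (rule Bochner_Integration.integrable_bound)
  show "integrable D (\<lambda>s. exp (- \<alpha> * b) * exp (\<alpha> * s))"
    using integrable_exp by simp
qed (auto simp: algebra_simps mult_exp_exp)

lemma V_mult_tail: "V b * (1 - cdf D b) = (LINT s|D. (if b < s then exp (\<alpha> * (s - b)) else 0))"
  using tail[of b] by (simp add: V_def)

lemma V_ge_1: "1 \<le> V b"
proof -
  have "(LINT s|D. (if b < s then 1 else 0)) \<le> (LINT s|D. (if b < s then exp (\<alpha> * (s - b)) else 0))"
    using alpha_pos by (intro integral_mono integrable_exp_tail) (auto intro!: integrable_bounded[of _ 1])
  then show ?thesis
    using tail[of b] by (simp add: integral_tail_const V_def field_simps)
qed

lemma borel_measurable_V[measurable]: "V \<in> borel_measurable borel"
  unfolding V_def[abs_def] by measurable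

lemma bounded_borel_min_V: "bounded_borel (\<lambda>x. min (V x) (real n))"
  unfolding bounded_borel_def
proof
  show "\<exists>M. \<forall>x. \<bar>min (V x) (real n)\<bar> \<le> M"
  proof (intro exI allI)
    show "\<bar>min (V x) (real n)\<bar> \<le> real n" for x using V_ge_1[of x] by simp
  qed
qed measurable

text \<open>The bound of \<open>renewal_comparison\<close> at time 1 with source term
  \<open>a\<close> equal to the exponential moment of the period.\<close>

definition drift_const :: real where
  "drift_const = exp 1 * (LINT s|D. exp (\<alpha> * s)) / (1 - laplace1)"

lemma drift_const_nonneg: "0 \<le> drift_const"
  unfolding drift_const_def using laplace1_less_1 by simp

text \<open>In the renewal equation for the process started at 0 the source at time \<open>v\<close>
  is at most \<open>V v\<close> times the tail at \<open>v\<close>. In this product the conditioning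
  cancels, and what is left is at most the exponential moment of the period, uniformly in
  \<open>v\<close> and \<open>n\<close>.\<close>

lemma evol_min_V_0_le:
  assumes "0 \<le> u" "u \<le> 1"
  shows "evol u (\<lambda>x. min (V x) (real n)) 0 \<le> drift_const"
proof -
  let ?g = "\<lambda>x. min (V x) (real n)"
  let ?m = "LINT s|D. exp (\<alpha> * s)"
  have g_nonneg: "0 \<le> ?g x" for x using V_ge_1[of x] by simp
  have nonneg: "0 \<le> evol v ?g 0" for v
    unfolding evol_def by (rule Bochner_Integration.integral_nonneg) (rule g_nonneg)
  have le_n: "evol v ?g 0 \<le> real n" for v
    using abs_evol_le[of ?g "real n" v 0] g_nonneg by auto
  have "evol u ?g 0 \<le> exp u * ?m / (1 - laplace1)"
  proof (rule renewal_comparison[where z="\<lambda>u. evol u ?g 0" and M="real n"])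
    fix v :: real assume v: "0 \<le> v"
    have "evol v ?g 0 = (LINT s|D. (if v < s then ?g v else 0) + (if s \<le> v then evol (v - s) ?g 0 else 0))"
      unfolding first_step_0[OF bounded_borel_min_V v] by (intro Bochner_Integration.integral_cong) auto
    also have "\<dots> = (LINT s|D. (if v < s then ?g v else 0)) + (LINT s|D. (if s \<le> v then evol (v - s) ?g 0 else 0))"
      using g_nonneg nonneg le_n
      by (intro Bochner_Integration.integral_add integrable_bounded[of _ "real n"]) auto
    also have "(LINT s|D. (if v < s then ?g v else 0)) \<le> ?m"
    proof -
      have "(LINT s|D. (if v < s then ?g v else 0)) \<le> V v * (1 - cdf D v)"
        unfolding integral_tail_const using tail[of v] by (intro mult_right_mono) auto
      also have "\<dots> \<le> ?m"
        unfolding V_mult_tail using v alpha_pos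
        by (intro integral_mono integrable_exp_tail integrable_exp) auto
      finally show ?thesis .
    qed
    finally show "evol v ?g 0 \<le> ?m + (LINT s|D. (if s \<le> v then evol (v - s) ?g 0 else 0))" by simp
  qed (use assms(1) nonneg le_n in auto)
  also have "\<dots> \<le> drift_const"
    unfolding drift_const_def using assms laplace1_less_1
    by (intro divide_right_mono mult_right_mono) auto
  finally show ?thesis .
qed

text \<open>If no renewal occurs within one unit of time, the remaining life shrinks by 1:
  multiplying by the tails removes the conditioning and \<open>V (b + 1)\<close> contributes at most
  \<open>exp (- \<alpha>) * V b\<close>. Otherwise the process restarts at 0 with at most one unit
  of time left, which costs at most \<open>drift_const\<close>.\<close>

lemma drift_min:
  "evol 1 (\<lambda>x. min (V x) (real n)) b \<le> exp (- \<alpha>) * V b + drift_const"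
proof -
  let ?g = "\<lambda>x. min (V x) (real n)"
  have g_nonneg: "0 \<le> ?g x" for x using V_ge_1[of x] by simp
  have b_evol: "\<bar>evol v ?g 0\<bar> \<le> real n" for v
    using abs_evol_le[of ?g "real n" v 0] g_nonneg by auto
  have "evol 1 ?g b * (1 - cdf D b)
     = (LINT s|D. (if s \<le> b then 0 else if b + 1 < s then ?g (b + 1) else evol (b + 1 - s) ?g 0))"
    using first_step[OF bounded_borel_min_V, of 1 n b] tail[of b] by simp
  also have "\<dots> \<le> (LINT s|D. (if b + 1 < s then V (b + 1) else 0) + (if b < s then drift_const else 0))"
  proof (rule integral_mono)
    show "integrable D (\<lambda>s. if s \<le> b then 0 else if b + 1 < s then ?g (b + 1) else evol (b + 1 - s) ?g 0)"
      using g_nonneg b_evol by (intro integrable_bounded[of _ "real n"]) auto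
    show "integrable D (\<lambda>s. (if b + 1 < s then V (b + 1) else 0) + (if b < s then drift_const else 0))"
      using V_ge_1[of "b + 1"] drift_const_nonneg by (intro integrable_bounded[of _ "V (b + 1) + drift_const"]) auto
    show "(if s \<le> b then 0 else if b + 1 < s then ?g (b + 1) else evol (b + 1 - s) ?g 0)
      \<le> (if b + 1 < s then V (b + 1) else 0) + (if b < s then drift_const else 0)" for s
      using evol_min_V_0_le[of "b + 1 - s" n] drift_const_nonneg by auto
  qed
  also have "\<dots> = (LINT s|D. (if b + 1 < s then V (b + 1) else 0)) + (LINT s|D. (if b < s then drift_const else 0))"
    by (intro Bochner_Integration.integral_add integrable_bounded[of _ "V (b + 1) + drift_const"])
       (use V_ge_1[of "b + 1"] drift_const_nonneg in auto)
  also have "\<dots> = V (b + 1) * (1 - cdf D (b + 1)) + drift_const * (1 - cdf D b)"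
    by (simp add: integral_tail_const)
  also have "V (b + 1) * (1 - cdf D (b + 1)) \<le> (LINT s|D. exp (- \<alpha>) * (if b < s then exp (\<alpha> * (s - b)) else 0))"
    unfolding V_mult_tail
    using alpha_pos by (intro integral_mono integrable_exp_tail integrable_mult_right)
       (auto simp: mult_exp_exp algebra_simps)
  also have "\<dots> = exp (- \<alpha>) * V b * (1 - cdf D b)"
    by (simp add: V_mult_tail mult.assoc)
  finally have "evol 1 ?g b * (1 - cdf D b) \<le> (exp (- \<alpha>) * V b + drift_const) * (1 - cdf D b)"
    by (simp add: algebra_simps)
  then show ?thesis using tail[of b] by simp
qed

text \<open>Monotone convergence along the truncations; this is the passage from bounded functions
  to \<open>V\<close> itself.\<close>

lemma V_integral_from_min:
  assumes "\<And>n. evol t (\<lambda>x. min (V x) (real n)) b \<le> B"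
  shows "integrable (backward_renewal_law (cdf D) b t) V" and "(LINT x|backward_renewal_law (cdf D) b t. V x) \<le> B"
proof -
  let ?L = "backward_renewal_law (cdf D) b t"
  interpret L: real_distribution ?L by (rule real_distribution_law)
  let ?i = "\<lambda>n. LINT x|?L. min (V x) (real n)"
  have inc: "incseq ?i"
    by (intro incseq_SucI integral_mono integrable_law bounded_borel_min_V) auto
  have "?i n \<le> B" for n using assms[of n] by (simp add: evol_def)
  then obtain l where l: "?i \<longlonglongrightarrow> l"
    using incseq_convergent[OF inc, of B] by blast
  have lim: "(\<lambda>n. min (V x) (real n)) \<longlonglongrightarrow> V x" for x
  proof (rule tendsto_eventually)
    show "\<forall>\<^sub>F n in sequentially. min (V x) (real n) = V x"
      using eventually_ge_at_top[of "nat \<lceil>V x\<rceil>"]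
    proof eventually_elim
      fix n assume "nat \<lceil>V x\<rceil> \<le> n"
      then have "V x \<le> real n" by linarith
      then show "min (V x) (real n) = V x" by simp
    qed
  qed
  have meas: "V \<in> borel_measurable ?L" by measurable
  have mono: "AE x in ?L. mono (\<lambda>n. min (V x) (real n))"
    by (auto simp: mono_def min_def intro: of_nat_mono order.trans)
  note conv = integrable_monotone_convergence[OF integrable_law[OF bounded_borel_min_V] mono AE_I2[OF lim] l meas]
    integral_monotone_convergence[OF integrable_law[OF bounded_borel_min_V] mono AE_I2[OF lim] l meas]
  show "integrable ?L V" by (rule conv)
  show "(LINT x|?L. V x) \<le> B"
    unfolding conv(2) using l assms by (intro LIMSEQ_le_const2[OF l]) (auto simp: evol_def)
qed

text \<open>The one-step bound is integrated after the induction hypothesis has been applied at the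
  state reached at time 1. The additive constant is a partial sum of a geometric series, hence
  bounded in \<open>k\<close>.\<close>

lemma drift:
  "evol (real k) (\<lambda>x. min (V x) (real n)) b
    \<le> exp (- \<alpha>) ^ k * V b + drift_const * (1 - exp (- \<alpha>) ^ k) / (1 - exp (- \<alpha>))"
proof (induction k arbitrary: b)
  case 0
  then show ?case by (simp add: evol_at_0[OF bounded_borel_min_V])
next
  case (Suc k)
  let ?g = "\<lambda>x. min (V x) (real n)"
  let ?C = "drift_const * (1 - exp (- \<alpha>) ^ k) / (1 - exp (- \<alpha>))"
  let ?L = "backward_renewal_law (cdf D) b 1"
  interpret L: real_distribution ?L by (rule real_distribution_law)
  note V = V_integral_from_min[OF drift_min, of b]
  have "evol (real (Suc k)) ?g b = evol 1 (evol (real k) ?g) b"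
    using evol_semigroup[OF bounded_borel_min_V, of 1 "real k" n b] by (simp add: add.commute)
  also have "\<dots> \<le> (LINT x|?L. exp (- \<alpha>) ^ k * V x + ?C)"
    unfolding evol_def[of 1]
    using V(1) Suc.IH by (intro integral_mono) (auto intro!: integrable_law bounded_borel_evol bounded_borel_min_V)
  also have "\<dots> = exp (- \<alpha>) ^ k * (LINT x|?L. V x) + ?C"
    using V(1) by simp
  also have "\<dots> \<le> exp (- \<alpha>) ^ k * (exp (- \<alpha>) * V b + drift_const) + ?C"
    using V(2) by (intro add_right_mono mult_left_mono) auto
  finally have le: "evol (real (Suc k)) ?g b \<le> exp (- \<alpha>) ^ Suc k * V b + (exp (- \<alpha>) ^ k * drift_const + ?C)"
    by (simp add: algebra_simps)
  have "exp (- \<alpha>) < 1" using alpha_pos by simp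
  then have "exp (- \<alpha>) ^ k * drift_const + ?C = drift_const * (1 - exp (- \<alpha>) ^ Suc k) / (1 - exp (- \<alpha>))"
    by (simp add: field_simps)
  with le show ?case by simp
qed

end

subsection \<open>Absolutely continuous part of the period distribution\<close>

text \<open>At a point \<open>x\<close> of positive derivative the distribution function is strictly
  smaller on the left, so the quantile function \<open>I\<close> sends \<open>cdf M x\<close> back
  to \<open>x\<close>, unless that level is 0 or 1. The image thus lies, up to two points, in the
  preimage of \<open>E\<close> under \<open>I\<close>, whose Lebesgue measure is the
  \<open>M\<close>-measure of \<open>E\<close>.\<close>

lemma (in cdf_distribution) negligible_cdf_image:
  assumes [measurable]: "E \<in> sets borel" and null: "emeasure M E = 0"
    and der: "\<And>x. x \<in> E \<Longrightarrow> \<exists>d>0. (cdf M has_real_derivative d) (at x)"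
  shows "negligible (cdf M ` E)"
proof -
  let ?\<Omega> = "restrict_space lborel {0<..<1::real}"
  have [measurable]: "I \<in> borel_measurable ?\<Omega>"
    using measurable_CI by (simp add: measurable_def space_restrict_space sets_restrict_space)
  have "emeasure ?\<Omega> (I -` E \<inter> space ?\<Omega>) = emeasure (distr ?\<Omega> borel I) E"
    by (rule emeasure_distr[symmetric]) measurable
  then have "emeasure ?\<Omega> (I -` E \<inter> {0<..<1}) = 0"
    by (simp add: distr_I_eq_M null space_restrict_space)
  moreover have "I -` E \<inter> {0<..<1} \<in> sets ?\<Omega>"
    using measurable_sets[OF \<open>I \<in> borel_measurable ?\<Omega>\<close> \<open>E \<in> sets borel\<close>] by (simp add: space_restrict_space)
  ultimately have "I -` E \<inter> {0<..<1} \<in> null_sets lborel"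
    by (subst (asm) emeasure_restrict_space) (auto simp: sets_restrict_space null_sets_def)
  then have negl: "negligible (I -` E \<inter> {0<..<1})"
    by (simp add: negligible_iff_null_sets null_sets_completionI)
  have "cdf M ` E \<subseteq> {0, 1} \<union> (I -` E \<inter> {0<..<1})"
  proof
    fix u assume "u \<in> cdf M ` E"
    then obtain x where x: "x \<in> E" "u = cdf M x" by auto
    have "0 \<le> u" "u \<le> 1" using x cdf_nonneg cdf_bounded_prob by auto
    moreover have "I u = x" if u: "0 < u" "u < 1"
    proof (rule ccontr)
      have "I u \<le> x" using pseudoinverse'[rule_format, of u x] u x by simp
      moreover assume "I u \<noteq> x"
      ultimately have less: "I u < x" by simp
      from der[OF x(1)] obtain d where "d > 0" "(cdf M has_real_derivative d) (at x)" by auto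
      from DERIV_pos_inc_left[OF this(2,1)] obtain \<delta> where \<delta>: "\<delta> > 0"
        "\<And>h. 0 < h \<Longrightarrow> h < \<delta> \<Longrightarrow> cdf M (x - h) < cdf M x" by blast
      define h where "h = min (\<delta> / 2) (x - I u)"
      have "cdf M (x - h) < cdf M x" using \<delta>(1) less by (intro \<delta>(2)) (auto simp: h_def)
      moreover have "u \<le> cdf M (I u)" using pseudoinverse'[rule_format, of u "I u"] u by simp
      moreover have "cdf M (I u) \<le> cdf M (x - h)" by (rule cdf_nondecreasing) (auto simp: h_def)
      ultimately show False using x by simp
    qed
    ultimately show "u \<in> {0, 1} \<union> (I -` E \<inter> {0<..<1})"
      using x(1) by (cases "u = 0 \<or> u = 1") auto
  qed
  with negl show ?thesis by (metis negligible_Un negligible_insert negligible_empty negligible_subset)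
qed

text \<open>The distribution function is injective on \<open>E\<close>, so by change of variables
  the integral of its derivative over \<open>E\<close> is the Lebesgue measure of the image, which
  is 0. As the derivative is positive on \<open>E\<close>, the set itself is null.\<close>

lemma (in cdf_distribution) null_of_positive_derivative:
  assumes E[measurable]: "E \<in> sets borel" and null: "emeasure M E = 0"
    and der: "\<And>x. x \<in> E \<Longrightarrow> \<exists>d>0. (cdf M has_real_derivative d) (at x)"
  shows "E \<in> null_sets lborel"
proof -
  obtain d where d: "\<And>x. x \<in> E \<Longrightarrow> d x > 0" "\<And>x. x \<in> E \<Longrightarrow> (cdf M has_real_derivative d x) (at x)"
    using der by metis
  have less: "cdf M x < cdf M y" if "x < y" "y \<in> E" for x y
  proof -
    from DERIV_pos_inc_left[OF d(2,1)[OF that(2)]] obtain \<delta> where \<delta>: "\<delta> > 0"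
      "\<And>h. 0 < h \<Longrightarrow> h < \<delta> \<Longrightarrow> cdf M (y - h) < cdf M y" by blast
    define h where "h = min (\<delta> / 2) (y - x)"
    have "cdf M (y - h) < cdf M y" using \<delta>(1) that by (intro \<delta>(2)) (auto simp: h_def)
    moreover have "cdf M x \<le> cdf M (y - h)" by (rule cdf_nondecreasing) (auto simp: h_def)
    ultimately show ?thesis by simp
  qed
  then have inj: "inj_on (cdf M) E" by (intro linorder_inj_onI) (auto, fastforce)
  have E_leb: "E \<in> sets lebesgue" using E by auto
  have negl: "negligible (cdf M ` E)" by (rule negligible_cdf_image) fact+
  have "(\<lambda>_. 1 :: real) absolutely_integrable_on (cdf M ` E) \<and> integral (cdf M ` E) (\<lambda>_. 1 :: real) = 0"
    using negl by (auto intro: absolutely_integrable_negligible integral_negligible)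
  then have *: "(\<lambda>x. \<bar>d x\<bar> * 1) absolutely_integrable_on E" "integral E (\<lambda>x. \<bar>d x\<bar> * 1) = 0"
    using has_absolute_integral_change_of_variables_1'[OF E_leb has_field_derivative_at_within[OF d(2)] inj, where f="\<lambda>_. 1" and b=0]
    by auto
  then have "(LINT x:E|lebesgue. \<bar>d x\<bar> * 1) = 0"
    by (simp add: set_lebesgue_integral_eq_integral)
  then have "AE x in lebesgue. indicator E x *\<^sub>R (\<bar>d x\<bar> * 1) = 0"
    using *(1) unfolding set_lebesgue_integral_def set_integrable_def
    by (subst (asm) integral_nonneg_eq_0_iff_AE) auto
  then have "AE x in lebesgue. x \<notin> E"
    by eventually_elim (use d(1) in \<open>fastforce simp: indicator_def split: if_splits\<close>)
  then have "E \<in> null_sets lebesgue" using E_leb by (simp add: AE_iff_null_sets)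
  then show ?thesis using E by (simp add: null_sets_def)
qed

text \<open>Let \<open>E\<close> consist of the positive zeros of \<open>f\<close> outside the
  atoms' carrier \<open>J\<close> and the exceptional set \<open>N\<close>. Both parts of the
  decomposition of \<open>D\<close> give \<open>E\<close> mass 0, while the derivative is positive
  on \<open>E\<close>; so \<open>E\<close> is Lebesgue-null.\<close>

lemma obtain_positive_density:
  assumes "real_distribution D" and ns: "no_singular_continuous_component D"
    and der: "AE s in lborel. s > 0 \<longrightarrow> (\<exists>d>0. (cdf D has_real_derivative d) (at s))"
  obtains f :: "real \<Rightarrow> ennreal" where "f \<in> borel_measurable borel" "density lborel f \<le> D"
    "AE s in lborel. 0 < s \<longrightarrow> 0 < f s"
proof -
  interpret cdf_distribution D unfolding cdf_distribution_def by fact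
  from ns obtain f J where f[measurable]: "f \<in> borel_measurable borel" and J: "countable J"
    and D: "\<And>A. A \<in> sets borel \<Longrightarrow> emeasure D A = (\<integral>\<^sup>+x\<in>A. f x \<partial>lborel) + emeasure D (A \<inter> J)"
    unfolding no_singular_continuous_component_def by blast
  have J_null: "J \<in> null_sets lborel" using J by (rule countable_imp_null_set_lborel)
  then have [measurable]: "J \<in> sets borel" by auto
  from der obtain N where N: "N \<in> null_sets lborel"
    "{s. \<not> (s > 0 \<longrightarrow> (\<exists>d>0. (cdf D has_real_derivative d) (at s)))} \<subseteq> N"
    by (auto elim!: AE_E simp: null_sets_def)
  then have [measurable]: "N \<in> sets borel" by auto
  define E where "E = {x. 0 < x \<and> f x = 0} - J - N"
  have [measurable]: "E \<in> sets borel" unfolding E_def by measurable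
  have "emeasure D E = (\<integral>\<^sup>+x\<in>E. f x \<partial>lborel) + emeasure D (E \<inter> J)" by (rule D) measurable
  also have "E \<inter> J = {}" by (auto simp: E_def)
  also have "(\<integral>\<^sup>+x\<in>E. f x \<partial>lborel) = (\<integral>\<^sup>+x. 0 \<partial>(lborel :: real measure))"
    by (intro nn_integral_cong) (auto simp: E_def indicator_def)
  finally have "emeasure D E = 0" by simp
  then have "E \<in> null_sets lborel"
    using N(2) by (intro null_of_positive_derivative) (auto simp: E_def)
  then have "AE s in lborel. s \<notin> E" "AE s in lborel. s \<notin> J" "AE s in lborel. s \<notin> N"
    using J_null N(1) by (auto intro: AE_not_in)
  then have "AE s in lborel. 0 < s \<longrightarrow> 0 < f s"
  proof eventually_elim
    case (elim s)
    then show ?case unfolding E_def using zero_less_iff_neq_zero[of "f s"] by blast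
  qed
  moreover have "density lborel f \<le> D"
  proof (subst le_measure)
    show "\<forall>A\<in>sets (density lborel f). emeasure (density lborel f) A \<le> emeasure D A"
    proof
      fix A assume "A \<in> sets (density lborel f)"
      then have A: "A \<in> sets borel" by simp
      then show "emeasure (density lborel f) A \<le> emeasure D A"
        unfolding D[OF A] by (subst emeasure_density) auto
    qed
  qed simp
  ultimately show ?thesis using that f by blast
qed

subsection \<open>Minorization\<close>

locale spread_renewal = exp_renewal +
  fixes f :: "real \<Rightarrow> ennreal"
  assumes borel_measurable_f[measurable]: "f \<in> borel_measurable borel"
    and density_le: "density lborel f \<le> D"
    and f_pos: "AE s in lborel. 0 < s \<longrightarrow> 0 < f s"
begin

text \<open>The sets where \<open>f\<close> lies below \<open>1 / (n + 1)\<close> decrease to a null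
  set, so one of them is small. The value 1/4 is chosen so that two exceptional sets removed from an
  interval of length at least 1 leave length at least 1/2.\<close>

lemma obtain_density_lower_bound:
  fixes h :: real
  obtains \<eta> G where "\<eta> > 0" "G \<in> sets borel" "G \<subseteq> {0..h}" "measure lborel ({0..h} - G) \<le> 1/4"
    "\<And>s. s \<in> G \<Longrightarrow> ennreal \<eta> \<le> f s"
proof -
  define A where "A n = {s\<in>{0..h}. f s < ennreal (1 / real (Suc n))}" for n
  have [measurable]: "A n \<in> sets borel" for n unfolding A_def by measurable
  have "(\<lambda>n. measure lborel (A n)) \<longlonglongrightarrow> measure lborel (\<Inter>n. A n)"
  proof (rule Lim_measure_decseq)
    show "decseq A"
    proof (rule decseq_SucI)
      fix n
      have "ennreal (1 / real (Suc (Suc n))) \<le> ennreal (1 / real (Suc n))"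
        by (intro ennreal_leI divide_left_mono) auto
      then show "A (Suc n) \<subseteq> A n" unfolding A_def by (auto simp del: of_nat_Suc intro: less_le_trans)
    qed
    fix n
    have "emeasure lborel (A n) \<le> emeasure lborel {0..h}" by (intro emeasure_mono) (auto simp: A_def)
    also have "\<dots> < \<infinity>" by (simp add: emeasure_lborel_Icc_eq)
    finally show "emeasure lborel (A n) \<noteq> \<infinity>" by simp
  qed auto
  moreover have "measure lborel (\<Inter>n. A n) = 0"
  proof -
    have zero: "f s = 0" if "s \<in> (\<Inter>n. A n)" for s
    proof (rule ccontr)
      assume "f s \<noteq> 0"
      then have "\<exists>x>0. ennreal x < f s"
      proof (cases "f s")
        case (real r)
        with \<open>f s \<noteq> 0\<close> have "0 < r" by (cases "r = 0") auto
        with real show ?thesis by (intro exI[of _ "r / 2"]) (auto simp: ennreal_less_iff)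
      next
        case top
        then show ?thesis by (intro exI[of _ 1]) auto
      qed
      then obtain x where x: "x > 0" "ennreal x < f s" by auto
      obtain n where "1 / real (Suc n) < x" using reals_Archimedean[OF x(1)] by (auto simp: inverse_eq_divide)
      then have "ennreal (1 / real (Suc n)) \<le> ennreal x" by (intro ennreal_leI) simp
      moreover have "f s < ennreal (1 / real (Suc n))" using that by (auto simp: A_def)
      ultimately show False using x(2) by (meson less_le_trans less_trans less_irrefl)
    qed
    have "AE s in lborel. s \<notin> (\<Inter>n. A n)"
      using f_pos AE_lborel_singleton[of 0]
    proof eventually_elim
      case (elim s)
      show ?case
      proof
        assume s: "s \<in> (\<Inter>n. A n)"
        then have "0 \<le> s" by (auto simp: A_def)
        with elim zero[OF s] show False by simp
      qed
    qed
    then have "(\<Inter>n. A n) \<in> null_sets lborel"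
      by (subst AE_iff_null_sets) auto
    then show ?thesis by (simp add: measure_def null_sets_def)
  qed
  ultimately have "\<forall>\<^sub>F n in sequentially. measure lborel (A n) < 1/4"
    by (intro order_tendstoD(2)) auto
  then obtain n where n: "measure lborel (A n) < 1/4"
    by (auto simp: eventually_sequentially)
  show ?thesis
  proof (rule that[of "1 / real (Suc n)" "{0..h} - A n"])
    have "{0..h} - ({0..h} - A n) = A n" by (auto simp: A_def)
    then show "measure lborel ({0..h} - ({0..h} - A n)) \<le> 1/4" using n by simp
  qed (auto simp: A_def not_less)
qed

text \<open>\<open>D\<close> dominates the measure with density \<open>f\<close>, and on
  \<open>G\<close> that density is at least \<open>\<eta>\<close>.\<close>

lemma integral_ge_lborel:
  fixes k :: "real \<Rightarrow> real"
  assumes [measurable]: "k \<in> borel_measurable borel" "G \<in> sets borel" and k: "\<And>s. 0 \<le> k s" "\<And>s. k s \<le> B"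
    and G: "G \<subseteq> {0..h}" "\<And>s. s \<in> G \<Longrightarrow> ennreal \<eta> \<le> f s" and "0 \<le> \<eta>"
  shows "\<eta> * (LINT s|lborel. indicator G s * k s) \<le> (LINT s|D. k s)"
proof -
  have int_G: "integrable lborel (\<lambda>s. indicator G s * k s)"
  proof (rule integrableI_bounded_set[where A="{0..h}" and B=B])
    show "AE s in lborel. s \<in> {0..h} \<longrightarrow> norm (indicator G s * k s) \<le> B"
      using k order.trans[OF k(1,2)] by (intro AE_I2) (auto simp: indicator_def)
  qed (use G in \<open>auto simp: emeasure_lborel_Icc_eq indicator_def intro!: AE_I2\<close>)
  have int_D: "integrable D k" using k by (intro integrable_bounded[of _ B]) auto
  have "ennreal (\<eta> * (LINT s|lborel. indicator G s * k s)) = ennreal (LINT s|lborel. \<eta> * (indicator G s * k s))"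
    by simp
  also have "\<dots> = (\<integral>\<^sup>+s. ennreal (\<eta> * (indicator G s * k s)) \<partial>lborel)"
    using int_G k \<open>0 \<le> \<eta>\<close> by (intro nn_integral_eq_integral[symmetric]) auto
  also have "\<dots> \<le> (\<integral>\<^sup>+s. f s * ennreal (k s) \<partial>lborel)"
  proof (rule nn_integral_mono)
    fix s
    show "ennreal (\<eta> * (indicator G s * k s)) \<le> f s * ennreal (k s)"
      using G(2)[of s] k[of s] \<open>0 \<le> \<eta>\<close> by (cases "s \<in> G") (auto simp: ennreal_mult intro: mult_right_mono)
  qed
  also have "\<dots> = (\<integral>\<^sup>+s. ennreal (k s) \<partial>density lborel f)"
    by (rule nn_integral_density[symmetric]) auto
  also have "\<dots> \<le> (\<integral>\<^sup>+s. ennreal (k s) \<partial>D)"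
    by (rule nn_integral_mono_measure) (auto simp: density_le)
  also have "\<dots> = ennreal (LINT s|D. k s)"
    using int_D k by (intro nn_integral_eq_integral) auto
  finally show ?thesis
    using k by (subst (asm) ennreal_le_iff) (auto intro!: integral_nonneg)
qed

text \<open>Age \<open>x\<close> in \<open>[0, 1]\<close> at time \<open>u\<close> is reached by two
  periods with sum \<open>u - x\<close> and a third one longer than 1, an event of probability
  \<open>c\<close>. With both lengths in \<open>G\<close>, the density at \<open>x\<close> is at
  least \<open>\<eta>\<^sup>2 * c\<close> times the convolution of the indicator of \<open>G\<close>
  with itself at \<open>u - x\<close>. A single indicator could vanish there, but the convolution is
  at least 1/2, as \<open>2 \<le> u\<close> gives \<open>1 \<le> u - x\<close>.\<close>

lemma minorization_0:
  fixes h :: real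
  obtains \<delta> where "0 < \<delta>"
    "\<And>\<psi> u. bounded_borel \<psi> \<Longrightarrow> (\<And>x. 0 \<le> \<psi> x) \<Longrightarrow> 2 \<le> u \<Longrightarrow> u \<le> h \<Longrightarrow>
      \<delta> * (LINT x|lborel. indicator {0..1} x * \<psi> x) \<le> evol u \<psi> 0"
proof -
  obtain \<eta> G where \<eta>: "\<eta> > 0" and [measurable]: "G \<in> sets borel" and G: "G \<subseteq> {0..h}"
    and small: "measure lborel ({0..h} - G) \<le> 1/4" and fG: "\<And>s. s \<in> G \<Longrightarrow> ennreal \<eta> \<le> f s"
    using obtain_density_lower_bound[of h] by metis
  define c where "c = 1 - cdf D 1"
  have c: "0 < c" "c \<le> 1" using tail[of 1] cdf_nonneg[of 1] by (auto simp: c_def)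
  show ?thesis
  proof (rule that[of "\<eta>\<^sup>2 * c / 2"])
    show "0 < \<eta>\<^sup>2 * c / 2" using \<eta> c by simp
    fix \<psi> u assume bb: "bounded_borel \<psi>" and nonneg: "\<And>x. 0 \<le> \<psi> x" and u: "2 \<le> u" "u \<le> h"
    have [measurable]: "\<psi> \<in> borel_measurable borel" by (rule bounded_borelD(1)[OF bb])
    obtain M where "\<And>x. \<bar>\<psi> x\<bar> \<le> M" using bounded_borelD(2)[OF bb] by auto
    then have M: "\<psi> x \<le> M" for x by (auto dest: spec[of _ x] simp: abs_le_iff)
    have "0 \<le> M" using nonneg[of 0] M[of 0] by simp
    have evol_nonneg: "0 \<le> evol v \<psi> 0" for v
      unfolding evol_def by (rule Bochner_Integration.integral_nonneg) (rule nonneg)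
    have evol_le: "evol v \<psi> 0 \<le> M" for v
      using abs_evol_le[of \<psi> M v 0] nonneg M by auto
    \<comment> \<open>Up to the factor \<open>\<eta> * c\<close>, the contribution of exactly one
      period with length in \<open>G\<close> before time \<open>w\<close>.\<close>
    define J where "J w = (LINT x|lborel. indicator {0..1} x * \<psi> x * indicator G (w - x))" for w
    have [measurable]: "J \<in> borel_measurable borel" unfolding J_def by measurable
    have J_nonneg: "0 \<le> J w" for w
      unfolding J_def by (rule Bochner_Integration.integral_nonneg) (auto simp: nonneg)
    \<comment> \<open>No renewal at all up to time \<open>v\<close>.\<close>
    have diag: "c * \<psi> v \<le> evol v \<psi> 0" if "0 \<le> v" "v \<le> 1" for v
    proof -
      have "c * \<psi> v \<le> \<psi> v * (1 - cdf D v)"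
        using cdf_nondecreasing[OF that(2)] nonneg[of v] by (simp add: c_def mult.commute mult_left_mono)
      also have "\<dots> = (LINT s|D. (if v < s then \<psi> v else 0))" by (simp add: integral_tail_const)
      also have "\<dots> \<le> (LINT s|D. (if v < s then \<psi> v else evol (v - s) \<psi> 0))"
        using nonneg M evol_nonneg evol_le \<open>0 \<le> M\<close>
        by (intro integral_mono integrable_bounded[of _ M]) auto
      finally show ?thesis using first_step_0[OF bb that(1)] by simp
    qed
    \<comment> \<open>The first period ends in the window \<open>[w - 1, w]\<close> and the second
      one is still running at time \<open>w\<close>.\<close>
    have one: "\<eta> * c * J w \<le> evol w \<psi> 0" if "0 \<le> w" for w
    proof -
      let ?k = "\<lambda>s. if s \<le> w \<and> w - 1 \<le> s then c * \<psi> (w - s) else 0"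
      have k: "0 \<le> ?k s" "?k s \<le> c * M" for s
        using c nonneg M \<open>0 \<le> M\<close> by (auto intro: mult_left_mono)
      have "\<eta> * c * J w = \<eta> * (c * (LINT s|lborel. indicator {0..1} (w - s) * \<psi> (w - s) * indicator G s))"
        unfolding J_def by (subst lborel_integral_real_affine[where t=w and c="-1"]) auto
      also have "\<dots> = \<eta> * (LINT s|lborel. c * (indicator {0..1} (w - s) * \<psi> (w - s) * indicator G s))" by simp
      also have "\<dots> = \<eta> * (LINT s|lborel. indicator G s * ?k s)"
        by (rule arg_cong[where f="\<lambda>x. \<eta> * x"], rule Bochner_Integration.integral_cong) (auto simp: indicator_def)
      also have "\<dots> \<le> (LINT s|D. ?k s)"
        using \<eta> k by (intro integral_ge_lborel[where B="c * M", OF _ _ _ _ G fG]) auto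
      also have "\<dots> \<le> (LINT s|D. (if w < s then \<psi> w else evol (w - s) \<psi> 0))"
      proof (rule integral_mono)
        show "integrable D ?k" using k by (intro integrable_bounded[of _ "c * M"]) auto
        show "integrable D (\<lambda>s. if w < s then \<psi> w else evol (w - s) \<psi> 0)"
          using nonneg M evol_nonneg evol_le by (intro integrable_bounded[of _ M]) auto
        show "?k s \<le> (if w < s then \<psi> w else evol (w - s) \<psi> 0)" for s
          using diag[of "w - s"] evol_nonneg[of "w - s"] nonneg by auto
      qed
      finally show ?thesis using first_step_0[OF bb that] by simp
    qed
    then have J_bound: "\<eta> * c * J w \<le> M" if "0 \<le> w" for w using evol_le that by (meson order.trans)
    let ?k = "\<lambda>s. if s \<le> u then \<eta> * c * J (u - s) else 0"
    have k: "0 \<le> ?k s" "?k s \<le> M" for s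
      using \<eta> c J_nonneg J_bound \<open>0 \<le> M\<close> by auto
     \<comment> \<open>A point \<open>s\<close> of \<open>{0..v}\<close> either has both
       \<open>s\<close> and \<open>v - s\<close> in \<open>G\<close>, or one of the two lies in the
       exceptional set, of measure at most 1/4; reflection preserves that measure.\<close>
     have half: "1 / 2 \<le> (LINT s|lborel. indicator G s * indicator G (v - s) :: real)" if v: "1 \<le> v" "v \<le> h" for v
    proof -
      let ?R = "(\<lambda>s. v - s) -` ({0..h} - G)"
      let ?B = "{0..h} - G"
      have finB: "emeasure lborel ?B < \<infinity>"
        by (rule le_less_trans[OF emeasure_mono[of _ "{0..h}"]]) (auto simp: emeasure_lborel_Icc_eq)
      have intB: "integrable lborel (indicator ?B :: real \<Rightarrow> real)" using finB by simp
      have intR: "integrable lborel (\<lambda>s. indicator ?B (v - s) :: real)"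
        using lborel_integrable_real_affine[OF intB, of "-1" v] by simp
      have eqR: "(LINT s|lborel. indicator ?B (v - s) :: real) = measure lborel ?B"
        using lborel_integral_real_affine[of "-1" "indicator ?B :: real \<Rightarrow> real" v] finB by simp
      have intG: "integrable lborel (\<lambda>s. indicator G s * indicator G (v - s) :: real)"
        by (rule integrableI_bounded_set[where A="{0..h}" and B=1])
           (use G in \<open>auto simp: emeasure_lborel_Icc_eq indicator_def intro!: AE_I2\<close>)
      have "v \<le> (LINT s|lborel. indicator {0..v} s)" using v by simp
      also have "\<dots> \<le> (LINT s|lborel. indicator G s * indicator G (v - s) + (indicator ?B s + indicator ?B (v - s)))"
      proof (rule integral_mono)
        show "integrable lborel (indicator {0..v} :: real \<Rightarrow> real)"
          by (simp add: emeasure_lborel_Icc_eq)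
        show "integrable lborel (\<lambda>s. indicator G s * indicator G (v - s) + (indicator ?B s + indicator ?B (v - s)) :: real)"
          by (intro Bochner_Integration.integrable_add intG intB intR)
        show "indicator {0..v} s \<le> (indicator G s * indicator G (v - s) + (indicator ?B s + indicator ?B (v - s)) :: real)" for s
          using v by (auto simp: indicator_def)
      qed
      also have "\<dots> = (LINT s|lborel. indicator G s * indicator G (v - s)) + (measure lborel ?B + measure lborel ?B)"
        using intG intB intR eqR finB by simp
      finally show ?thesis using small v by simp
    qed
    have fubini_int: "integrable (lborel \<Otimes>\<^sub>M lborel) (\<lambda>(s, x). indicator G s * (indicator {0..1} x * \<psi> x * indicator G (u - s - x)))"
    proof (rule integrableI_bounded_set[where A="{0..h} \<times> {0..1}" and B=M])
      show "emeasure (lborel \<Otimes>\<^sub>M lborel) ({0..h} \<times> {0..1::real}) < \<infinity>"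
        by (subst lborel.emeasure_pair_measure_Times) (auto simp: emeasure_lborel_Icc_eq ennreal_mult_less_top)
    qed (use G nonneg M \<open>0 \<le> M\<close> in \<open>auto simp: indicator_def intro!: AE_I2\<close>)
    have psi_int: "integrable lborel (\<lambda>x. indicator {0..1} x * \<psi> x)"
      by (rule integrableI_bounded_set[where A="{0..1}" and B=M]) (use nonneg M in auto)
    have inner_int: "integrable lborel (\<lambda>x. LINT s|lborel. indicator G s * (indicator {0..1} x * \<psi> x * indicator G (u - s - x)))"
      using lborel_pair.integrable_snd[OF fubini_int] by simp
    have "\<eta>\<^sup>2 * c / 2 * (LINT x|lborel. indicator {0..1} x * \<psi> x)
        = \<eta>\<^sup>2 * c * (LINT x|lborel. 1 / 2 * (indicator {0..1} x * \<psi> x))" by simp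
    also have "\<dots> \<le> \<eta>\<^sup>2 * c * (LINT x|lborel. LINT s|lborel. indicator G s * (indicator {0..1} x * \<psi> x * indicator G (u - s - x)))"
    proof (intro mult_left_mono integral_mono inner_int)
      show "integrable lborel (\<lambda>x. 1 / 2 * (indicator {0..1} x * \<psi> x))" using psi_int by simp
      fix x
      have "(LINT s|lborel. indicator G s * (indicator {0..1} x * \<psi> x * indicator G (u - s - x)))
        = (indicator {0..1} x * \<psi> x) * (LINT s|lborel. indicator G s * indicator G (u - x - s))"
        by (subst integral_mult_right_zero[symmetric]) (auto intro!: Bochner_Integration.integral_cong simp: algebra_simps)
      moreover have "1 / 2 * (indicator {0..1} x * \<psi> x) \<le> (LINT s|lborel. indicator G s * indicator G (u - x - s)) * (indicator {0..1} x * \<psi> x)"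
        if "x \<in> {0..1}" using that u nonneg[of x] by (intro mult_right_mono half) auto
      ultimately show "1 / 2 * (indicator {0..1} x * \<psi> x)
        \<le> (LINT s|lborel. indicator G s * (indicator {0..1} x * \<psi> x * indicator G (u - s - x)))"
        by (cases "x \<in> {0..1}") (auto simp: mult.commute)
    qed (use \<eta> c in auto)
    also have "\<dots> = \<eta>\<^sup>2 * c * (LINT s|lborel. LINT x|lborel. indicator G s * (indicator {0..1} x * \<psi> x * indicator G (u - s - x)))"
      using lborel_pair.Fubini_integral[OF fubini_int] by simp
    also have "\<dots> = \<eta> * (LINT s|lborel. \<eta> * c * (indicator G s * J (u - s)))"
      by (simp add: J_def power2_eq_square)
    also have "\<dots> = \<eta> * (LINT s|lborel. indicator G s * ?k s)"
    proof (rule arg_cong[where f="\<lambda>x. \<eta> * x"], rule Bochner_Integration.integral_cong[OF refl])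
      fix s
      \<comment> \<open>\<open>G\<close> contains no negative numbers, so cutting \<open>?k\<close>
        off at \<open>u\<close> loses nothing.\<close>
      have "J (u - s) = 0" if "u < s"
      proof -
        have *: "indicator {0..1} x * \<psi> x * indicator G (u - s - x) = 0" for x
          using subsetD[OF G, of "u - s - x"] that by (cases "u - s - x \<in> G"; cases "x \<in> {0..1}") auto
        show ?thesis unfolding J_def * by simp
      qed
      then show "\<eta> * c * (indicator G s * J (u - s)) = indicator G s * ?k s"
        by (cases "s \<le> u") simp_all
    qed
    also have "\<dots> \<le> (LINT s|D. ?k s)"
      using \<eta> k by (intro integral_ge_lborel[where B=M, OF _ _ _ _ G fG]) auto
    also have "\<dots> \<le> (LINT s|D. (if u < s then \<psi> u else evol (u - s) \<psi> 0))"
    proof (rule integral_mono)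
      show "integrable D ?k" using k by (intro integrable_bounded[of _ M]) auto
      show "integrable D (\<lambda>s. if u < s then \<psi> u else evol (u - s) \<psi> 0)"
        using nonneg M evol_nonneg evol_le by (intro integrable_bounded[of _ M]) auto
      show "?k s \<le> (if u < s then \<psi> u else evol (u - s) \<psi> 0)" for s
        using one[of "u - s"] nonneg by auto
    qed
    also have "\<dots> = evol u \<psi> 0" using first_step_0[OF bb] u by simp
    finally show "\<eta>\<^sup>2 * c / 2 * (LINT x|lborel. indicator {0..1} x * \<psi> x) \<le> evol u \<psi> 0" .
  qed
qed

text \<open>\<open>T\<close> is taken so large that, by Markov's inequality for the exponential
  moment \<open>V b \<le> R\<close>, the residual period exceeds \<open>T\<close> with probability
  at most 1/2. A renewal before \<open>T\<close> leaves between 2 and \<open>T + 2\<close> units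
  until time \<open>n = T + 2\<close>, the range covered by \<open>minorization_0\<close>; this
  gives \<open>\<epsilon> = \<delta> / 2\<close>.\<close>

lemma minorization:
  fixes R :: real
  obtains n :: nat and \<epsilon> where "0 < n" "0 < \<epsilon>"
    "\<And>\<psi> b. bounded_borel \<psi> \<Longrightarrow> (\<And>x. 0 \<le> \<psi> x) \<Longrightarrow> V b \<le> R \<Longrightarrow>
      \<epsilon> * (LINT x|lborel. indicator {0..1} x * \<psi> x) \<le> evol (real n) \<psi> b"
proof -
  obtain T :: nat where T: "2 * R \<le> exp (\<alpha> * real T)"
  proof -
    obtain T :: nat where "2 * R / \<alpha> \<le> real T" using real_arch_simple by blast
    then have "2 * R \<le> \<alpha> * real T" using alpha_pos by (simp add: field_simps)
    also have "\<dots> \<le> exp (\<alpha> * real T)" using exp_ge_add_one_self[of "\<alpha> * real T"] by linarith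
    finally show ?thesis using that by blast
  qed
  obtain \<delta> where \<delta>: "0 < \<delta>"
    and minor: "\<And>\<psi> u. bounded_borel \<psi> \<Longrightarrow> (\<And>x. 0 \<le> \<psi> x) \<Longrightarrow> 2 \<le> u \<Longrightarrow> u \<le> real (T + 2) \<Longrightarrow>
      \<delta> * (LINT x|lborel. indicator {0..1} x * \<psi> x) \<le> evol u \<psi> 0"
    using minorization_0[of "real (T + 2)"] by metis
  show ?thesis
  proof (rule that[of "T + 2" "\<delta> / 2"])
    show "0 < T + 2" "0 < \<delta> / 2" using \<delta> by auto
    fix \<psi> b assume bb: "bounded_borel \<psi>" and nonneg: "\<And>x. 0 \<le> \<psi> x" and "V b \<le> R"
    have [measurable]: "\<psi> \<in> borel_measurable borel" by (rule bounded_borelD(1)[OF bb])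
    obtain M where M: "\<And>x. \<bar>\<psi> x\<bar> \<le> M" using bounded_borelD(2)[OF bb] by auto
    define \<nu> where "\<nu> = (LINT x|lborel. indicator {0..1} x * \<psi> x)"
    have "0 \<le> \<nu>" unfolding \<nu>_def by (rule Bochner_Integration.integral_nonneg) (simp add: nonneg)
    have evol_nonneg: "0 \<le> evol v \<psi> 0" for v
      unfolding evol_def by (rule Bochner_Integration.integral_nonneg) (rule nonneg)
    \<comment> \<open>Markov's inequality, multiplied through by the tail at
      \<open>b\<close>.\<close>
    have "exp (\<alpha> * real T) * (1 - cdf D (b + real T)) = (LINT s|D. (if b + real T < s then exp (\<alpha> * real T) else 0))"
      by (simp add: integral_tail_const)
    also have "\<dots> \<le> V b * (1 - cdf D b)"
      unfolding V_mult_tail using alpha_pos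
      by (intro integral_mono integrable_exp_tail) (auto intro!: integrable_bounded[of _ "exp (\<alpha> * real T)"])
    also have "\<dots> \<le> R * (1 - cdf D b)" using tail[of b] \<open>V b \<le> R\<close> by (intro mult_right_mono) auto
    also have "\<dots> \<le> exp (\<alpha> * real T) / 2 * (1 - cdf D b)" using T tail[of b] by (intro mult_right_mono) auto
    also have "\<dots> = exp (\<alpha> * real T) * ((1 - cdf D b) / 2)" by simp
    finally have "1 - cdf D (b + real T) \<le> (1 - cdf D b) / 2"
      by (subst (asm) mult_le_cancel_left_pos) auto
    then have "\<delta> * \<nu> * ((1 - cdf D b) / 2) \<le> \<delta> * \<nu> * ((1 - cdf D b) - (1 - cdf D (b + real T)))"
      using \<delta> \<open>0 \<le> \<nu>\<close> by (intro mult_left_mono) auto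
    also have "\<dots> = (LINT s|D. (if b < s then \<delta> * \<nu> else 0)) - (LINT s|D. (if b + real T < s then \<delta> * \<nu> else 0))"
      unfolding integral_tail_const by (simp add: algebra_simps)
    also have "\<dots> = (LINT s|D. (if b < s then \<delta> * \<nu> else 0) - (if b + real T < s then \<delta> * \<nu> else 0))"
      using \<delta> \<open>0 \<le> \<nu>\<close> by (intro Bochner_Integration.integral_diff[symmetric] integrable_bounded[of _ "\<delta> * \<nu>"]) auto
    also have "\<dots> \<le> (LINT s|D. (if s \<le> b then 0 else if b + real (T + 2) < s then \<psi> (b + real (T + 2))
        else evol (b + real (T + 2) - s) \<psi> 0))"
    proof (rule integral_mono)
      show "integrable D (\<lambda>s. (if b < s then \<delta> * \<nu> else 0) - (if b + real T < s then \<delta> * \<nu> else 0))"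
        using \<delta> \<open>0 \<le> \<nu>\<close> by (intro integrable_bounded[of _ "\<delta> * \<nu>"]) auto
      show "integrable D (\<lambda>s. if s \<le> b then 0 else if b + real (T + 2) < s then \<psi> (b + real (T + 2))
        else evol (b + real (T + 2) - s) \<psi> 0)"
        using M abs_evol_le[of \<psi> M, OF M] order.trans[OF abs_ge_zero M] by (intro integrable_bounded[of _ M]) auto
      show "(if b < s then \<delta> * \<nu> else 0) - (if b + real T < s then \<delta> * \<nu> else 0)
        \<le> (if s \<le> b then 0 else if b + real (T + 2) < s then \<psi> (b + real (T + 2)) else evol (b + real (T + 2) - s) \<psi> 0)" for s
        using minor[OF bb nonneg, of "b + real (T + 2) - s"] nonneg evol_nonneg by (auto simp: \<nu>_def)
    qed
    also have "\<dots> = evol (real (T + 2)) \<psi> b * (1 - cdf D b)"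
      using first_step[OF bb, of "real (T + 2)" b] tail[of b] by (simp add: add.assoc cong: if_cong)
    finally have "(\<delta> / 2 * \<nu>) * (1 - cdf D b) \<le> evol (real (T + 2)) \<psi> b * (1 - cdf D b)"
      by (simp add: mult_ac)
    then show "\<delta> / 2 * (LINT x|lborel. indicator {0..1} x * \<psi> x) \<le> evol (real (T + 2)) \<psi> b"
      using tail[of b] by (simp add: \<nu>_def)
  qed
qed

end

subsection \<open>Exponential contraction\<close>

text \<open>The assumption says that the supremum of \<open>\<phi> - W\<close> is at most the
  infimum of \<open>\<phi> + W\<close>; any number in between works. A weighted oscillation bound
  thus becomes a weighted supremum bound after subtracting a constant.\<close>

lemma exists_centering_constant:
  fixes \<phi> W :: "'a \<Rightarrow> real"
  assumes "\<And>x y. \<phi> x - \<phi> y \<le> W x + W y"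
  obtains c where "\<And>x. \<bar>\<phi> x - c\<bar> \<le> W x"
proof -
  define c where "c = (SUP x. \<phi> x - W x)"
  have le: "\<phi> x - W x \<le> \<phi> y + W y" for x y using assms[of x y] by linarith
  have "\<phi> x - W x \<le> c" for x
    unfolding c_def using le by (intro cSUP_upper bdd_aboveI2[of _ _ "\<phi> undefined + W undefined"]) auto
  moreover have "c \<le> \<phi> x + W x" for x
    unfolding c_def using le by (intro cSUP_least) auto
  ultimately have "\<bar>\<phi> x - c\<bar> \<le> W x" for x by (smt (verit))
  then show ?thesis by (rule that)
qed

context spread_renewal
begin

text \<open>The assumption on \<open>\<phi>\<close> is a Lipschitz bound for the weighted distance
  \<open>2 + \<beta> * V x + \<beta> * V y\<close> between distinct points. If
  \<open>V x + V y\<close> is at least \<open>R\<close>, the drift alone contracts it. Otherwise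
  both points lie in the sublevel set, where minorization gains \<open>2 * \<epsilon> * L\<close>,
  and \<open>\<beta>\<close> is so small that the additive drift constants give back only half of
  this.\<close>

theorem obtain_contraction:
  obtains n :: nat and \<beta> \<rho> :: real where "0 < n" "0 < \<beta>" "0 < \<rho>" "\<rho> < 1"
    "\<And>\<phi> L x y. bounded_borel \<phi> \<Longrightarrow> 0 \<le> L \<Longrightarrow>
      (\<And>x y. \<phi> x - \<phi> y \<le> L * (2 + \<beta> * V x + \<beta> * V y)) \<Longrightarrow>
      evol (real n) \<phi> x - evol (real n) \<phi> y \<le> \<rho> * L * (2 + \<beta> * V x + \<beta> * V y)"
proof -
  define \<gamma> where "\<gamma> = exp (- \<alpha>)"
  have \<gamma>: "0 < \<gamma>" "\<gamma> < 1" using alpha_pos by (auto simp: \<gamma>_def)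
  \<comment> \<open>The limit of the geometric sum in \<open>drift\<close>, plus 1 so that dividing
    by \<open>K\<close> is possible.\<close>
  define K where "K = drift_const / (1 - \<gamma>) + 1"
  have K: "0 < K" using drift_const_nonneg \<gamma> by (simp add: K_def add_nonneg_pos)
  \<comment> \<open>Chosen so that \<open>2 * K\<close> is at most half of
    \<open>(1 - \<gamma>) * S\<close> once \<open>R \<le> S\<close>; the factor
    \<open>\<gamma>\<close> then becomes \<open>\<gamma>' = (1 + \<gamma>) / 2\<close>.\<close>
  define R where "R = 4 * K / (1 - \<gamma>)"
  have R: "0 < R" using K \<gamma> by (simp add: R_def)
  obtain n :: nat and \<epsilon> where n: "0 < n" and \<epsilon>: "0 < \<epsilon>"
    and minor: "\<And>\<psi> b. bounded_borel \<psi> \<Longrightarrow> (\<And>x. 0 \<le> \<psi> x) \<Longrightarrow> V b \<le> R \<Longrightarrow>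
      \<epsilon> * (LINT x|lborel. indicator {0..1} x * \<psi> x) \<le> evol (real n) \<psi> b"
    using minorization[of R] by metis
  let ?L = "\<lambda>b. backward_renewal_law (cdf D) b (real n)"
  have V_int: "integrable (?L b) V" and V_le: "(LINT x|?L b. V x) \<le> \<gamma> * V b + K" for b
  proof -
    \<comment> \<open>The factor \<open>\<gamma> ^ n\<close> is weakened to \<open>\<gamma>\<close>:
      \<open>n\<close> comes from \<open>R\<close>, so the constants that determine \<open>R\<close>
      must not depend on \<open>n\<close>.\<close>
    have "evol (real n) (\<lambda>x. min (V x) (real m)) b \<le> \<gamma> * V b + K" for m
    proof -
      have "exp (- \<alpha>) ^ n \<le> exp (- \<alpha>) ^ 1"
        using n alpha_pos by (intro power_decreasing) auto
      then have "\<gamma> ^ n * V b \<le> \<gamma> * V b"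
        using V_ge_1[of b] by (intro mult_right_mono) (auto simp: \<gamma>_def)
      moreover have "drift_const * (1 - \<gamma> ^ n) / (1 - \<gamma>) \<le> drift_const * 1 / (1 - \<gamma>)"
        using \<gamma> drift_const_nonneg by (intro divide_right_mono mult_left_mono) auto
      ultimately show ?thesis using drift[of n m b] by (simp add: K_def \<gamma>_def[symmetric])
    qed
    from V_integral_from_min[OF this]
    show "integrable (?L b) V" "(LINT x|?L b. V x) \<le> \<gamma> * V b + K" by auto
  qed
  \<comment> \<open>So that \<open>2 * K * \<beta> = \<epsilon>\<close>.\<close>
  define \<beta> where "\<beta> = \<epsilon> / (2 * K)"
  have \<beta>: "0 < \<beta>" using \<epsilon> K by (simp add: \<beta>_def)
  define \<gamma>' where "\<gamma>' = (1 + \<gamma>) / 2"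
  have \<gamma>': "\<gamma>' < 1" "0 < \<gamma>'" using \<gamma> by (auto simp: \<gamma>'_def)
  \<comment> \<open>The value at \<open>S = R\<close> of the ratio
    \<open>(2 + \<beta> * \<gamma>' * S) / (2 + \<beta> * S)\<close>, which decreases in
    \<open>S\<close>.\<close>
  define \<rho>1 where "\<rho>1 = (2 + \<beta> * \<gamma>' * R) / (2 + \<beta> * R)"
  have \<rho>1: "\<rho>1 < 1" using \<beta> R \<gamma>' by (simp add: \<rho>1_def field_simps add_pos_pos)
  define \<rho> where "\<rho> = max \<rho>1 (max \<gamma> (1 - \<epsilon> / 2))"
  have \<rho>: "0 < \<rho>" "\<rho> < 1" using \<rho>1 \<gamma> \<epsilon> by (auto simp: \<rho>_def)
  have int_indicator: "integrable lborel (\<lambda>x. indicator {0..1} x * g x)" if "bounded_borel g" for g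
  proof -
    from that obtain B where "\<And>x. \<bar>g x\<bar> \<le> B" by (auto simp: bounded_borel_def)
    with bounded_borelD(1)[OF that] show ?thesis
      by (intro integrableI_bounded_set[where A="{0..1}" and B=B]) auto
  qed
  have upper: "evol (real n) \<psi> x \<le> L * (1 + \<beta> * (\<gamma> * V x + K))"
    and upper_minor: "V x \<le> R \<Longrightarrow> evol (real n) \<psi> x
      \<le> \<epsilon> * (LINT x|lborel. indicator {0..1} x * \<psi> x) + L * (1 + \<beta> * (\<gamma> * V x + K)) - \<epsilon> * L"
    if bb: "bounded_borel \<psi>" and L: "0 \<le> L" and le: "\<And>x. \<bar>\<psi> x\<bar> \<le> L * (1 + \<beta> * V x)" for \<psi> L x
  proof -
    interpret P: real_distribution "?L x" by (rule real_distribution_law)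
    obtain B where B: "\<And>x. \<bar>\<psi> x\<bar> \<le> B" using bounded_borelD(2)[OF bb] by auto
    \<comment> \<open>Truncating the weight at \<open>N\<close> makes it bounded, while it still
      dominates \<open>\<psi>\<close> (by \<open>B\<close>) and stays at least
      \<open>L\<close>.\<close>
    define N where "N = max B L"
    let ?W = "\<lambda>x. min (L * (1 + \<beta> * V x)) N"
    have W_ge: "L \<le> ?W x" for x using L \<beta> V_ge_1[of x] by (simp add: N_def algebra_simps)
    have "\<bar>?W x\<bar> \<le> N" for x using W_ge[of x] L by (auto simp: abs_if min_def)
    then have W: "bounded_borel ?W" by (auto simp: bounded_borel_def)
    have WP: "evol (real n) ?W x \<le> L * (1 + \<beta> * (\<gamma> * V x + K))"
    proof -
      have "evol (real n) ?W x \<le> (LINT x|?L x. L * (1 + \<beta> * V x))"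
        unfolding evol_def using V_int[of x] integrable_law[OF W] by (intro integral_mono) auto
      also have "\<dots> = L * (1 + \<beta> * (LINT x|?L x. V x))"
        using V_int[of x] by simp
      also have "\<dots> \<le> L * (1 + \<beta> * (\<gamma> * V x + K))"
        using L \<beta> V_le[of x] by (intro mult_left_mono add_left_mono) auto
      finally show ?thesis .
    qed
    have \<psi>_le: "\<psi> x \<le> ?W x" for x using le[of x] B[of x] by (auto simp: N_def abs_le_iff le_max_iff_disj)
    show "evol (real n) \<psi> x \<le> L * (1 + \<beta> * (\<gamma> * V x + K))"
      using evol_mono[OF bb W \<psi>_le] WP by (rule order.trans)
    assume "V x \<le> R"
    have L_le: "L \<le> (LINT x|lborel. indicator {0..1} x * ?W x)"
    proof -
      have "L = (LINT x|lborel. indicator {0..1::real} x * L)" by simp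
      also have "\<dots> \<le> (LINT x|lborel. indicator {0..1} x * ?W x)"
        using W_ge by (intro integral_mono int_indicator W bounded_borel_const mult_left_mono) auto
      finally show ?thesis .
    qed
    \<comment> \<open>Minorization is applied to the nonnegative gap between weight and
      \<open>\<psi>\<close>. The weight integrates to at least \<open>L\<close> over
      \<open>[0, 1]\<close>, which is the source of the gain \<open>\<epsilon> * L\<close>.\<close>
    have "\<epsilon> * (LINT x|lborel. indicator {0..1} x * (?W x - \<psi> x)) \<le> evol (real n) (\<lambda>x. ?W x - \<psi> x) x"
      using \<psi>_le \<open>V x \<le> R\<close> by (intro minor bounded_borel_diff W bb) (auto simp del: min.bounded_iff)
    also have "\<dots> = evol (real n) ?W x - evol (real n) \<psi> x" by (rule evol_diff[OF W bb])
    also have "(LINT x|lborel. indicator {0..1} x * (?W x - \<psi> x))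
      = (LINT x|lborel. indicator {0..1} x * ?W x) - (LINT x|lborel. indicator {0..1} x * \<psi> x)"
      using int_indicator[OF W] int_indicator[OF bb] by (simp add: right_diff_distrib)
    finally show "evol (real n) \<psi> x
      \<le> \<epsilon> * (LINT x|lborel. indicator {0..1} x * \<psi> x) + L * (1 + \<beta> * (\<gamma> * V x + K)) - \<epsilon> * L"
      using WP mult_left_mono[OF L_le less_imp_le[OF \<epsilon>]] by (simp add: right_diff_distrib)
  qed
  show ?thesis
  proof (rule that[of n \<beta> \<rho>, OF n \<beta> \<rho>])
    fix \<phi> L x y
    assume bb: "bounded_borel \<phi>" and L: "0 \<le> L"
      and osc: "\<And>x y. \<phi> x - \<phi> y \<le> L * (2 + \<beta> * V x + \<beta> * V y)"
    obtain c where c: "\<And>x. \<bar>\<phi> x - c\<bar> \<le> L * (1 + \<beta> * V x)"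
      by (rule exists_centering_constant[of \<phi> "\<lambda>x. L * (1 + \<beta> * V x)"])
         (use osc in \<open>auto simp: algebra_simps\<close>)
    let ?\<psi> = "\<lambda>x. \<phi> x - c"
    have bb': "bounded_borel ?\<psi>" by (intro bounded_borel_diff bb bounded_borel_const)
    have bb'': "bounded_borel (\<lambda>x. - ?\<psi> x)" by (rule bounded_borel_minus[OF bb'])
    have c'': "\<bar>- ?\<psi> x\<bar> \<le> L * (1 + \<beta> * V x)" for x using c by (simp add: abs_minus_commute)
    \<comment> \<open>With opposite signs at \<open>x\<close> and \<open>y\<close> the two integrals
      of \<open>?\<psi>\<close> over \<open>[0, 1]\<close> cancel in the second case.\<close>
    have eq: "evol (real n) \<phi> x - evol (real n) \<phi> y = evol (real n) ?\<psi> x + evol (real n) (\<lambda>x. - ?\<psi> x) y"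
      using evol_diff[OF bb bounded_borel_const, of "real n" c] by (simp only: evol_minus) simp
    define S where "S = V x + V y"
    have S: "0 \<le> S" using V_ge_1[of x] V_ge_1[of y] by (simp add: S_def)
    have target: "\<rho> * L * (2 + \<beta> * V x + \<beta> * V y) = L * (\<rho> * (2 + \<beta> * S))"
      by (simp add: S_def algebra_simps)
    show "evol (real n) \<phi> x - evol (real n) \<phi> y \<le> \<rho> * L * (2 + \<beta> * V x + \<beta> * V y)"
    proof (cases "R \<le> S")
      case True
      have "evol (real n) \<phi> x - evol (real n) \<phi> y \<le> L * (1 + \<beta> * (\<gamma> * V x + K)) + L * (1 + \<beta> * (\<gamma> * V y + K))"
        unfolding eq by (intro add_mono upper bb' bb'' L c c'')
      also have "\<dots> = L * (2 + \<beta> * (\<gamma> * S + 2 * K))" by (simp add: S_def algebra_simps)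
      also have "\<dots> \<le> L * (2 + \<beta> * (\<gamma>' * S))"
      proof -
        have "2 * K = (1 - \<gamma>) / 2 * R" using \<gamma> by (simp add: R_def)
        also have "\<dots> \<le> (1 - \<gamma>) / 2 * S" using True \<gamma> by (intro mult_left_mono) auto
        finally have "\<gamma> * S + 2 * K \<le> \<gamma>' * S" by (simp add: \<gamma>'_def field_simps)
        then show ?thesis using L \<beta> by (intro mult_left_mono add_left_mono) auto
      qed
      also have "\<dots> \<le> L * (\<rho>1 * (2 + \<beta> * S))"
      proof (rule mult_left_mono[OF _ L])
        have "(2 + \<beta> * (\<gamma>' * S)) * (2 + \<beta> * R) \<le> (2 + \<beta> * \<gamma>' * R) * (2 + \<beta> * S)"
        proof -
          have "0 \<le> 2 * \<beta> * ((1 - \<gamma>') * (S - R))" using True \<beta> \<gamma>' by simp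
          then show ?thesis by (simp add: algebra_simps)
        qed
        moreover have "0 < 2 + \<beta> * R" using \<beta> R by (simp add: add_pos_pos)
        ultimately show "2 + \<beta> * (\<gamma>' * S) \<le> \<rho>1 * (2 + \<beta> * S)"
          by (simp add: \<rho>1_def pos_le_divide_eq)
      qed
      also have "\<dots> \<le> L * (\<rho> * (2 + \<beta> * S))"
        using L \<beta> S by (intro mult_left_mono mult_right_mono) (auto simp: \<rho>_def)
      finally show ?thesis unfolding target .
    next
      case False
      then have "V x \<le> R" "V y \<le> R" using V_ge_1[of x] V_ge_1[of y] by (auto simp: S_def)
      have "evol (real n) \<phi> x - evol (real n) \<phi> y
        \<le> (\<epsilon> * (LINT x|lborel. indicator {0..1} x * ?\<psi> x) + L * (1 + \<beta> * (\<gamma> * V x + K)) - \<epsilon> * L)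
        + (\<epsilon> * (LINT x|lborel. indicator {0..1} x * - ?\<psi> x) + L * (1 + \<beta> * (\<gamma> * V y + K)) - \<epsilon> * L)"
        unfolding eq by (rule add_mono[OF upper_minor[OF bb' L c \<open>V x \<le> R\<close>] upper_minor[OF bb'' L c'' \<open>V y \<le> R\<close>]])
      also have "(LINT x|lborel. indicator {0..1} x * - ?\<psi> x) = - (LINT x|lborel. indicator {0..1} x * ?\<psi> x)"
        unfolding mult_minus_right by (rule integral_minus)
      also have "(\<epsilon> * (LINT x|lborel. indicator {0..1} x * ?\<psi> x) + L * (1 + \<beta> * (\<gamma> * V x + K)) - \<epsilon> * L)
        + (\<epsilon> * - (LINT x|lborel. indicator {0..1} x * ?\<psi> x) + L * (1 + \<beta> * (\<gamma> * V y + K)) - \<epsilon> * L)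
        = L * (2 - 2 * \<epsilon> + \<beta> * (\<gamma> * S + 2 * K))" by (simp add: S_def algebra_simps)
      also have "\<dots> = L * ((1 - \<epsilon> / 2) * 2 + \<gamma> * (\<beta> * S))"
        using K by (simp add: \<beta>_def field_simps)
      also have "\<dots> \<le> L * (\<rho> * 2 + \<rho> * (\<beta> * S))"
        using L S \<beta> by (intro mult_left_mono add_mono mult_right_mono) (auto simp: \<rho>_def)
      also have "\<dots> = L * (\<rho> * (2 + \<beta> * S))" by (simp add: algebra_simps)
      finally show ?thesis unfolding target .
    qed
  qed
qed

text \<open>Iterating the contraction handles multiples of \<open>n\<close>. The remaining time
  \<open>r\<close> is absorbed into the test function, which stays in \<open>[0, 1]\<close>, so
  \<open>V\<close> need not be controlled between these times.\<close>

theorem obtain_exponential_rate: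
  obtains C \<kappa> :: real where "0 < C" "0 < \<kappa>"
    "\<And>\<phi> t x y. bounded_borel \<phi> \<Longrightarrow> (\<And>x. 0 \<le> \<phi> x) \<Longrightarrow> (\<And>x. \<phi> x \<le> 1) \<Longrightarrow> 0 \<le> t \<Longrightarrow>
      evol t \<phi> x - evol t \<phi> y \<le> C * (V x + V y) * exp (- \<kappa> * t)"
proof -
  obtain n :: nat and \<beta> \<rho> :: real where n: "0 < n" and \<beta>: "0 < \<beta>" and \<rho>: "0 < \<rho>" "\<rho> < 1"
    and contraction: "\<And>\<phi> L x y. bounded_borel \<phi> \<Longrightarrow> 0 \<le> L \<Longrightarrow>
      (\<And>x y. \<phi> x - \<phi> y \<le> L * (2 + \<beta> * V x + \<beta> * V y)) \<Longrightarrow>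
      evol (real n) \<phi> x - evol (real n) \<phi> y \<le> \<rho> * L * (2 + \<beta> * V x + \<beta> * V y)"
    using obtain_contraction by metis
  have iter: "bounded_borel \<phi> \<Longrightarrow> (\<And>x. 0 \<le> \<phi> x) \<Longrightarrow> (\<And>x. \<phi> x \<le> 1) \<Longrightarrow>
      evol (real (n * m)) \<phi> x - evol (real (n * m)) \<phi> y \<le> \<rho> ^ m * (1/2) * (2 + \<beta> * V x + \<beta> * V y)" for m \<phi> x y
  proof (induction m arbitrary: x y)
    case 0
    \<comment> \<open>A function with values in \<open>[0, 1]\<close> satisfies the oscillation
      bound with \<open>L = 1/2\<close>.\<close>
    have "\<phi> x - \<phi> y \<le> 1" using 0(2)[of y] 0(3)[of x] by linarith
    moreover have "0 \<le> \<beta> * V x" "0 \<le> \<beta> * V y" using V_ge_1[of x] V_ge_1[of y] \<beta> by auto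
    ultimately show ?case by (simp add: evol_at_0[OF 0(1)])
  next
    case (Suc m)
    have "evol (real (n * Suc m)) \<phi> z = evol (real n) (evol (real (n * m)) \<phi>) z" for z
      using evol_semigroup[OF Suc.prems(1), of "real n" "real (n * m)" z] by (simp add: algebra_simps)
    moreover have "evol (real n) (evol (real (n * m)) \<phi>) x - evol (real n) (evol (real (n * m)) \<phi>) y
      \<le> \<rho> * (\<rho> ^ m * (1/2)) * (2 + \<beta> * V x + \<beta> * V y)"
      using Suc.IH[OF Suc.prems] \<rho> by (intro contraction bounded_borel_evol Suc.prems(1)) auto
    ultimately show ?case by simp
  qed
  \<comment> \<open>So that \<open>\<rho>\<close> to the power \<open>t / n\<close> is
    \<open>exp (- \<kappa> * t)\<close>; the factor \<open>1 / \<rho>\<close> in the constant pays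
    for rounding \<open>t / n\<close> down to \<open>m\<close>.\<close>
  define \<kappa> where "\<kappa> = - ln \<rho> / real n"
  have \<kappa>: "0 < \<kappa>" using \<rho> n by (simp add: \<kappa>_def divide_neg_pos)
  show ?thesis
  proof (rule that[of "(1 + \<beta>) / \<rho>" \<kappa>])
    show "0 < (1 + \<beta>) / \<rho>" using \<beta> \<rho> by simp
    show "0 < \<kappa>" by (rule \<kappa>)
    fix \<phi> t x y assume bb: "bounded_borel \<phi>" and \<phi>: "\<And>x. 0 \<le> \<phi> x" "\<And>x. \<phi> x \<le> 1" and t: "0 \<le> (t::real)"
    define m where "m = nat \<lfloor>t / real n\<rfloor>"
    define r where "r = t - real (n * m)"
    have m: "real m \<le> t / real n" "t / real n \<le> real m + 1"
      using t by (auto simp: m_def)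
    then have r: "0 \<le> r" using n by (simp add: r_def field_simps)
    have "0 \<le> evol r \<phi> z" for z
      using evol_mono[OF bounded_borel_const[of 0] bb, of r z] \<phi> by simp
    moreover have "evol r \<phi> z \<le> 1" for z
      using evol_mono[OF bb bounded_borel_const[of 1], of r z] \<phi> by simp
    ultimately have "evol (real (n * m)) (evol r \<phi>) x - evol (real (n * m)) (evol r \<phi>) y
      \<le> \<rho> ^ m * (1/2) * (2 + \<beta> * V x + \<beta> * V y)"
      by (intro iter bounded_borel_evol bb r)
    then have "evol t \<phi> x - evol t \<phi> y \<le> \<rho> ^ m * (1/2) * (2 + \<beta> * V x + \<beta> * V y)"
      using evol_semigroup[OF bb _ r, of "real (n * m)"] by (simp add: r_def)
    also have "\<dots> \<le> (exp (- \<kappa> * t) / \<rho>) * (1/2) * (2 * (1 + \<beta>) * (V x + V y))"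
    proof (intro mult_mono)
      have "\<rho> ^ m = exp (real m * ln \<rho>)" using \<rho> by (simp add: exp_of_nat_mult)
      also have "\<dots> \<le> exp ((t / real n - 1) * ln \<rho>)"
        using m(2) \<rho> by (intro iffD2[OF exp_le_cancel_iff] mult_right_mono_neg) auto
      also have "\<dots> = exp (- \<kappa> * t) / \<rho>"
        using \<rho> by (simp add: \<kappa>_def left_diff_distrib exp_diff)
      finally show "\<rho> ^ m \<le> exp (- \<kappa> * t) / \<rho>" .
      have "0 \<le> \<beta> * V x" "0 \<le> \<beta> * V y" "2 \<le> V x + V y" using V_ge_1[of x] V_ge_1[of y] \<beta> by auto
      then show "2 + \<beta> * V x + \<beta> * V y \<le> 2 * (1 + \<beta>) * (V x + V y)" "0 \<le> 2 + \<beta> * V x + \<beta> * V y"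
        by (auto simp: algebra_simps)
    qed (use \<rho> in auto)
    also have "\<dots> = (1 + \<beta>) / \<rho> * (V x + V y) * exp (- \<kappa> * t)"
      using \<rho> by (simp add: field_simps)
    finally show "evol t \<phi> x - evol t \<phi> y \<le> (1 + \<beta>) / \<rho> * (V x + V y) * exp (- \<kappa> * t)" .
  qed
qed

end

subsection \<open>Stationarity\<close>

context exp_renewal
begin

lemma integrable_id: "integrable D (\<lambda>s. s)"
proof (rule Bochner_Integration.integrable_bound)
  show "integrable D (\<lambda>s. exp (\<alpha> * s) / \<alpha>)" using integrable_exp by simp
  show "AE s in D. norm s \<le> norm (exp (\<alpha> * s) / \<alpha>)"
    using pos
  proof eventually_elim
    case (elim s)
    have "\<alpha> * s \<le> exp (\<alpha> * s)" using exp_ge_add_one_self[of "\<alpha> * s"] by linarith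
    with elim alpha_pos show ?case by (simp add: field_simps)
  qed
qed simp

definition mean :: real where "mean = (LINT s|D. s)"

lemma mean_pos: "0 < mean"
proof -
  have "(LINT s|D. 0) < (LINT s|D. s)"
    using integrable_id pos emeasure_space_1 by (intro integral_less_AE_space) auto
  then show ?thesis by (simp add: mean_def)
qed

sublocale lborel_D: pair_sigma_finite lborel D ..

text \<open>Lebesgue measure is infinite, so integrability on the product must be secured: the
  kernel is bounded and lives on \<open>0 \<le> x \<le> \<bar>s\<bar> + t\<close>, a region whose
  product measure is finite because \<open>D\<close> has a first moment.\<close>

lemma integral_swap:
  fixes k :: "real \<Rightarrow> real \<Rightarrow> real"
  assumes [measurable]: "(\<lambda>(x, s). k x s) \<in> borel_measurable (borel \<Otimes>\<^sub>M borel)"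
    and bound: "\<And>x s. \<bar>k x s\<bar> \<le> M" and supp: "\<And>x s. \<not> (0 \<le> x \<and> x \<le> \<bar>s\<bar> + t) \<Longrightarrow> k x s = 0" and "0 \<le> t"
  shows "(LINT x|lborel. LINT s|D. k x s) = (LINT s|D. LINT x|lborel. k x s)"
    and "integrable lborel (\<lambda>x. LINT s|D. k x s)" and "integrable D (\<lambda>s. LINT x|lborel. k x s)"
    and "\<And>s. integrable lborel (\<lambda>x. k x s)"
proof -
  have [measurable_cong]: "sets (lborel \<Otimes>\<^sub>M D) = sets (borel \<Otimes>\<^sub>M borel)"
    by (intro sets_pair_measure_cong) auto
  have int_abs: "integrable D (\<lambda>s. \<bar>s\<bar> + t)" using integrable_id by simp
  have int: "integrable (lborel \<Otimes>\<^sub>M D) (\<lambda>(x, s). k x s)"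
  proof (rule integrableI_bounded_set[where A="{p. 0 \<le> fst p \<and> fst p \<le> \<bar>snd p\<bar> + t}" and B=M])
    have "{p \<in> space (borel \<Otimes>\<^sub>M borel). 0 \<le> fst p \<and> fst p \<le> \<bar>snd p\<bar> + t} \<in> sets (borel \<Otimes>\<^sub>M (borel :: real measure))"
      by measurable
    then show A: "{p. 0 \<le> fst p \<and> fst p \<le> \<bar>snd p\<bar> + t} \<in> sets (lborel \<Otimes>\<^sub>M D)"
      by (simp add: space_pair_measure sets_pair_measure_cong[of lborel borel D borel])
    have "emeasure (lborel \<Otimes>\<^sub>M D) {p. 0 \<le> fst p \<and> fst p \<le> \<bar>snd p\<bar> + t}
      = (\<integral>\<^sup>+s. emeasure lborel ((\<lambda>x. (x, s)) -` {p. 0 \<le> fst p \<and> fst p \<le> \<bar>snd p\<bar> + t}) \<partial>D)"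
      by (rule lborel_D.emeasure_pair_measure_alt2[OF A])
    also have "\<dots> = (\<integral>\<^sup>+s. ennreal (\<bar>s\<bar> + t) \<partial>D)"
    proof (rule nn_integral_cong)
      fix s
      have "(\<lambda>x. (x, s)) -` {p. 0 \<le> fst p \<and> fst p \<le> \<bar>snd p\<bar> + t} = {0..\<bar>s\<bar> + t}" by auto
      then show "emeasure lborel ((\<lambda>x. (x, s)) -` {p. 0 \<le> fst p \<and> fst p \<le> \<bar>snd p\<bar> + t}) = ennreal (\<bar>s\<bar> + t)"
        using \<open>0 \<le> t\<close> by simp
    qed
    also have "\<dots> = ennreal (LINT s|D. \<bar>s\<bar> + t)"
      using int_abs \<open>0 \<le> t\<close> by (intro nn_integral_eq_integral) auto
    finally show "emeasure (lborel \<Otimes>\<^sub>M D) {p. 0 \<le> fst p \<and> fst p \<le> \<bar>snd p\<bar> + t} < \<infinity>" by simp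
  qed (use bound supp in \<open>auto intro!: AE_I2\<close>)
  show "(LINT x|lborel. LINT s|D. k x s) = (LINT s|D. LINT x|lborel. k x s)"
    using lborel_D.Fubini_integral[OF int] by simp
  show "integrable lborel (\<lambda>x. LINT s|D. k x s)" using lborel_D.integrable_fst[OF int] by simp
  show "integrable D (\<lambda>s. LINT x|lborel. k x s)" using lborel_D.integrable_snd[OF int] by simp
  show "integrable lborel (\<lambda>x. k x s)" for s
    by (rule integrableI_bounded_set[where A="{0..\<bar>s\<bar> + t}" and B=M])
       (use bound supp \<open>0 \<le> t\<close> in \<open>auto intro!: AE_I2\<close>)
qed

text \<open>After the shifts by \<open>t\<close> and \<open>t - s\<close>, the first integral on the left covers exactly the parts of
  \<open>(0, s)\<close> and \<open>(0, t)\<close> that the second one leaves out.\<close>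

lemma stationary_balance:
  fixes g Z :: "real \<Rightarrow> real"
  assumes [measurable]: "g \<in> borel_measurable borel" "Z \<in> borel_measurable borel"
    and bounds: "\<And>x. \<bar>g x\<bar> \<le> M" "\<And>x. \<bar>Z x\<bar> \<le> M" and s: "0 < s" and t: "0 \<le> t"
  shows "(LINT x|lborel. indicator {0<..<s} x * (if x + t < s then g (x + t) else Z (x + t - s)))
      + (LINT v|lborel. indicator {0..t} v * (if v < s then g v else Z (v - s)))
    = (LINT x|lborel. indicator {0<..<s} x * g x) + (LINT v|lborel. indicator {0..t} v * Z v)"
proof -
  have int: "integrable lborel (\<lambda>x. indicator {a..b} x * h x)"
    if [measurable]: "h \<in> borel_measurable borel" and "\<And>x. \<bar>h x\<bar> \<le> M" for a b and h :: "real \<Rightarrow> real"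
    using that by (intro integrableI_bounded_set[where A="{a..b}" and B=M])
      (auto simp: emeasure_lborel_Icc_eq)
  have M: "0 \<le> M" using bounds(1)[of 0] by linarith
  \<comment> \<open>These endpoints treat \<open>s \<le> t\<close> and \<open>t < s\<close> at once;
    intervals such as \<open>{0..s - t}\<close> are simply empty in the wrong case.\<close>
  define p q where "p = min s t" and "q = max (t - s) 0"
  let ?I = "\<lambda>a b (h :: real \<Rightarrow> real). LINT x|lborel. indicator {a..b} x * h x"
  have shift: "(LINT x|lborel. indicator {a..b} x * h (x + c)) = ?I (a + c) (b + c) h" for a b c and h :: "real \<Rightarrow> real"
    by (subst lborel_integral_real_affine[where t="-c" and c=1]) (auto intro!: Bochner_Integration.integral_cong simp: indicator_def)
  have 1: "(LINT x|lborel. indicator {0<..<s} x * (if x + t < s then g (x + t) else Z (x + t - s)))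
     = (LINT x|lborel. indicator {0..s - t} x * g (x + t) + indicator {q + s - t..s} x * Z (x + (t - s)))"
  proof (rule integral_cong_AE)
    show "AE x in lborel. indicator {0<..<s} x * (if x + t < s then g (x + t) else Z (x + t - s))
      = indicator {0..s - t} x * g (x + t) + indicator {q + s - t..s} x * Z (x + (t - s))"
      using AE_lborel_singleton[of 0] AE_lborel_singleton[of s] AE_lborel_singleton[of "s - t"]
      by eventually_elim (use t s in \<open>auto simp: indicator_def q_def algebra_simps\<close>)
  qed measurable
  also have "\<dots> = (LINT x|lborel. indicator {0..s - t} x * g (x + t)) + (LINT x|lborel. indicator {q + s - t..s} x * Z (x + (t - s)))"
    by (intro Bochner_Integration.integral_add int bounds) measurable
  also have "\<dots> = ?I t s g + ?I q t Z"
    unfolding shift by (simp add: algebra_simps)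
  finally have 1: "(LINT x|lborel. indicator {0<..<s} x * (if x + t < s then g (x + t) else Z (x + t - s))) = ?I t s g + ?I q t Z" .
  have 2: "(LINT v|lborel. indicator {0..t} v * (if v < s then g v else Z (v - s)))
     = (LINT v|lborel. indicator {0..p} v * g v + indicator {s..t} v * Z (v + - s))"
  proof (rule integral_cong_AE)
    show "AE v in lborel. indicator {0..t} v * (if v < s then g v else Z (v - s))
      = indicator {0..p} v * g v + indicator {s..t} v * Z (v + - s)"
      using AE_lborel_singleton[of s] by eventually_elim (use t s in \<open>auto simp: indicator_def p_def\<close>)
  qed measurable
  also have "\<dots> = ?I 0 p g + (LINT v|lborel. indicator {s..t} v * Z (v + - s))"
    by (intro Bochner_Integration.integral_add int bounds) measurable
  also have "\<dots> = ?I 0 p g + ?I 0 (t - s) Z"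
    unfolding shift by simp
  finally have 2: "(LINT v|lborel. indicator {0..t} v * (if v < s then g v else Z (v - s))) = ?I 0 p g + ?I 0 (t - s) Z" .
  have "?I t s g + ?I 0 p g = (LINT x|lborel. indicator {t..s} x * g x + indicator {0..p} x * g x)"
    by (intro Bochner_Integration.integral_add[symmetric] int bounds) measurable
  also have "\<dots> = (LINT x|lborel. indicator {0<..<s} x * g x)"
  proof (rule integral_cong_AE)
    show "AE x in lborel. indicator {t..s} x * g x + indicator {0..p} x * g x = indicator {0<..<s} x * g x"
      using AE_lborel_singleton[of 0] AE_lborel_singleton[of s] AE_lborel_singleton[of t]
      by eventually_elim (use t s in \<open>auto simp: indicator_def p_def\<close>)
  qed measurable
  finally have 3: "?I t s g + ?I 0 p g = (LINT x|lborel. indicator {0<..<s} x * g x)" .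
  have "?I q t Z + ?I 0 (t - s) Z = (LINT x|lborel. indicator {q..t} x * Z x + indicator {0..t - s} x * Z x)"
    by (intro Bochner_Integration.integral_add[symmetric] int bounds) measurable
  also have "\<dots> = ?I 0 t Z"
  proof (rule integral_cong_AE)
    show "AE x in lborel. indicator {q..t} x * Z x + indicator {0..t - s} x * Z x = indicator {0..t} x * Z x"
      using AE_lborel_singleton[of 0] AE_lborel_singleton[of "t - s"]
      by eventually_elim (use t s in \<open>auto simp: indicator_def q_def\<close>)
  qed measurable
  finally have 4: "?I q t Z + ?I 0 (t - s) Z = ?I 0 t Z" .
  show ?thesis unfolding 1 2 using 3 4 by linarith
qed

text \<open>By the first-step equation and Fubini, both sides are \<open>D\<close>-integrals of the
  terms \<open>?k1\<close> and \<open>?k2\<close> of \<open>stationary_balance\<close>. The two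
  extra terms there cancel after integration over \<open>s\<close>: integrating \<open>?k3\<close>
  over \<open>D\<close> reproduces \<open>Z\<close> on \<open>[0, t]\<close>, which is the renewal
  equation for the start 0.\<close>

lemma stationary_integral:
  assumes bb: "bounded_borel g" and t: "0 \<le> t"
  shows "(LINT x|lborel. indicator {0<..} x * ((1 - cdf D x) * evol t g x))
    = (LINT x|lborel. indicator {0<..} x * ((1 - cdf D x) * g x))"
proof -
  have g[measurable]: "g \<in> borel_measurable borel" by (rule bounded_borelD(1)[OF bb])
  obtain M where M: "\<And>x. \<bar>g x\<bar> \<le> M" using bounded_borelD(2)[OF bb] by auto
  have "0 \<le> M" using M[of 0] by linarith
  define Z where "Z u = evol u g 0" for u
  have Z[measurable]: "Z \<in> borel_measurable borel" unfolding Z_def[abs_def] by measurable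
  have Z_le: "\<bar>Z u\<bar> \<le> M" for u unfolding Z_def by (rule abs_evol_le) (rule M)
  let ?k1 = "\<lambda>x s. indicator {0<..<s} x * (if x + t < s then g (x + t) else Z (x + t - s))"
  let ?k2 = "\<lambda>x s. indicator {0<..<s} x * g x"
  let ?k3 = "\<lambda>x s. indicator {0..t} x * (if x < s then g x else Z (x - s))"
  have ind: "indicator {0<..<s} x = (if 0 < x \<and> x < s then 1 else 0 :: real)" for x s :: real by (simp add: indicator_def)
  have k1: "(\<lambda>(x, s). ?k1 x s) \<in> borel_measurable (borel \<Otimes>\<^sub>M borel)" unfolding ind by measurable
  have k2: "(\<lambda>(x, s). ?k2 x s) \<in> borel_measurable (borel \<Otimes>\<^sub>M borel)" unfolding ind by measurable
  have k3: "(\<lambda>(x, s). ?k3 x s) \<in> borel_measurable (borel \<Otimes>\<^sub>M borel)" by measurable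
  have b1: "\<bar>?k1 x s\<bar> \<le> M" "\<bar>?k2 x s\<bar> \<le> M" "\<bar>?k3 x s\<bar> \<le> M" for x s
    using M Z_le \<open>0 \<le> M\<close> by (auto simp: indicator_def)
  have s1: "\<not> (0 \<le> x \<and> x \<le> \<bar>s\<bar> + t) \<Longrightarrow> ?k1 x s = 0" "\<not> (0 \<le> x \<and> x \<le> \<bar>s\<bar> + t) \<Longrightarrow> ?k2 x s = 0"
    "\<not> (0 \<le> x \<and> x \<le> \<bar>s\<bar> + t) \<Longrightarrow> ?k3 x s = 0" for x s
    using t by (auto simp: indicator_def)
  note F1 = integral_swap[OF k1 b1(1) s1(1) t] and F2 = integral_swap[OF k2 b1(2) s1(2) t]
    and F3 = integral_swap[OF k3 b1(3) s1(3) t]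
  have lhs: "indicator {0<..} x * ((1 - cdf D x) * evol t g x) = (LINT s|D. ?k1 x s)" for x
  proof (cases "0 < x")
    case True
    have "(1 - cdf D x) * evol t g x = (LINT s|D. (if s \<le> x then 0 else if x + t < s then g (x + t) else Z (x + t - s)))"
      using first_step[OF bb t, of x] tail[of x] by (simp add: Z_def cong: if_cong)
    also have "\<dots> = (LINT s|D. ?k1 x s)"
      using True by (intro Bochner_Integration.integral_cong) (auto simp: indicator_def)
    finally show ?thesis using True by simp
  qed simp
  have rhs: "indicator {0<..} x * ((1 - cdf D x) * g x) = (LINT s|D. ?k2 x s)" for x
  proof (cases "0 < x")
    case True
    have "(1 - cdf D x) * g x = (LINT s|D. (if x < s then g x else 0))" by (simp add: integral_tail_const mult.commute)
    also have "\<dots> = (LINT s|D. ?k2 x s)"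
      using True by (intro Bochner_Integration.integral_cong) (auto simp: indicator_def)
    finally show ?thesis using True by simp
  qed simp
  have ren: "indicator {0..t} x * Z x = (LINT s|D. ?k3 x s)" for x
    using first_step_0[OF bb, of x] by (cases "x \<in> {0..t}") (auto simp: Z_def cong: if_cong)
  have "(LINT s|D. (LINT x|lborel. ?k1 x s) + (LINT x|lborel. ?k3 x s))
     = (LINT s|D. (LINT x|lborel. ?k2 x s) + (LINT v|lborel. indicator {0..t} v * Z v))"
  proof (rule integral_cong_AE)
    show "AE s in D. (LINT x|lborel. ?k1 x s) + (LINT x|lborel. ?k3 x s)
      = (LINT x|lborel. ?k2 x s) + (LINT v|lborel. indicator {0..t} v * Z v)"
      using pos by eventually_elim (rule stationary_balance[OF g Z M Z_le _ t])
  qed (use borel_measurable_integrable[OF F1(3)] borel_measurable_integrable[OF F2(3)]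
      borel_measurable_integrable[OF F3(3)] in auto)
  then have "(LINT s|D. LINT x|lborel. ?k1 x s) + (LINT s|D. LINT x|lborel. ?k3 x s)
     = (LINT s|D. LINT x|lborel. ?k2 x s) + (LINT v|lborel. indicator {0..t} v * Z v)"
    using F1(3) F2(3) F3(3) by simp
  moreover have "(LINT v|lborel. indicator {0..t} v * Z v) = (LINT s|D. LINT x|lborel. ?k3 x s)"
    unfolding ren by (rule F3(1))
  ultimately have "(LINT s|D. LINT x|lborel. ?k1 x s) = (LINT s|D. LINT x|lborel. ?k2 x s)"
    by linarith
  then show ?thesis
    unfolding lhs rhs using F1(1) F2(1) by metis
qed

section \<open>The stationary law in density form\<close>

definition stat :: "real measure" where
  "stat = density lborel (\<lambda>x. ennreal (indicator {0<..} x * ((1 - cdf D x) / mean)))"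

lemma tail_nonneg: "0 \<le> 1 - cdf D x" using tail[of x] by simp

lemma sets_stat[measurable_cong, simp]: "sets stat = sets borel" and space_stat[simp]: "space stat = UNIV"
  by (simp_all add: stat_def)

lemma integral_stat:
  assumes [measurable]: "g \<in> borel_measurable borel"
  shows "(LINT x|stat. g x) = (LINT x|lborel. indicator {0<..} x * ((1 - cdf D x) * g x)) / mean"
proof -
  have "(LINT x|stat. g x) = (LINT x|lborel. (indicator {0<..} x * ((1 - cdf D x) / mean)) *\<^sub>R g x)"
    unfolding stat_def using tail_nonneg mean_pos by (intro integral_density) auto
  also have "\<dots> = (LINT x|lborel. (indicator {0<..} x * ((1 - cdf D x) * g x)) / mean)"
    by (simp add: mult.assoc)
  finally show ?thesis unfolding integral_divide_zero .
qed

text \<open>Layer-cake formula: Fubini for the indicator of \<open>0 < x < s\<close>.\<close>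

lemma tail_integral: "(LINT x|lborel. indicator {0<..} x * (1 - cdf D x)) = mean"
  and integrable_tail: "integrable lborel (\<lambda>x. indicator {0<..} x * (1 - cdf D x))"
proof -
  let ?k = "\<lambda>x s :: real. if 0 < x \<and> x < s then 1 else 0 :: real"
  have "(\<lambda>(x, s). ?k x s) \<in> borel_measurable (borel \<Otimes>\<^sub>M borel)" by measurable
  note F = integral_swap[OF this, of 1 0]
  have eq: "indicator {0<..} x * (1 - cdf D x) = (LINT s|D. ?k x s)" for x
  proof (cases "0 < x")
    case True
    have "(1 - cdf D x) = (LINT s|D. (if x < s then 1 else 0))" by (simp add: integral_tail_const)
    also have "\<dots> = (LINT s|D. ?k x s)"
      using True by (intro Bochner_Integration.integral_cong) (auto simp: indicator_def)
    finally show ?thesis using True by simp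
  qed simp
  show "integrable lborel (\<lambda>x. indicator {0<..} x * (1 - cdf D x))"
    unfolding eq by (rule F(2)) (auto simp: indicator_def)
  have "(LINT x|lborel. indicator {0<..} x * (1 - cdf D x)) = (LINT s|D. LINT x|lborel. ?k x s)"
    unfolding eq by (rule F(1)) (auto simp: indicator_def)
  also have "\<dots> = (LINT s|D. s)"
  proof (rule integral_cong_AE)
    have "(LINT x|lborel. ?k x s) = (LINT x|lborel. indicator {0<..<s} x)" for s
      by (intro Bochner_Integration.integral_cong) (auto simp: indicator_def)
    then show "AE s in D. (LINT x|lborel. ?k x s) = s"
      using pos by (auto elim!: eventually_mono)
    have "integrable D (\<lambda>s. LINT x|lborel. ?k x s)" by (rule F(3)) auto
    then show "(\<lambda>s. LINT x|lborel. ?k x s) \<in> borel_measurable D" by (rule borel_measurable_integrable)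
  qed simp
  finally show "(LINT x|lborel. indicator {0<..} x * (1 - cdf D x)) = mean" by (simp add: mean_def)
qed

lemma real_distribution_stat: "real_distribution stat"
proof -
  have "emeasure stat UNIV = (\<integral>\<^sup>+x. ennreal (indicator {0<..} x * ((1 - cdf D x) / mean)) \<partial>lborel)"
    by (simp add: stat_def emeasure_density)
  also have "\<dots> = ennreal (LINT x|lborel. indicator {0<..} x * (1 - cdf D x) / mean)"
    using integrable_tail tail_nonneg mean_pos by (subst nn_integral_eq_integral) auto
  also have "(LINT x|lborel. indicator {0<..} x * (1 - cdf D x) / mean) = mean / mean"
    unfolding integral_divide_zero tail_integral ..
  finally have "emeasure stat UNIV = 1" using mean_pos by simp
  then show ?thesis
    using prob_spaceI[of stat] by (simp add: real_distribution_def real_distribution_axioms_def)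
qed

lemma cdf_stat: "cdf stat = stationary_cdf (cdf D) mean"
proof
  interpret S: real_distribution stat by (rule real_distribution_stat)
  fix s :: real
  have "cdf stat s = 1 - measure stat {s<..}"
  proof -
    have "{s<..} = UNIV - {..s}" by auto
    then show ?thesis using S.prob_compl[of "{..s}"] by (simp add: cdf_def)
  qed
  also have "measure stat {s<..} = (LINT x|stat. indicator {s<..} x)" by simp
  also have "\<dots> = (LINT x|lborel. indicator {0<..} x * ((1 - cdf D x) * indicator {s<..} x)) / mean"
    by (rule integral_stat) simp
  also have "1 - \<dots> = stationary_cdf (cdf D) mean s"
  proof (cases "s < 0")
    case True
    then have "(LINT x|lborel. indicator {0<..} x * ((1 - cdf D x) * indicator {s<..} x)) = mean"
      unfolding tail_integral[symmetric]
      by (intro Bochner_Integration.integral_cong) (auto simp: indicator_def)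
    then show ?thesis using True mean_pos by (simp add: stationary_cdf_def)
  next
    case False
    have "(LINT x|lborel. indicator {0<..} x * ((1 - cdf D x) * indicator {s<..} x)) = (LINT u:{s..}|lborel. 1 - cdf D u)"
      unfolding set_lebesgue_integral_def
    proof (rule integral_cong_AE)
      show "AE x in lborel. indicator {0<..} x * ((1 - cdf D x) * indicator {s<..} x) = indicator {s..} x *\<^sub>R (1 - cdf D x)"
        using AE_lborel_singleton[of s] by eventually_elim (use False in \<open>auto simp: indicator_def\<close>)
    qed measurable
    then show ?thesis using False by (simp add: stationary_cdf_def)
  qed
  finally show "cdf stat s = stationary_cdf (cdf D) mean s" .
qed

lemma stationary_law_eq: "stationary_law (cdf D) mean = stat"
  unfolding stationary_law_def cdf_stat[symmetric]
  by (rule interval_measure_cdf) (rule real_distribution_stat)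

theorem stationarity:
  assumes "bounded_borel g" "0 \<le> t"
  shows "(LINT x|stat. evol t g x) = (LINT x|stat. g x)"
  using stationary_integral[OF assms] bounded_borelD(1)[OF assms(1)] bounded_borelD(1)[OF bounded_borel_evol[OF assms]]
  by (simp add: integral_stat)

text \<open>The density of \<open>stat\<close> carries the tail that \<open>V\<close> has in its
  denominator, so the product is at most a constant times
  \<open>exp (- \<alpha> * x)\<close>.\<close>

lemma integrable_V_stat: "integrable stat V"
proof -
  let ?m = "LINT s|D. exp (\<alpha> * s)"
  have V_le: "V x * (1 - cdf D x) \<le> exp (- \<alpha> * x) * ?m" for x
  proof -
    have "V x * (1 - cdf D x) \<le> (LINT s|D. exp (- \<alpha> * x) * exp (\<alpha> * s))"
      unfolding V_mult_tail
    proof (rule integral_mono[OF integrable_exp_tail])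
      show "integrable D (\<lambda>s. exp (- \<alpha> * x) * exp (\<alpha> * s))" using integrable_exp by simp
    qed (auto simp: mult_exp_exp algebra_simps)
    then show ?thesis by simp
  qed
  have exp_int: "integrable lborel (exponential_density \<alpha>)"
  proof -
    interpret E: prob_space "density lborel (exponential_density \<alpha>)"
      by (rule prob_space_exponential_density[OF alpha_pos])
    have "(\<integral>\<^sup>+x. ennreal (exponential_density \<alpha> x) \<partial>lborel) = 1"
      using E.emeasure_space_1 by (simp add: emeasure_density)
    then show ?thesis
      using exponential_density_nonneg[OF alpha_pos] by (intro integrableI_nonneg) auto
  qed
  have "integrable lborel (\<lambda>x. (indicator {0<..} x * ((1 - cdf D x) / mean)) *\<^sub>R V x)"
  proof (rule Bochner_Integration.integrable_bound)
    show "integrable lborel (\<lambda>x. ?m / (mean * \<alpha>) * exponential_density \<alpha> x)" using exp_int by simp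
    show "AE x in lborel. norm ((indicator {0<..} x * ((1 - cdf D x) / mean)) *\<^sub>R V x)
      \<le> norm (?m / (mean * \<alpha>) * exponential_density \<alpha> x)"
    proof (rule AE_I2)
      fix x :: real
      have "0 \<le> ?m" by simp
      have "V x * (1 - cdf D x) / mean \<le> exp (- \<alpha> * x) * ?m / mean"
        using V_le[of x] mean_pos by (intro divide_right_mono) auto
      then have "(indicator {0<..} x * ((1 - cdf D x) / mean)) * V x \<le> ?m / (mean * \<alpha>) * exponential_density \<alpha> x" if "0 < x"
        using that mean_pos alpha_pos by (simp add: exponential_density_def mult_ac)
      moreover have "0 \<le> (indicator {0<..} x * ((1 - cdf D x) / mean)) * V x"
        using tail_nonneg[of x] mean_pos V_ge_1[of x] by (auto simp: indicator_def)
      ultimately show "norm ((indicator {0<..} x * ((1 - cdf D x) / mean)) *\<^sub>R V x)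
      \<le> norm (?m / (mean * \<alpha>) * exponential_density \<alpha> x)"
        unfolding real_norm_def real_scaleR_def by (cases "0 < x") (linarith, simp)
    qed
  qed measurable
  then show ?thesis
    unfolding stat_def using tail_nonneg mean_pos by (subst integrable_density) auto
qed

end

subsection \<open>Maximal couplings on the unit interval\<close>

definition uniform01 :: "real measure" where
  "uniform01 = restrict_space lborel {0<..<1}"

lemma space_uniform01[simp]: "space uniform01 = {0<..<1}"
  by (simp add: uniform01_def space_restrict_space)

lemma measurable_uniform01: "h \<in> borel_measurable borel \<Longrightarrow> h \<in> borel_measurable uniform01"
  unfolding uniform01_def by (rule measurable_restrict_space1) simp

lemma emeasure_uniform01: "A \<in> sets borel \<Longrightarrow> emeasure uniform01 ({0<..<1} \<inter> A) = emeasure lborel ({0<..<1} \<inter> A)"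
  unfolding uniform01_def by (subst emeasure_restrict_space) (auto simp: Int_assoc)

lemma prob_space_uniform01: "prob_space uniform01"
  by (auto simp: uniform01_def space_restrict_space emeasure_restrict_space intro!: prob_spaceI)

lemma emeasure_distr_uniform01:
  assumes [measurable]: "h \<in> borel_measurable borel" "A \<in> sets borel"
  shows "emeasure (distr uniform01 borel h) A = emeasure lborel ({0<..<1} \<inter> h -` A)"
proof -
  have "emeasure (distr uniform01 borel h) A = emeasure uniform01 ({0<..<1} \<inter> h -` A)"
    by (subst emeasure_distr) (auto intro: measurable_uniform01 simp: Int_commute)
  also have "\<dots> = emeasure lborel ({0<..<1} \<inter> h -` A)"
    using measurable_sets[of h borel borel A] by (intro emeasure_uniform01) auto
  finally show ?thesis .
qed

text \<open>The quantile transform of the normalized measure, stretched to an interval of length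
  equal to the mass. The coupling has to separate the components for every \<open>u\<close>, so
  \<open>h u\<close> must lie in \<open>H\<close> without exceptions.\<close>

lemma obtain_quantile:
  fixes \<nu> :: "real measure"
  assumes "finite_measure \<nu>" and sets[simp]: "sets \<nu> = sets borel" and [measurable]: "H \<in> sets borel"
    and null: "emeasure \<nu> (- H) = 0"
  obtains h where "h \<in> borel_measurable borel" "\<And>u. 0 < u \<Longrightarrow> u < measure \<nu> UNIV \<Longrightarrow> h u \<in> H"
    "\<And>A. A \<in> sets borel \<Longrightarrow> emeasure lborel ({0<..<measure \<nu> UNIV} \<inter> h -` A) = emeasure \<nu> A"
proof (cases "measure \<nu> UNIV = 0")
  interpret finite_measure \<nu> by fact
  case True
  have "emeasure \<nu> A = 0" if "A \<in> sets borel" for A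
    using emeasure_mono[of A UNIV \<nu>] True by (auto simp: emeasure_eq_measure)
  then show ?thesis using that[of "\<lambda>_. 0"] True by simp
next
  interpret finite_measure \<nu> by fact
  case False
  define a where "a = measure \<nu> UNIV"
  have a: "0 < a" using False by (simp add: a_def zero_less_measure_iff)
  define N where "N = scale_measure (ennreal (1 / a)) \<nu>"
  have N_eq: "emeasure N A = ennreal (1 / a) * emeasure \<nu> A" for A by (simp add: N_def)
  have [simp]: "sets N = sets borel" by (simp add: N_def)
  then have [simp]: "space N = UNIV" by (metis sets_eq_imp_space_eq space_borel)
  have "emeasure N UNIV = 1"
    using a by (simp add: N_eq emeasure_eq_measure a_def[symmetric] ennreal_mult[symmetric])
  then interpret N: cdf_distribution N
    using prob_spaceI[of N] by (simp add: cdf_distribution_def real_distribution_def real_distribution_axioms_def)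
  define J where "J v = (if v \<in> {0<..<1} then N.I v else 0)" for v
  have [measurable]: "J \<in> borel_measurable borel"
    unfolding J_def using N.measurable_CI by (subst measurable_restrict_space_iff[symmetric]) auto
  have J: "emeasure lborel ({0<..<1} \<inter> J -` A) = emeasure N A" if [measurable]: "A \<in> sets borel" for A
  proof -
    have "emeasure lborel ({0<..<1} \<inter> J -` A) = emeasure (distr uniform01 borel J) A"
      by (rule emeasure_distr_uniform01[symmetric]) measurable
    also have "distr uniform01 borel J = distr uniform01 borel N.I"
      by (rule distr_cong) (auto simp: J_def)
    also have "\<dots> = N" unfolding uniform01_def by (rule N.distr_I_eq_M)
    finally show ?thesis .
  qed
  have scaled: "emeasure lborel ({0<..<a} \<inter> (\<lambda>u. J (u / a)) -` A) = emeasure \<nu> A" if [measurable]: "A \<in> sets borel" for A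
  proof -
    have m[measurable]: "{0<..<a} \<inter> (\<lambda>u. J (u / a)) -` A \<in> sets borel" "{0<..<1} \<inter> J -` A \<in> sets borel"
      using measurable_sets[of "\<lambda>u. J (u / a)" borel borel A] measurable_sets[of J borel borel A] by auto
    have "emeasure lborel ({0<..<a} \<inter> (\<lambda>u. J (u / a)) -` A)
      = (\<integral>\<^sup>+u. indicator ({0<..<a} \<inter> (\<lambda>u. J (u / a)) -` A) u \<partial>lborel)"
      by simp
    also have "\<dots> = ennreal a * (\<integral>\<^sup>+u. indicator ({0<..<a} \<inter> (\<lambda>u. J (u / a)) -` A) (0 + a * u) \<partial>lborel)"
      using a by (subst nn_integral_real_affine[where c=a and t=0]) auto
    also have "(\<lambda>u. indicator ({0<..<a} \<inter> (\<lambda>u. J (u / a)) -` A) (0 + a * u) :: ennreal) = indicator ({0<..<1} \<inter> J -` A)"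
      using a by (auto simp: indicator_def fun_eq_iff zero_less_mult_iff)
    also have "(\<integral>\<^sup>+u. indicator ({0<..<1} \<inter> J -` A) u \<partial>lborel) = emeasure N A"
      using J by simp
    also have "ennreal a * emeasure N A = emeasure \<nu> A"
      using a by (simp add: N_eq mult.assoc[symmetric] ennreal_mult[symmetric])
    finally show ?thesis .
  qed
  \<comment> \<open>A fixed point of \<open>H\<close> serves as default value where the quantile
    function leaves \<open>H\<close>; this happens only on a null set and does not change the
    law.\<close>
  have "H \<noteq> {}"
    using null a by (auto simp: a_def emeasure_eq_measure)
  then obtain h0 where h0: "h0 \<in> H" by auto
  define h where "h u = (if J (u / a) \<in> H then J (u / a) else h0)" for u
  have [measurable]: "h \<in> borel_measurable borel" unfolding h_def by measurable
  have "emeasure lborel ({0<..<a} \<inter> h -` A) = emeasure \<nu> A" if [measurable]: "A \<in> sets borel" for A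
  proof -
    have m[measurable]: "{0<..<a} \<inter> (\<lambda>u. J (u / a)) -` B \<in> sets borel" "{0<..<a} \<inter> h -` B \<in> sets borel" if "B \<in> sets borel" for B
      using measurable_sets[of "\<lambda>u. J (u / a)" borel borel B] measurable_sets[of h borel borel B] that by auto
    have "AE u in lborel. u \<notin> {0<..<a} \<inter> (\<lambda>u. J (u / a)) -` (- H)"
      by (rule AE_not_in) (use scaled[of "- H"] null m[of "- H"] in \<open>auto simp: null_sets_def\<close>)
    then have "AE u in lborel. u \<in> {0<..<a} \<inter> h -` A \<longleftrightarrow> u \<in> {0<..<a} \<inter> (\<lambda>u. J (u / a)) -` A"
      by eventually_elim (auto simp: h_def)
    then have "emeasure lborel ({0<..<a} \<inter> h -` A) = emeasure lborel ({0<..<a} \<inter> (\<lambda>u. J (u / a)) -` A)"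
      by (rule emeasure_eq_AE) (use m in auto)
    then show ?thesis using scaled[of A] by simp
  qed
  then show ?thesis using that[of h] h0 by (auto simp: a_def h_def)
qed

lemma emeasure_lborel_vimage_split:
  fixes g h :: "real \<Rightarrow> real"
  assumes [measurable]: "g \<in> borel_measurable borel" "h \<in> borel_measurable borel" "A \<in> sets borel"
    and d: "0 \<le> d" "d \<le> 1"
  shows "emeasure lborel ({0<..<1} \<inter> (\<lambda>u. if u < d then g u else h (u - d)) -` A)
    = emeasure lborel ({0<..<d} \<inter> g -` A) + emeasure lborel ({0<..<1 - d} \<inter> h -` A)"
proof -
  have sets: "{0<..<d} \<inter> g -` A \<in> sets borel" "{0<..<1 - d} \<inter> h -` A \<in> sets borel"
    "{d<..<1} \<inter> (\<lambda>u. h (u - d)) -` A \<in> sets borel"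
    "{0<..<1} \<inter> (\<lambda>u. if u < d then g u else h (u - d)) -` A \<in> sets borel"
    using measurable_sets[of g borel borel A] measurable_sets[of h borel borel A]
      measurable_sets[of "\<lambda>u. h (u - d)" borel borel A]
      measurable_sets[of "\<lambda>u. if u < d then g u else h (u - d)" borel borel A] by auto
  have "emeasure lborel ({0<..<1} \<inter> (\<lambda>u. if u < d then g u else h (u - d)) -` A)
    = emeasure lborel (({0<..<d} \<inter> g -` A) \<union> ({d<..<1} \<inter> (\<lambda>u. h (u - d)) -` A))"
  proof (rule emeasure_eq_AE)
    show "AE u in lborel. u \<in> {0<..<1} \<inter> (\<lambda>u. if u < d then g u else h (u - d)) -` A
      \<longleftrightarrow> u \<in> ({0<..<d} \<inter> g -` A) \<union> ({d<..<1} \<inter> (\<lambda>u. h (u - d)) -` A)"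
      using AE_lborel_singleton[of d] by eventually_elim (use d in auto)
  qed (use sets in auto)
  also have "\<dots> = emeasure lborel ({0<..<d} \<inter> g -` A) + emeasure lborel ({d<..<1} \<inter> (\<lambda>u. h (u - d)) -` A)"
    using sets by (intro plus_emeasure[symmetric]) auto
  also have "emeasure lborel ({d<..<1} \<inter> (\<lambda>u. h (u - d)) -` A)
    = (\<integral>\<^sup>+u. indicator ({d<..<1} \<inter> (\<lambda>u. h (u - d)) -` A) u \<partial>lborel)"
    using sets by simp
  also have "\<dots> = ennreal \<bar>1\<bar> * (\<integral>\<^sup>+u. indicator ({d<..<1} \<inter> (\<lambda>u. h (u - d)) -` A) (d + 1 * u) \<partial>lborel)"
    using sets by (intro nn_integral_real_affine) auto
  also have "(\<lambda>u. indicator ({d<..<1} \<inter> (\<lambda>u. h (u - d)) -` A) (d + 1 * u) :: ennreal) = indicator ({0<..<1 - d} \<inter> h -` A)"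
    by (auto simp: indicator_def fun_eq_iff)
  finally show ?thesis using sets by simp
qed

text \<open>\<open>Y\<close> is the positive set of a Hahn decomposition of \<open>P - Q\<close>. It
  attains the supremum including the absolute value, since equal total masses make a deficit on
  \<open>A\<close> an excess on its complement.\<close>

lemma tv_dist_Hahn:
  assumes P: "real_distribution P" and Q: "real_distribution Q"
  obtains Y where "Y \<in> sets borel" "tv_dist P Q = measure P Y - measure Q Y"
    "\<And>X. X \<in> sets borel \<Longrightarrow> X \<subseteq> Y \<Longrightarrow> measure Q X \<le> measure P X"
    "\<And>X. X \<in> sets borel \<Longrightarrow> X \<inter> Y = {} \<Longrightarrow> measure P X \<le> measure Q X"
proof -
  interpret P: real_distribution P by fact
  interpret Q: real_distribution Q by fact
  obtain Y where Y: "Y \<in> sets borel" and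
    le: "\<And>X. X \<in> sets borel \<Longrightarrow> X \<subseteq> Y \<Longrightarrow> measure Q X \<le> measure P X"
      "\<And>X. X \<in> sets borel \<Longrightarrow> X \<inter> Y = {} \<Longrightarrow> measure P X \<le> measure Q X"
    using finite_unsigned_Hahn_decomposition[of P Q] P.finite_measure_axioms Q.finite_measure_axioms
    by (auto simp: P.emeasure_eq_measure Q.emeasure_eq_measure)
  have split: "measure P A = measure P (A \<inter> B) + measure P (A - B)" "measure Q A = measure Q (A \<inter> B) + measure Q (A - B)"
    if "A \<in> sets borel" "B \<in> sets borel" for A B
  proof -
    have "(A \<inter> B) \<union> (A - B) = A" "(A \<inter> B) \<inter> (A - B) = {}" by auto
    then show "measure P A = measure P (A \<inter> B) + measure P (A - B)" "measure Q A = measure Q (A \<inter> B) + measure Q (A - B)"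
      using P.finite_measure_Union[of "A \<inter> B" "A - B"] Q.finite_measure_Union[of "A \<inter> B" "A - B"] that by auto
  qed
  have "tv_dist P Q = measure P Y - measure Q Y"
    unfolding tv_dist_def
  proof (rule cSup_eq_maximum)
    show "measure P Y - measure Q Y \<in> (\<lambda>A. \<bar>measure P A - measure Q A\<bar>) ` sets borel"
      using Y le(1)[OF Y] by (intro image_eqI[of _ _ Y]) auto
    fix x assume "x \<in> (\<lambda>A. \<bar>measure P A - measure Q A\<bar>) ` sets borel"
    then obtain A where A: "A \<in> sets borel" and x: "x = \<bar>measure P A - measure Q A\<bar>" by auto
    note YA = split[OF Y A, unfolded Int_commute[of Y A]]
    have U: "measure P (- A) = 1 - measure P A" "measure Q (- A) = 1 - measure Q A"
      using P.prob_compl[of A] Q.prob_compl[of A] A by (simp_all add: Compl_eq_Diff_UNIV)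
    have "measure P (A - Y) \<le> measure Q (A - Y)" "measure Q (Y - A) \<le> measure P (Y - A)"
      "measure Q (A \<inter> Y) \<le> measure P (A \<inter> Y)" using A Y by (auto intro!: le)
    moreover have "measure P (- A - Y) \<le> measure Q (- A - Y)" using A Y by (auto intro!: le)
    moreover have "measure P (- A) = measure P (Y - A) + measure P (- A - Y)" "measure Q (- A) = measure Q (Y - A) + measure Q (- A - Y)"
      using split[of "- A" Y] A Y Diff_eq[of Y A] by (auto simp: Int_commute)
    ultimately show "x \<le> measure P Y - measure Q Y"
      unfolding x using split[OF A Y] U YA A Y by auto
  qed
  with Y le show ?thesis using that by blast
qed

lemma tv_dist_nonneg: 
  assumes "real_distribution P" "real_distribution Q" shows "0 \<le> tv_dist P Q" "tv_dist P Q \<le> 1"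
proof -
  interpret P: real_distribution P by fact
  interpret Q: real_distribution Q by fact
  obtain Y where Y: "Y \<in> sets borel" "tv_dist P Q = measure P Y - measure Q Y"
    "\<And>X. X \<in> sets borel \<Longrightarrow> X \<subseteq> Y \<Longrightarrow> measure Q X \<le> measure P X"
    using tv_dist_Hahn[OF assms] by metis
  from Y(3)[OF Y(1)] show "0 \<le> tv_dist P Q" by (simp add: Y(2))
  show "tv_dist P Q \<le> 1" using P.prob_le_1[of Y] measure_nonneg[of Q Y] unfolding Y(2) by linarith
qed

text \<open>For \<open>u < d\<close> the components are drawn from the positive and negative parts
  of \<open>P - Q\<close>, which live on \<open>Y\<close> and on its complement and so never agree.
  For \<open>u \<ge> d\<close> both are the same quantile of the common part. The masses are
  \<open>d\<close>, \<open>d\<close> and \<open>1 - d\<close>.\<close>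

lemma maximal_coupling:
  assumes P: "real_distribution P" and Q: "real_distribution Q"
  obtains \<zeta> \<zeta>' :: "real \<Rightarrow> real" where "\<zeta> \<in> borel_measurable borel" "\<zeta>' \<in> borel_measurable borel"
    "distr uniform01 borel \<zeta> = P" "distr uniform01 borel \<zeta>' = Q"
    "\<And>u. u \<in> {0<..<1} \<Longrightarrow> \<zeta> u = \<zeta>' u \<longleftrightarrow> tv_dist P Q \<le> u"
proof -
  interpret P: real_distribution P by fact
  interpret Q: real_distribution Q by fact
  obtain Y where [measurable]: "Y \<in> sets borel" and tv: "tv_dist P Q = measure P Y - measure Q Y"
    and le1: "\<And>X. X \<in> sets borel \<Longrightarrow> X \<subseteq> Y \<Longrightarrow> measure Q X \<le> measure P X"
    and le2: "\<And>X. X \<in> sets borel \<Longrightarrow> X \<inter> Y = {} \<Longrightarrow> measure P X \<le> measure Q X"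
    using tv_dist_Hahn[OF P Q] by metis
  define d where "d = tv_dist P Q"
  have d: "0 \<le> d" "d \<le> 1" using tv_dist_nonneg[OF P Q] by (auto simp: d_def)
  define R where "R = diff_measure (density P (indicator Y)) (density Q (indicator Y))"
  define R' where "R' = diff_measure (density Q (indicator (- Y))) (density P (indicator (- Y)))"
  have dens: "emeasure (density P (indicator H)) A = ennreal (measure P (H \<inter> A))"
    "emeasure (density Q (indicator H)) A = ennreal (measure Q (H \<inter> A))"
    if "A \<in> sets borel" "H \<in> sets borel" for A H
    using that by (simp_all add: emeasure_density P.emeasure_eq_measure Q.emeasure_eq_measure
        indicator_inter_arith[symmetric])
  have fin: "finite_measure (density P (indicator H))" "finite_measure (density Q (indicator H))"
    if "H \<in> sets borel" for H
    by (rule finite_measureI, simp add: dens that)+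
  have R: "emeasure R A = ennreal (measure P (Y \<inter> A) - measure Q (Y \<inter> A))" if "A \<in> sets borel" for A
    unfolding R_def using that
    by (subst emeasure_diff_measure) (auto intro!: fin le1 ennreal_leI simp: dens ennreal_minus)
  have R': "emeasure R' A = ennreal (measure Q (- Y \<inter> A) - measure P (- Y \<inter> A))" if "A \<in> sets borel" for A
    unfolding R'_def using that
    by (subst emeasure_diff_measure) (auto intro!: fin le2 ennreal_leI simp: dens ennreal_minus)
  have [simp]: "sets R = sets borel" "sets R' = sets borel" "space R = UNIV" "space R' = UNIV"
    by (simp_all add: R_def R'_def)
  have compl: "measure P (- Y) = 1 - measure P Y" "measure Q (- Y) = 1 - measure Q Y"
    using P.prob_compl[of Y] Q.prob_compl[of Y] by (simp_all add: Compl_eq_Diff_UNIV)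
  have R_tot: "measure R UNIV = d" "measure R' UNIV = d"
    using R[of UNIV] R'[of UNIV] d by (simp_all add: measure_def[of R] measure_def[of R'] compl tv d_def)
  have finR: "finite_measure R" "finite_measure R'"
    by (rule finite_measureI, simp add: R R')+
  \<comment> \<open>The minimum of \<open>P\<close> and \<open>Q\<close>: it is \<open>Q\<close> on
    \<open>Y\<close> and \<open>P\<close> on the complement.\<close>
  define m where "m = diff_measure P R"
  have split: "measure P A = measure P (Y \<inter> A) + measure P (- Y \<inter> A)" "measure Q A = measure Q (Y \<inter> A) + measure Q (- Y \<inter> A)"
    if "A \<in> sets borel" for A
  proof -
    have "(Y \<inter> A) \<union> (- Y \<inter> A) = A" by auto
    then show "measure P A = measure P (Y \<inter> A) + measure P (- Y \<inter> A)" "measure Q A = measure Q (Y \<inter> A) + measure Q (- Y \<inter> A)"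
      using P.finite_measure_Union[of "Y \<inter> A" "- Y \<inter> A"] Q.finite_measure_Union[of "Y \<inter> A" "- Y \<inter> A"] that by auto
  qed
  have m: "emeasure m A = ennreal (measure Q (Y \<inter> A) + measure P (- Y \<inter> A))" if "A \<in> sets borel" for A
  proof -
    have "emeasure m A = emeasure P A - emeasure R A"
      unfolding m_def
    proof (rule emeasure_diff_measure)
      show "emeasure R A \<le> emeasure P A" if "A \<in> sets P" for A
      proof -
        have A: "A \<in> sets borel" using that by simp
        have "measure P (Y \<inter> A) - measure Q (Y \<inter> A) \<le> measure P A"
          using split(1)[OF A] measure_nonneg[of Q "Y \<inter> A"] measure_nonneg[of P "- Y \<inter> A"] by linarith
        then show ?thesis unfolding R[OF A] P.emeasure_eq_measure by (rule ennreal_leI)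
      qed
    qed (use that finR P.finite_measure_axioms in auto)
    also have "\<dots> = ennreal (measure P A - (measure P (Y \<inter> A) - measure Q (Y \<inter> A)))"
      using that le1[of "Y \<inter> A"] by (simp add: R P.emeasure_eq_measure ennreal_minus)
    finally show ?thesis using split(1)[OF that] by simp
  qed
  have [simp]: "sets m = sets borel" "space m = UNIV" by (simp_all add: m_def)
  have m_tot: "measure m UNIV = 1 - d"
  proof -
    have "emeasure m UNIV = ennreal (1 - d)"
      using m[of UNIV] by (simp add: compl tv d_def algebra_simps del: ennreal_plus)
    then show ?thesis using d by (simp add: measure_def[of m])
  qed
  have finm: "finite_measure m" by (rule finite_measureI) (simp add: m)
  obtain hm where hm[measurable]: "hm \<in> borel_measurable borel"
    and hm_law: "\<And>A. A \<in> sets borel \<Longrightarrow> emeasure lborel ({0<..<1 - d} \<inter> hm -` A) = emeasure m A"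
    using obtain_quantile[OF finm _ sets.top, of] m_tot by (auto simp: m)
  obtain hr where hr[measurable]: "hr \<in> borel_measurable borel" and hr_in: "\<And>u. 0 < u \<Longrightarrow> u < d \<Longrightarrow> hr u \<in> Y"
    and hr_law: "\<And>A. A \<in> sets borel \<Longrightarrow> emeasure lborel ({0<..<d} \<inter> hr -` A) = emeasure R A"
    using obtain_quantile[OF finR(1), of Y] R_tot by (auto simp: R)
  obtain hr' where hr'[measurable]: "hr' \<in> borel_measurable borel" and hr'_in: "\<And>u. 0 < u \<Longrightarrow> u < d \<Longrightarrow> hr' u \<in> - Y"
    and hr'_law: "\<And>A. A \<in> sets borel \<Longrightarrow> emeasure lborel ({0<..<d} \<inter> hr' -` A) = emeasure R' A"
    using obtain_quantile[OF finR(2), of "- Y"] R_tot by (auto simp: R')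
  define \<zeta> where "\<zeta> u = (if u < d then hr u else hm (u - d))" for u
  define \<zeta>' where "\<zeta>' u = (if u < d then hr' u else hm (u - d))" for u
  show ?thesis
  proof (rule that[of \<zeta> \<zeta>'])
    show meas: "\<zeta> \<in> borel_measurable borel" "\<zeta>' \<in> borel_measurable borel"
      unfolding \<zeta>_def[abs_def] \<zeta>'_def[abs_def] by measurable
    show "distr uniform01 borel \<zeta> = P"
    proof (rule measure_eqI)
      fix A assume "A \<in> sets (distr uniform01 borel \<zeta>)"
      then have A[measurable]: "A \<in> sets borel" by simp
      have "emeasure (distr uniform01 borel \<zeta>) A = emeasure R A + emeasure m A"
        unfolding emeasure_distr_uniform01[OF meas(1) A] \<zeta>_def
        using hr_law[OF A] hm_law[OF A] by (subst emeasure_lborel_vimage_split) (use d in auto)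
      also have "\<dots> = emeasure P A"
        using le1[of "Y \<inter> A"] split(1)[OF A] by (simp add: R m ennreal_plus[symmetric] P.emeasure_eq_measure del: ennreal_plus)
      finally show "emeasure (distr uniform01 borel \<zeta>) A = emeasure P A" .
    qed simp
    show "distr uniform01 borel \<zeta>' = Q"
    proof (rule measure_eqI)
      fix A assume "A \<in> sets (distr uniform01 borel \<zeta>')"
      then have A[measurable]: "A \<in> sets borel" by simp
      have "emeasure (distr uniform01 borel \<zeta>') A = emeasure R' A + emeasure m A"
        unfolding emeasure_distr_uniform01[OF meas(2) A] \<zeta>'_def
        using hr'_law[OF A] hm_law[OF A] by (subst emeasure_lborel_vimage_split) (use d in auto)
      also have "\<dots> = emeasure Q A"
        using le2[of "- Y \<inter> A"] split(2)[OF A] by (simp add: R' m ennreal_plus[symmetric] Q.emeasure_eq_measure del: ennreal_plus)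
      finally show "emeasure (distr uniform01 borel \<zeta>') A = emeasure Q A" .
    qed simp
    show "\<zeta> u = \<zeta>' u \<longleftrightarrow> tv_dist P Q \<le> u" if "u \<in> {0<..<1}" for u
      using hr_in[of u] hr'_in[of u] that by (auto simp: \<zeta>_def \<zeta>'_def d_def[symmetric])
  qed
qed

text \<open>Read off from the maximal coupling: the values of \<open>g\<close> at the two components
  differ by at most 1, and only for \<open>u\<close> below the distance.\<close>

lemma tv_dist_integral:
  assumes P: "real_distribution P" and Q: "real_distribution Q"
    and [measurable]: "g \<in> borel_measurable borel" and g: "\<And>x. 0 \<le> g x" "\<And>x. g x \<le> 1"
  shows "(LINT x|P. g x) - (LINT x|Q. g x) \<le> tv_dist P Q"
proof -
  obtain \<zeta> \<zeta>' :: "real \<Rightarrow> real" where [measurable]: "\<zeta> \<in> borel_measurable borel" "\<zeta>' \<in> borel_measurable borel"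
    and law: "distr uniform01 borel \<zeta> = P" "distr uniform01 borel \<zeta>' = Q"
    and eq: "\<And>u. u \<in> {0<..<1} \<Longrightarrow> \<zeta> u = \<zeta>' u \<longleftrightarrow> tv_dist P Q \<le> u"
    using maximal_coupling[OF P Q] by metis
  interpret U: prob_space uniform01 by (rule prob_space_uniform01)
  note [measurable] = measurable_uniform01
  let ?d = "tv_dist P Q"
  have d: "0 \<le> ?d" "?d \<le> 1" using tv_dist_nonneg[OF P Q] by auto
  have int: "integrable uniform01 (\<lambda>u. g (\<zeta> u))" "integrable uniform01 (\<lambda>u. g (\<zeta>' u))"
    using g by (intro U.integrable_const_bound[of _ 1]; simp)+
  have "(LINT x|P. g x) - (LINT x|Q. g x) = (LINT u|uniform01. g (\<zeta> u)) - (LINT u|uniform01. g (\<zeta>' u))"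
    unfolding law[symmetric] by (subst (1 2) integral_distr) auto
  also have "\<dots> = (LINT u|uniform01. g (\<zeta> u) - g (\<zeta>' u))"
    using int by simp
  also have "\<dots> \<le> (LINT u|uniform01. indicator {..<?d} u)"
  proof (rule integral_mono)
    show "integrable uniform01 (indicator {..<?d} :: real \<Rightarrow> real)"
      by (intro U.integrable_const_bound[of _ 1]) auto
    show "g (\<zeta> u) - g (\<zeta>' u) \<le> indicator {..<?d} u" if "u \<in> space uniform01" for u
      using eq[of u] that g(1)[of "\<zeta>' u"] g(2)[of "\<zeta> u"] by (auto simp: indicator_def not_less)
  qed (use int in auto)
  also have "\<dots> = measure uniform01 ({..<?d} \<inter> {0<..<1})"
    by (simp add: Int_commute)
  also have "{..<?d} \<inter> {0<..<1} = {0<..<1} \<inter> {0<..<?d}" by auto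
  also have "measure uniform01 ({0<..<1} \<inter> {0<..<?d}) = ?d"
  proof -
    have "{0<..<1} \<inter> {0<..<?d} = {0<..<?d}" using d by auto
    then have "emeasure uniform01 ({0<..<1} \<inter> {0<..<?d}) = ennreal ?d"
      using emeasure_uniform01[of "{0<..<?d}"] d by simp
    then show ?thesis using d by (simp add: measure_def)
  qed
  finally show ?thesis .
qed

subsection \<open>Coupling of the one-dimensional marginals\<close>

lemma tv_dist_le:
  assumes "real_distribution P" "real_distribution Q"
    and "\<And>A. A \<in> sets borel \<Longrightarrow> measure P A - measure Q A \<le> v"
  shows "tv_dist P Q \<le> v"
proof -
  obtain Y where "Y \<in> sets borel" "tv_dist P Q = measure P Y - measure Q Y"
    using tv_dist_Hahn[OF assms(1,2)] by metis
  then show ?thesis using assms(3)[of Y] by simp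
qed

lemma tv_dist_ge:
  assumes "real_distribution P" "real_distribution Q" "A \<in> sets borel"
  shows "measure P A - measure Q A \<le> tv_dist P Q"
proof -
  interpret P: real_distribution P by fact
  interpret Q: real_distribution Q by fact
  show ?thesis
    using tv_dist_integral[OF assms(1,2), of "indicator A"] assms(3) by simp
qed

lemma nn_integral_uniform01_rsqrt:
  assumes "0 \<le> a"
  shows "(\<integral>\<^sup>+u. ennreal (1 + a * u powr (- (1 / 2))) \<partial>uniform01) = ennreal (1 + 2 * a)"
proof -
  let ?f = "\<lambda>u :: real. if u \<in> {0..1} then u powr (- (1 / 2)) else 0"
  have "((\<lambda>u. u powr (- (1 / 2))) has_integral (1 powr (- (1 / 2) + 1) / (- (1 / 2) + 1))) {0..1 :: real}"
    by (rule has_integral_powr_from_0) auto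
  then have "(?f has_integral 2) UNIV"
    by (subst has_integral_restrict_UNIV) simp
  then have f: "(\<integral>\<^sup>+u. ennreal (?f u) \<partial>lborel) = ennreal 2"
    by (intro nn_integral_has_integral_lborel) auto
  have "(\<integral>\<^sup>+u. ennreal (1 + a * u powr (- (1 / 2))) \<partial>uniform01)
    = (\<integral>\<^sup>+u. ennreal (1 + a * u powr (- (1 / 2))) * indicator {0<..<1} u \<partial>lborel)"
    unfolding uniform01_def by (rule nn_integral_restrict_space) simp
  also have "\<dots> = (\<integral>\<^sup>+u. indicator {0<..<1} u + ennreal a * ennreal (?f u) \<partial>lborel)"
  proof (rule nn_integral_cong_AE)
    show "AE u in lborel. ennreal (1 + a * u powr (- (1 / 2))) * indicator {0<..<1} u
      = indicator {0<..<1} u + ennreal a * ennreal (?f u)"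
      using AE_lborel_singleton[of 0] AE_lborel_singleton[of 1]
      by eventually_elim (use assms in \<open>auto simp: indicator_def ennreal_mult\<close>)
  qed
  also have "\<dots> = (\<integral>\<^sup>+u. indicator {0<..<1 :: real} u \<partial>lborel) + ennreal a * (\<integral>\<^sup>+u. ennreal (?f u) \<partial>lborel)"
    by (subst nn_integral_add) (auto simp: nn_integral_cmult)
  also have "\<dots> = 1 + ennreal a * ennreal 2" unfolding f by simp
  also have "\<dots> = ennreal (1 + 2 * a)"
    using assms by (subst ennreal_plus) (auto simp: ennreal_mult mult.commute[of 2])
  finally show ?thesis .
qed

text \<open>The sample points are prescribed to be paths. The uniform variable is encoded as the
  constant path with first component \<open>u\<close>, and the sigma-algebra is pulled back along
  the evaluation \<open>\<pi>\<close> at time 0.\<close>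

lemma uniform01_path_space:
  obtains N :: "(real \<Rightarrow> real \<times> real) measure" and \<pi> where
    "\<pi> \<in> N \<rightarrow>\<^sub>M uniform01" "distr N uniform01 \<pi> = uniform01" "prob_space N"
proof -
  define \<pi> where "\<pi> \<omega> = fst (\<omega> 0)" for \<omega> :: "real \<Rightarrow> real \<times> real"
  define E :: "(real \<Rightarrow> real \<times> real) measure" where "E = vimage_algebra (\<pi> -` {0<..<1}) \<pi> uniform01"
  define emb :: "real \<Rightarrow> real \<Rightarrow> real \<times> real" where "emb u = (\<lambda>_. (u, 0))" for u
  have \<pi>_emb: "\<pi> (emb u) = u" for u by (simp add: \<pi>_def emb_def)
  have emb: "emb \<in> uniform01 \<rightarrow>\<^sub>M E"
    unfolding E_def by (rule measurable_vimage_algebra2) (auto simp: \<pi>_emb)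
  have \<pi>: "\<pi> \<in> E \<rightarrow>\<^sub>M uniform01"
    unfolding E_def by (rule measurable_vimage_algebra1) auto
  show ?thesis
  proof (rule that[of \<pi> "distr uniform01 E emb"])
    show "\<pi> \<in> distr uniform01 E emb \<rightarrow>\<^sub>M uniform01" using \<pi> by simp
    show "distr (distr uniform01 E emb) uniform01 \<pi> = uniform01"
      using emb \<pi> by (subst distr_distr) (auto simp: comp_def \<pi>_emb)
    show "prob_space (distr uniform01 E emb)"
      by (rule prob_space.prob_space_distr[OF prob_space_uniform01 emb])
  qed
qed

lemma coupling_time_le_exp_scaled:
  assumes "0 < \<beta>"
  shows "x \<le> ennreal (1 / \<beta>) * exp_scaled \<beta> x"
proof (cases x)
  case (real r)
  have "\<beta> * r \<le> exp (\<beta> * r)" using exp_ge_add_one_self[of "\<beta> * r"] by linarith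
  then have "r \<le> 1 / \<beta> * exp (\<beta> * r)" using assms by (simp add: field_simps)
  then have "ennreal r \<le> ennreal (1 / \<beta> * exp (\<beta> * r))" by (rule ennreal_leI)
  with real assms show ?thesis unfolding exp_scaled_def by (subst (asm) ennreal_mult) auto
qed (use assms in \<open>simp add: exp_scaled_def ennreal_mult_top\<close>)

context renewal
begin

abbreviation law :: "real \<Rightarrow> real \<Rightarrow> real measure" where
  "law b t \<equiv> backward_renewal_law (cdf D) b t"

lemma measure_law: "A \<in> sets borel \<Longrightarrow> measure (law b t) A = evol t (indicator A) b"
proof -
  interpret L: real_distribution "law b t" by (rule real_distribution_law)
  show "A \<in> sets borel \<Longrightarrow> measure (law b t) A = evol t (indicator A) b"
    by (simp add: evol_def)
qed

lemma law_0: "law b 0 = return borel b"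
proof (rule measure_eqI)
  interpret L: real_distribution "law b 0" by (rule real_distribution_law)
  show "sets (law b 0) = sets (return borel b)" by simp
  fix A assume "A \<in> sets (law b 0)"
  then have A: "A \<in> sets borel" by simp
  then show "emeasure (law b 0) A = emeasure (return borel b) A"
    using measure_law[OF A, of b 0] evol_at_0[OF bounded_borel_indicator[OF A], of b]
    by (simp add: L.emeasure_eq_measure indicator_def)
qed

section \<open>Monotonicity and right-continuity of the total variation distance\<close>

definition tv :: "real \<Rightarrow> real \<Rightarrow> real \<Rightarrow> real" where
  "tv b b' t = tv_dist (law b t) (law b' t)"

lemma evol_diff_le_tv:
  assumes "bounded_borel g" "\<And>x. 0 \<le> g x" "\<And>x. g x \<le> 1"
  shows "evol t g b - evol t g b' \<le> tv b b' t"
  unfolding evol_def tv_def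
  by (rule tv_dist_integral[OF real_distribution_law real_distribution_law bounded_borelD(1)[OF assms(1)] assms(2,3)])

lemma tv_bounds: "0 \<le> tv b b' t" "tv b b' t \<le> 1"
  unfolding tv_def by (rule tv_dist_nonneg[OF real_distribution_law real_distribution_law])+

text \<open>By the Markov property the remaining evolution turns an indicator at time
  \<open>t'\<close> into a test function with values in \<open>[0, 1]\<close> at time
  \<open>t\<close>.\<close>

lemma tv_antimono:
  assumes "0 \<le> t" "t \<le> t'" shows "tv b b' t' \<le> tv b b' t"
  unfolding tv_def[of _ _ t']
proof (rule tv_dist_le[OF real_distribution_law real_distribution_law])
  fix A :: "real set" assume A: "A \<in> sets borel"
  let ?g = "evol (t' - t) (indicator A)"
  have bb: "bounded_borel (indicator A :: real \<Rightarrow> real)" using A by simp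
  have "measure (law c t') A = evol t ?g c" for c
    using evol_semigroup[OF bb assms(1), of "t' - t" c] assms A by (simp add: measure_law)
  moreover have "0 \<le> ?g x" "?g x \<le> 1" for x
    using evol_mono[OF bounded_borel_const[of 0] bb, of "t' - t" x] evol_mono[OF bb bounded_borel_const[of 1], of "t' - t" x]
    by (auto simp: indicator_def)
  ultimately show "measure (law b t') A - measure (law b' t') A \<le> tv b b' t"
    using evol_diff_le_tv[OF bounded_borel_evol[OF bb], of "t' - t" t b b'] assms by simp
qed

text \<open>The residual period is almost surely positive, so for small times no renewal has
  occurred and the age is merely shifted; continuity of \<open>g\<close> and dominated convergence
  do the rest.\<close>

lemma evol_tendsto_at_0:
  assumes bb: "bounded_borel g" and cont: "continuous_on UNIV g"
  shows "(\<lambda>n. evol (1 / real (Suc n)) g x) \<longlonglongrightarrow> g x"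
proof -
  interpret R: real_distribution "residual x" by (rule real_distribution_residual)
  have [measurable]: "g \<in> borel_measurable borel" by (rule bounded_borelD(1)[OF bb])
  obtain M where M: "\<And>x. \<bar>g x\<bar> \<le> M" using bounded_borelD(2)[OF bb] by auto
  let ?h = "\<lambda>n. 1 / real (Suc n)"
  have h0: "?h \<longlonglongrightarrow> 0" by (rule LIMSEQ_Suc[OF lim_const_over_n])
  have "(\<lambda>n. LINT s|residual x. (if ?h n < s then g (x + ?h n) else evol (?h n - s) g 0)) \<longlonglongrightarrow> (LINT s|residual x. g x)"
  proof (rule integral_dominated_convergence[where w="\<lambda>_. M"])
    have "AE s in residual x. 0 < s"
      unfolding residual_def by (subst AE_distr_iff) (auto intro!: AE_uniform_measureI)
    then show "AE s in residual x. (\<lambda>n. if ?h n < s then g (x + ?h n) else evol (?h n - s) g 0) \<longlonglongrightarrow> g x"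
    proof eventually_elim
      case (elim s)
      have "\<forall>\<^sub>F n in sequentially. ?h n < s" using order_tendstoD(2)[OF h0 elim] .
      then have ev: "\<forall>\<^sub>F n in sequentially. g (x + ?h n) = (if ?h n < s then g (x + ?h n) else evol (?h n - s) g 0)"
        by eventually_elim simp
      have "(\<lambda>n. x + ?h n) \<longlonglongrightarrow> x + 0" by (intro tendsto_add tendsto_const h0)
      then have "(\<lambda>n. g (x + ?h n)) \<longlonglongrightarrow> g x"
        using continuous_on_tendsto_compose[OF cont, of "\<lambda>n. x + ?h n" x sequentially] by simp
      then show ?case by (rule Lim_transform_eventually[OF _ ev])
    qed
    show "AE s in residual x. norm (if ?h n < s then g (x + ?h n) else evol (?h n - s) g 0) \<le> M" for n
      using M abs_evol_le[of g M, OF M] by (intro AE_I2) auto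
  qed auto
  then show ?thesis by (simp add: evol_residual[OF bb] del: of_nat_Suc cong: if_cong)
qed

text \<open>The semigroup law puts the small increment of time innermost, where convergence is
  pointwise in the state.\<close>

lemma evol_tendsto_right:
  assumes bb: "bounded_borel g" and cont: "continuous_on UNIV g" and t: "0 \<le> t"
  shows "(\<lambda>n. evol (t + 1 / real (Suc n)) g b) \<longlonglongrightarrow> evol t g b"
proof -
  interpret L: real_distribution "law b t" by (rule real_distribution_law)
  obtain M where M: "\<And>x. \<bar>g x\<bar> \<le> M" using bounded_borelD(2)[OF bb] by auto
  have "(\<lambda>n. LINT x|law b t. evol (1 / real (Suc n)) g x) \<longlonglongrightarrow> (LINT x|law b t. g x)"
  proof (rule integral_dominated_convergence[where w="\<lambda>_. M"])
    show "AE x in law b t. (\<lambda>n. evol (1 / real (Suc n)) g x) \<longlonglongrightarrow> g x"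
      by (intro AE_I2 evol_tendsto_at_0 bb cont)
    show "AE x in law b t. norm (evol (1 / real (Suc n)) g x) \<le> M" for n
      using abs_evol_le[of g M, OF M] by simp
    show "evol (1 / real (Suc n)) g \<in> borel_measurable (law b t)" for n
      using bounded_borelD(1)[OF bounded_borel_evol[OF bb, of "1 / real (Suc n)"]] by simp
  qed (use bounded_borelD(1)[OF bb] in auto)
  then show ?thesis
    using evol_semigroup[OF bb t] unfolding evol_def[of t] by simp
qed

text \<open>Total variation is lower semicontinuous under weak convergence, so \<open>tv\<close> is right-continuous.\<close>

lemma tv_right_limit:
  assumes t: "0 \<le> t" and le: "\<And>s. t < s \<Longrightarrow> tv b b' s \<le> v"
  shows "tv b b' t \<le> v"
proof (rule field_le_epsilon)
  fix e :: real assume "0 < e"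
  interpret P: real_distribution "law b t" by (rule real_distribution_law)
  interpret Q: real_distribution "law b' t" by (rule real_distribution_law)
  have "0 \<le> v" using le[of "t + 1"] tv_bounds(1)[of b b' "t + 1"] by simp
  obtain Y where Y: "Y \<in> sets borel" and tv: "tv b b' t = measure (law b t) Y - measure (law b' t) Y"
    unfolding tv_def using tv_dist_Hahn[OF real_distribution_law real_distribution_law] by metis
  \<comment> \<open>Only continuous test functions pass to the limit. The Hahn set \<open>Y\<close>
    is first replaced by a compact subset, which costs at most \<open>e\<close> of the first law and
    can only lower the mass under the second.\<close>
  have "emeasure (law b t) Y = (SUP K\<in>{K. K \<subseteq> Y \<and> compact K}. emeasure (law b t) K)"
    by (rule inner_regular) (use Y P.emeasure_finite in auto)
  moreover have "ennreal (measure (law b t) Y - e) < emeasure (law b t) Y \<or> measure (law b t) Y = 0"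
    using \<open>0 < e\<close> measure_nonneg[of "law b t" Y] by (cases "measure (law b t) Y = 0") (auto simp: P.emeasure_eq_measure zero_less_measure_iff intro!: ennreal_lessI)
  ultimately obtain K where K: "K \<subseteq> Y" "compact K" "measure (law b t) Y - e \<le> measure (law b t) K"
  proof (elim disjE)
    assume "emeasure (law b t) Y = (SUP K\<in>{K. K \<subseteq> Y \<and> compact K}. emeasure (law b t) K)"
      and "ennreal (measure (law b t) Y - e) < emeasure (law b t) Y"
    then obtain K where "K \<subseteq> Y" "compact K" "ennreal (measure (law b t) Y - e) < emeasure (law b t) K"
      by (auto simp: less_SUP_iff)
    then show ?thesis using that[of K]
      by (metis P.emeasure_eq_measure ennreal_leI linorder_not_less nle_le)
  next
    assume "measure (law b t) Y = 0"
    then show ?thesis using that[of "{}"] \<open>0 < e\<close> by simp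
  qed
  have K_meas: "K \<in> sets borel" using K(2) by (intro borel_compact)
  have "measure (law b' t) K \<le> measure (law b' t) Y" using K(1) Y by (intro Q.finite_measure_mono) auto
  then have le_K: "tv b b' t - e \<le> measure (law b t) K - measure (law b' t) K"
    unfolding tv using K(3) by linarith
  show "tv b b' t \<le> v + e"
  proof (cases "K = {}")
    case True
    then show ?thesis using le_K \<open>0 \<le> v\<close> by simp
  next
    case False
    \<comment> \<open>Continuous functions decreasing to the indicator of \<open>K\<close>. The
      empty set is treated separately because \<open>infdist\<close> to it is 0.\<close>
    define g where "g n x = max 0 (1 - real n * infdist x K)" for n and x :: real
    have g_cont: "continuous_on UNIV (g n)" for n
      unfolding g_def by (intro continuous_intros)
    have g_bd: "0 \<le> g n x" "g n x \<le> 1" for n x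
      using infdist_nonneg[of x K] by (auto simp: g_def)
    have g_bb: "bounded_borel (g n)" for n
      using borel_measurable_continuous_onI[OF g_cont[of n]] g_bd[of n]
      by (auto simp: bounded_borel_def intro!: exI[of _ 1])
    have step: "evol t (g n) b - evol t (g n) b' \<le> v" for n
    proof (rule LIMSEQ_le_const2)
      show "(\<lambda>m. evol (t + 1 / real (Suc m)) (g n) b - evol (t + 1 / real (Suc m)) (g n) b')
        \<longlonglongrightarrow> evol t (g n) b - evol t (g n) b'"
        by (intro tendsto_diff evol_tendsto_right g_bb g_cont t)
      have "evol (t + 1 / real (Suc m)) (g n) b - evol (t + 1 / real (Suc m)) (g n) b' \<le> v" for m
        using evol_diff_le_tv[OF g_bb g_bd, of "t + 1 / real (Suc m)" n b b'] le[of "t + 1 / real (Suc m)"] by simp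
      then show "\<exists>N. \<forall>m\<ge>N. evol (t + 1 / real (Suc m)) (g n) b - evol (t + 1 / real (Suc m)) (g n) b' \<le> v" by blast
    qed
    have lim: "(\<lambda>n. evol t (g n) c) \<longlonglongrightarrow> evol t (indicator K) c" for c
    proof -
      interpret L: real_distribution "law c t" by (rule real_distribution_law)
      show ?thesis
        unfolding evol_def
      proof (rule integral_dominated_convergence[where w="\<lambda>_. 1"])
        show "AE x in law c t. (\<lambda>n. g n x) \<longlonglongrightarrow> indicator K x"
        proof (rule AE_I2)
          fix x :: real
          show "(\<lambda>n. g n x) \<longlonglongrightarrow> indicator K x"
          proof (cases "x \<in> K")
            case True
            then show ?thesis by (simp add: g_def)
          next
            case False
            then have pos: "0 < infdist x K"
              using in_closed_iff_infdist_zero[OF compact_imp_closed[OF K(2)] \<open>K \<noteq> {}\<close>, of x] infdist_nonneg[of x K]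
              by linarith
            then obtain N :: nat where N: "1 / infdist x K \<le> real N" using real_arch_simple by blast
            have "\<forall>\<^sub>F n in sequentially. g n x = 0"
              using eventually_ge_at_top[of N]
            proof eventually_elim
              case (elim n)
              then have "1 / infdist x K \<le> real n" using N by (meson of_nat_mono order.trans)
              then have "1 \<le> real n * infdist x K" using pos by (simp add: field_simps)
              then show ?case by (simp add: g_def)
            qed
            then show ?thesis using False by (simp add: tendsto_eventually)
          qed
        qed
      qed (use K_meas g_bd bounded_borelD(1)[OF g_bb] in auto)
    qed
    have "evol t (indicator K) b - evol t (indicator K) b' \<le> v"
      by (rule LIMSEQ_le_const2[OF tendsto_diff[OF lim lim]]) (use step in blast)
    then show ?thesis using le_K K_meas by (simp add: measure_law)
  qed
qed

text \<open>The components agree at time \<open>t > 0\<close> exactly when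
  \<open>?d t \<le> u\<close>, so \<open>\<tau> u\<close> is at most
  \<open>ln (B / u) / (2 * \<beta>)\<close> for \<open>u < B\<close>, and
  \<open>exp (\<beta> * \<tau> u)\<close> is at most \<open>sqrt (B / u)\<close>. The factor 2 in
  the exponent is what makes this integrable near 0.\<close>

lemma successful_coupling_of_tv_bound:
  assumes \<beta>: "0 < \<beta>" and B: "0 \<le> B" and bound: "\<And>t. 0 \<le> t \<Longrightarrow> tv b b' t \<le> B * exp (- (2 * \<beta>) * t)"
  shows "\<exists>(N :: (real \<Rightarrow> real \<times> real) measure) Z Z'.
    successful_coupling (cdf D) b b' N Z Z' \<and>
    (\<integral>\<^sup>+\<omega>. exp_scaled \<beta> (coupling_time Z Z' \<omega>) \<partial>N) \<le> ennreal (2 + B)"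
proof -
  let ?d = "tv b b'"
  define coupled where "coupled t z z' \<longleftrightarrow> z \<in> borel_measurable borel \<and> z' \<in> borel_measurable borel \<and>
      distr uniform01 borel z = law b t \<and> distr uniform01 borel z' = law b' t \<and>
      (\<forall>u\<in>{0<..<1}. z u = z' u \<longleftrightarrow> ?d t \<le> u)" for t z z'
  have "\<exists>z z'. coupled t z z'" for t
  proof -
    show ?thesis
    proof (rule maximal_coupling[OF real_distribution_law[of b t] real_distribution_law[of b' t]])
      fix z z' :: "real \<Rightarrow> real"
      assume "z \<in> borel_measurable borel" "z' \<in> borel_measurable borel"
        "distr uniform01 borel z = law b t" "distr uniform01 borel z' = law b' t"
        "\<And>u. u \<in> {0<..<1} \<Longrightarrow> z u = z' u \<longleftrightarrow> tv_dist (law b t) (law b' t) \<le> u"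
      then show ?thesis unfolding coupled_def tv_def by blast
    qed
  qed
  then have "\<exists>\<zeta> \<zeta>'. \<forall>t. coupled t (\<zeta> t) (\<zeta>' t)"
    by metis
  then obtain \<zeta> \<zeta>' where coupled: "\<And>t. coupled t (\<zeta> t) (\<zeta>' t)" by blast
  have \<zeta>: "\<And>t. \<zeta> t \<in> borel_measurable borel" "\<And>t. \<zeta>' t \<in> borel_measurable borel"
    "\<And>t. distr uniform01 borel (\<zeta> t) = law b t" "\<And>t. distr uniform01 borel (\<zeta>' t) = law b' t"
    using coupled by (simp_all add: coupled_def)
  have meet: "\<And>t u. u \<in> {0<..<1} \<Longrightarrow> \<zeta> t u = \<zeta>' t u \<longleftrightarrow> ?d t \<le> u"
    using coupled unfolding coupled_def by blast
  obtain N :: "(real \<Rightarrow> real \<times> real) measure" and \<pi> where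
    \<pi>: "\<pi> \<in> N \<rightarrow>\<^sub>M uniform01" and \<pi>_law: "distr N uniform01 \<pi> = uniform01" and N: "prob_space N"
    using uniform01_path_space by metis
  interpret N: prob_space N by (rule N)
  \<comment> \<open>Time 0 is set by hand: the quantile coupling has the right law there, but the
    initial states must hold at every sample point.\<close>
  define Z where "Z t \<omega> = (if t = 0 then b else \<zeta> t (\<pi> \<omega>))" for t \<omega>
  define Z' where "Z' t \<omega> = (if t = 0 then b' else \<zeta>' t (\<pi> \<omega>))" for t \<omega>
  define \<tau> where "\<tau> u = (INF t\<in>{t. 0 < t \<and> ?d t \<le> u}. ennreal t)" for u
  have \<pi>_in: "\<pi> \<omega> \<in> {0<..<1}" if "\<omega> \<in> space N" for \<omega>
    using measurable_space[OF \<pi> that] by simp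
  have \<tau>: "coupling_time Z Z' \<omega> = \<tau> (\<pi> \<omega>)" if "\<omega> \<in> space N" for \<omega>
  proof -
    have "{t. 0 < t \<and> Z t \<omega> = Z' t \<omega>} = {t. 0 < t \<and> ?d t \<le> \<pi> \<omega>}"
      using meet[OF \<pi>_in[OF that]] by (auto simp: Z_def Z'_def)
    then show ?thesis by (simp add: coupling_time_def \<tau>_def)
  qed
  \<comment> \<open>Since the distance decreases in time, the infimum can be tested on rational
    times, so the event is a countable union of half-lines.\<close>
  have \<tau>_meas: "\<tau> \<in> borel_measurable uniform01"
  proof (rule measurable_uniform01, rule borel_measurableI_less)
    fix y
    have "{u \<in> space borel. \<tau> u < y} = (\<Union>q\<in>{q\<in>\<rat>. 0 < q \<and> ennreal q < y}. {?d q..})"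
    proof safe
      fix u assume "\<tau> u < y"
      then obtain t where t: "0 < t" "?d t \<le> u" "ennreal t < y"
        by (auto simp: \<tau>_def INF_less_iff)
      obtain t' where t': "t < t'" "ennreal t' < y"
      proof (cases y)
        case (real r)
        then show ?thesis using that[of "(t + r) / 2"] t by (auto simp: ennreal_less_iff)
      next
        case top
        then show ?thesis using that[of "t + 1"] by simp
      qed
      obtain q where q: "q \<in> \<rat>" "t < q" "q < t'" using Rats_dense_in_real[OF t'(1)] by auto
      have "ennreal q \<le> ennreal t'" using q by (intro ennreal_leI) simp
      moreover have "?d q \<le> u" using tv_antimono[of t q b b'] t q by simp
      ultimately show "u \<in> (\<Union>q\<in>{q\<in>\<rat>. 0 < q \<and> ennreal q < y}. {?d q..})"
        using q(1,2) t(1) le_less_trans[of "ennreal q" "ennreal t'" y] t'(2) by (intro UN_I[of q]) auto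
    next
      fix q u assume "?d q \<le> u" "0 < q" "ennreal q < y"
      then show "\<tau> u < y" by (auto simp: \<tau>_def INF_less_iff)
    qed auto
    also have "\<dots> \<in> sets borel"
      using countable_rat by (intro sets.countable_UN') (auto intro: countable_subset)
    finally show "{u \<in> space borel. \<tau> u < y} \<in> sets borel" .
  qed
  have nn_N: "(\<integral>\<^sup>+\<omega>. h (coupling_time Z Z' \<omega>) \<partial>N) = (\<integral>\<^sup>+u. h (\<tau> u) \<partial>uniform01)"
    if [measurable]: "h \<in> borel_measurable borel" for h
  proof -
    have "(\<integral>\<^sup>+\<omega>. h (coupling_time Z Z' \<omega>) \<partial>N) = (\<integral>\<^sup>+\<omega>. h (\<tau> (\<pi> \<omega>)) \<partial>N)"
      by (intro nn_integral_cong) (simp add: \<tau>)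
    also have "\<dots> = (\<integral>\<^sup>+u. h (\<tau> u) \<partial>distr N uniform01 \<pi>)"
      by (rule nn_integral_distr[OF \<pi>, symmetric]) (use \<tau>_meas in \<open>simp add: measurable_compose[OF _ that]\<close>)
    finally show ?thesis unfolding \<pi>_law .
  qed
  have exp_meas: "exp_scaled \<beta> \<in> borel_measurable borel"
    unfolding exp_scaled_def[abs_def] by measurable
  have \<tau>_le: "exp_scaled \<beta> (\<tau> u) \<le> ennreal (1 + sqrt B * u powr (- (1 / 2)))" if u: "u \<in> {0<..<1}" for u
  proof -
    have le_t: "\<tau> u \<le> ennreal t" if "0 < t" "B * exp (- (2 * \<beta>) * t) \<le> u" for t
      unfolding \<tau>_def using bound[of t] that by (intro INF_lower) auto
    have exp_le: "exp_scaled \<beta> (\<tau> u) \<le> ennreal (exp (\<beta> * t))" if "\<tau> u \<le> ennreal t" "0 \<le> t" for t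
      using that \<beta> by (cases "\<tau> u") (auto simp: exp_scaled_def top_unique intro!: ennreal_leI)
    show ?thesis
    proof (cases "B \<le> u")
      case True
      have "\<tau> u \<le> ennreal e" if "0 < e" for e
      proof (rule le_t[OF that])
        have "B * exp (- (2 * \<beta>) * e) \<le> B * 1" using B \<beta> that by (intro mult_left_mono) auto
        with True show "B * exp (- (2 * \<beta>) * e) \<le> u" by simp
      qed
      then have "\<tau> u \<le> 0 + ennreal e" if "0 < e" for e using that by simp
      then have "\<tau> u \<le> 0" by (rule ennreal_le_epsilon)
      then have "\<tau> u \<le> ennreal 0" by simp
      from exp_le[OF this] have "exp_scaled \<beta> (\<tau> u) \<le> ennreal 1" by simp
      also have "\<dots> \<le> ennreal (1 + sqrt B * u powr (- (1 / 2)))" using B by (intro ennreal_leI) simp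
      finally show ?thesis .
    next
      case False
      \<comment> \<open>The time at which the bound \<open>B * exp (- (2 * \<beta>) * t)\<close>
        equals \<open>u\<close>.\<close>
      define t where "t = ln (B / u) / (2 * \<beta>)"
      have Bu: "1 < B / u" using False u by simp
      have "0 < t" using Bu \<beta> by (simp add: t_def)
      have "- (2 * \<beta>) * t = - ln (B / u)" using \<beta> by (simp add: t_def)
      then have "exp (- (2 * \<beta>) * t) = inverse (B / u)" using Bu by (simp only: exp_minus) simp
      then have "\<tau> u \<le> ennreal t" using u False B by (intro le_t[OF \<open>0 < t\<close>]) (simp add: inverse_eq_divide)
      from exp_le[OF this] have "exp_scaled \<beta> (\<tau> u) \<le> ennreal (exp (\<beta> * t))" using \<open>0 < t\<close> by simp
      also have "exp (\<beta> * t) = exp (ln (sqrt (B / u)))"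
        using Bu \<beta> by (simp add: t_def ln_sqrt)
      also have "\<dots> = sqrt (B / u)" using Bu by (intro exp_ln) simp
      also have "\<dots> = sqrt B * u powr (- (1 / 2))"
      proof -
        have "u powr (- (1 / 2)) = inverse (sqrt u)"
          using u by (simp only: powr_minus) (simp add: powr_half_sqrt)
        then show ?thesis unfolding real_sqrt_divide by (simp only: divide_inverse[of "sqrt B"])
      qed
      also have "ennreal \<dots> \<le> ennreal (1 + sqrt B * u powr (- (1 / 2)))" by (intro ennreal_leI) simp
      finally show ?thesis .
    qed
  qed
  have exp_bound: "(\<integral>\<^sup>+\<omega>. exp_scaled \<beta> (coupling_time Z Z' \<omega>) \<partial>N) \<le> ennreal (2 + B)"
  proof -
    have "(\<integral>\<^sup>+\<omega>. exp_scaled \<beta> (coupling_time Z Z' \<omega>) \<partial>N) = (\<integral>\<^sup>+u. exp_scaled \<beta> (\<tau> u) \<partial>uniform01)"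
      by (rule nn_N[OF exp_meas])
    also have "\<dots> \<le> (\<integral>\<^sup>+u. ennreal (1 + sqrt B * u powr (- (1 / 2))) \<partial>uniform01)"
      by (intro nn_integral_mono \<tau>_le) simp
    also have "\<dots> = ennreal (1 + 2 * sqrt B)" using B by (intro nn_integral_uniform01_rsqrt) simp
    also have "\<dots> \<le> ennreal (2 + B)"
    proof (rule ennreal_leI)
      \<comment> \<open>The square root is traded for a bound linear in \<open>B\<close>, so that it
        will be integrable where \<open>V\<close> is.\<close>
      have "0 \<le> (sqrt B - 1)\<^sup>2" by simp
      then show "1 + 2 * sqrt B \<le> 2 + B" using B by (simp add: power2_diff)
    qed
    finally show ?thesis .
  qed
  have "successful_coupling (cdf D) b b' N Z Z'"
    unfolding successful_coupling_def
  proof (intro conjI allI impI ballI)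
    show "prob_space N" by (rule N)
    fix t :: real assume "0 \<le> t"
    have comp: "(\<lambda>\<omega>. \<zeta> t (\<pi> \<omega>)) \<in> borel_measurable N" "(\<lambda>\<omega>. \<zeta>' t (\<pi> \<omega>)) \<in> borel_measurable N"
      using measurable_compose[OF \<pi> measurable_uniform01] \<zeta> by auto
    show "Z t \<in> borel_measurable N" "Z' t \<in> borel_measurable N"
      unfolding Z_def[abs_def] Z'_def[abs_def] using comp by auto
    have "distr N borel (\<lambda>\<omega>. \<zeta> t (\<pi> \<omega>)) = distr (distr N uniform01 \<pi>) borel (\<zeta> t)"
      "distr N borel (\<lambda>\<omega>. \<zeta>' t (\<pi> \<omega>)) = distr (distr N uniform01 \<pi>) borel (\<zeta>' t)"
      using distr_distr[OF measurable_uniform01[OF \<zeta>(1)] \<pi>] distr_distr[OF measurable_uniform01[OF \<zeta>(2)] \<pi>]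
      by (simp_all add: comp_def)
    then have "distr N borel (\<lambda>\<omega>. \<zeta> t (\<pi> \<omega>)) = law b t" "distr N borel (\<lambda>\<omega>. \<zeta>' t (\<pi> \<omega>)) = law b' t"
      unfolding \<pi>_law \<zeta> .
    then show "distr N borel (Z t) = law b t" "distr N borel (Z' t) = law b' t"
      by (cases "t = 0"; simp add: Z_def[abs_def] Z'_def[abs_def] law_0 N.distr_const)+
  next
    fix \<omega> show "Z 0 \<omega> = b" "Z' 0 \<omega> = b'" by (simp_all add: Z_def Z'_def)
  next
    have "(\<lambda>\<omega>. \<tau> (\<pi> \<omega>)) \<in> borel_measurable N" by (rule measurable_compose[OF \<pi> \<tau>_meas])
    then show "coupling_time Z Z' \<in> borel_measurable N"
      by (subst measurable_cong[OF \<tau>])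
  next
    have "(\<integral>\<^sup>+\<omega>. coupling_time Z Z' \<omega> \<partial>N) \<le> (\<integral>\<^sup>+\<omega>. ennreal (1 / \<beta>) * exp_scaled \<beta> (coupling_time Z Z' \<omega>) \<partial>N)"
      by (intro nn_integral_mono coupling_time_le_exp_scaled \<beta>)
    also have "\<dots> = (\<integral>\<^sup>+u. ennreal (1 / \<beta>) * exp_scaled \<beta> (\<tau> u) \<partial>uniform01)"
      by (rule nn_N) (use exp_meas in measurable)
    also have "\<dots> = ennreal (1 / \<beta>) * (\<integral>\<^sup>+u. exp_scaled \<beta> (\<tau> u) \<partial>uniform01)"
      by (intro nn_integral_cmult measurable_compose[OF \<tau>_meas exp_meas])
    also have "\<dots> \<le> ennreal (1 / \<beta>) * ennreal (2 + B)"
      using exp_bound unfolding nn_N[OF exp_meas] by (intro mult_left_mono) auto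
    also have "\<dots> < \<infinity>" by (simp add: ennreal_mult_less_top)
    finally show "(\<integral>\<^sup>+\<omega>. coupling_time Z Z' \<omega> \<partial>N) < \<infinity>" .
  next
    show "AE \<omega> in N. \<forall>t\<ge>0. coupling_time Z Z' \<omega> \<le> ennreal t \<longrightarrow> Z t \<omega> = Z' t \<omega>"
    proof (intro AE_I2 allI impI)
      fix \<omega> and t :: real assume \<omega>: "\<omega> \<in> space N" and t: "0 \<le> t" and le: "coupling_time Z Z' \<omega> \<le> ennreal t"
      \<comment> \<open>The coupling time is an infimum: it only gives meeting times below each
        \<open>s > t\<close>. Monotonicity carries the bound to \<open>s\<close>, and
        right-continuity to \<open>t\<close> itself.\<close>
      have "?d t \<le> \<pi> \<omega>"
      proof (rule tv_right_limit[OF t])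
        fix s assume "t < s"
        then have "\<tau> (\<pi> \<omega>) < ennreal s"
          using le t unfolding \<tau>[OF \<omega>] by (auto intro: le_less_trans simp: ennreal_less_iff)
        then obtain r where "0 < r" "?d r \<le> \<pi> \<omega>" "ennreal r < ennreal s"
          by (auto simp: \<tau>_def INF_less_iff)
        then show "?d s \<le> \<pi> \<omega>" using tv_antimono[of r s b b'] by (auto simp: ennreal_less_iff)
      qed
      show "Z t \<omega> = Z' t \<omega>"
      proof (cases "t = 0")
        case False
        then show ?thesis using meet[OF \<pi>_in[OF \<omega>], of t] \<open>?d t \<le> \<pi> \<omega>\<close> by (simp add: Z_def Z'_def)
      next
        case True
        \<comment> \<open>For distinct starts the distance at time 0 is 1, above every
          \<open>u\<close> of the open unit interval, so the coupling time cannot be 0.\<close>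
        have "b = b'"
        proof (rule ccontr)
          assume "b \<noteq> b'"
          have "measure (law b 0) {b} - measure (law b' 0) {b} \<le> ?d 0"
            unfolding tv_def by (rule tv_dist_ge[OF real_distribution_law real_distribution_law]) simp
          then have "1 \<le> ?d 0" using \<open>b \<noteq> b'\<close> by (simp add: law_0 measure_return)
          then show False using \<open>?d t \<le> \<pi> \<omega>\<close> \<pi>_in[OF \<omega>] True by simp
        qed
        then show ?thesis using True by (simp add: Z_def Z'_def)
      qed
    qed
  qed
  with exp_bound show ?thesis by blast
qed

end

section \<open>Distance to the stationary law\<close>

context exp_renewal
begin

text \<open>By stationarity \<open>measure stat A\<close> is the \<open>stat\<close>-average over
  \<open>y\<close> of the transition probabilities into \<open>A\<close>, so the bound for two
  starting points is averaged over the second one.\<close>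

lemma tv_stat_le:
  assumes \<kappa>: "\<And>\<phi> x y. bounded_borel \<phi> \<Longrightarrow> (\<And>x. 0 \<le> \<phi> x) \<Longrightarrow> (\<And>x. \<phi> x \<le> 1) \<Longrightarrow>
      evol t \<phi> x - evol t \<phi> y \<le> C * (V x + V y) * r" and t: "0 \<le> t"
  shows "tv_dist (law b t) stat \<le> (LINT x|stat. C * (V b + V x) * r)"
proof (rule tv_dist_le[OF real_distribution_law real_distribution_stat])
  interpret S: real_distribution stat by (rule real_distribution_stat)
  fix A :: "real set" assume A: "A \<in> sets borel"
  then have bb: "bounded_borel (indicator A :: real \<Rightarrow> real)" by simp
  let ?e = "evol t (indicator A)"
  obtain M where M: "\<And>x. \<bar>?e x\<bar> \<le> M" using bounded_borelD(2)[OF bounded_borel_evol[OF bb t]] by auto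
  have int: "integrable stat ?e"
    using bounded_borelD(1)[OF bounded_borel_evol[OF bb t]] M by (intro S.integrable_bounded[of _ M]) auto
  have "measure (law b t) A - measure stat A = ?e b - (LINT x|stat. ?e x)"
    using A by (simp add: measure_law stationarity[OF bb t])
  also have "\<dots> = (LINT x|stat. ?e b - ?e x)" using int by simp
  also have "\<dots> \<le> (LINT x|stat. C * (V b + V x) * r)"
    using int integrable_V_stat bb by (intro integral_mono \<kappa>) auto
  finally show "measure (law b t) A - measure stat A \<le> (LINT x|stat. C * (V b + V x) * r)" .
qed

lemma integral_stat_atLeast_0:
  fixes g :: "real \<Rightarrow> real"
  assumes [measurable]: "g \<in> borel_measurable borel"
  shows "(LINT x:{0..}|stat. g x) = (LINT x|stat. g x)"
proof -
  have "(LINT x:{0..}|stat. g x) = (LINT x|stat. indicator {0..} x * g x)"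
    by (simp add: set_lebesgue_integral_def)
  also have "\<dots> = (LINT x|lborel. indicator {0<..} x * ((1 - cdf D x) * (indicator {0..} x * g x))) / mean"
    by (rule integral_stat) measurable
  also have "(\<lambda>x. indicator {0<..} x * ((1 - cdf D x) * (indicator {0..} x * g x)))
    = (\<lambda>x. indicator {0<..} x * ((1 - cdf D x) * g x))"
    by (auto simp: indicator_def)
  also have "(LINT x|lborel. indicator {0<..} x * ((1 - cdf D x) * g x)) / mean = (LINT x|stat. g x)"
    by (rule integral_stat[symmetric]) measurable
  finally show ?thesis .
qed

end

theorem theorem2:
  fixes M :: "'a measure" and \<xi> :: "'a \<Rightarrow> real" and F :: "real \<Rightarrow> real" and \<alpha> \<mu> :: real
  assumes "prob_space M"
    and "\<xi> \<in> borel_measurable M"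
    and "AE \<omega> in M. \<xi> \<omega> > 0"
    and "F = cdf (distr M borel \<xi>)"
    and "integrable M \<xi>"
    and "\<mu> = (LINT \<omega>|M. \<xi> \<omega>)"
    and "no_singular_continuous_component (distr M borel \<xi>)"
    and "AE s in lborel. s > 0 \<longrightarrow> (\<exists>d>0. (F has_real_derivative d) (at s))"
    and "\<alpha> > 0"
    and "integrable M (\<lambda>\<omega>. exp (\<alpha> * \<xi> \<omega>))"
  shows "\<exists>\<beta> (K :: real \<Rightarrow> real \<Rightarrow> real).
      0 < \<beta> \<and> \<beta> < \<alpha> \<and>
      (\<lambda>(b, b'). K b b') \<in> borel_measurable (restrict_space borel ({0..} \<times> {0..})) \<and>
      (\<forall>b\<ge>0. \<forall>b'\<ge>0. K b b' \<ge> 0) \<and>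
      (\<forall>b\<ge>0. \<forall>b'\<ge>0. \<exists>(N :: (real \<Rightarrow> real \<times> real) measure) Z Z'.
         successful_coupling F b b' N Z Z' \<and>
         (\<integral>\<^sup>+\<omega>. exp_scaled \<beta> (coupling_time Z Z' \<omega>) \<partial>N) \<le> ennreal (K b b')) \<and>
      (\<forall>b\<ge>0. set_integrable (stationary_law F \<mu>) {0..} (K b) \<and>
         (\<forall>t\<ge>0. tv_dist (backward_renewal_law F b t) (stationary_law F \<mu>)
            \<le> (LINT b':{0..}|stationary_law F \<mu>. K b b') * exp (- \<beta> * t)))"
proof -
  define D where "D = distr M borel \<xi>"
  note [measurable] = \<open>\<xi> \<in> borel_measurable M\<close>
  have F: "F = cdf D" using assms(4) by (simp add: D_def)
  interpret M: prob_space M by fact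
  have "prob_space D" unfolding D_def by (rule M.prob_space_distr) measurable
  then interpret D: real_distribution D
    by (simp add: real_distribution_def real_distribution_axioms_def D_def)
  \<comment> \<open>If \<open>F\<close> reached 1 it would be constant from there on, contradicting
    a positive derivative almost everywhere on an interval.\<close>
  have tail: "cdf D b < 1" for b
  proof (rule ccontr)
    assume "\<not> cdf D b < 1"
    then have one: "cdf D x = 1" if "b \<le> x" for x
      using D.cdf_nondecreasing[OF that] D.cdf_bounded_prob[of x] D.cdf_bounded_prob[of b] by linarith
    have "AE s in lborel. s \<notin> {max b 0<..<max b 0 + 1}"
      using assms(8)
    proof eventually_elim
      case (elim s)
      show ?case
      proof
        assume s: "s \<in> {max b 0<..<max b 0 + 1}"
        with elim obtain d where "d > 0" "(cdf D has_real_derivative d) (at s)" by (auto simp: F)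
        from DERIV_pos_inc_left[OF this(2,1)] obtain \<delta> where \<delta>: "\<delta> > 0"
          "\<And>h. 0 < h \<Longrightarrow> h < \<delta> \<Longrightarrow> cdf D (s - h) < cdf D s" by blast
        define h where "h = min (\<delta> / 2) (s - b)"
        have "cdf D (s - h) < cdf D s" using \<delta>(1) s by (intro \<delta>(2)) (auto simp: h_def)
        then show False using one[of "s - h"] one[of s] s by (auto simp: h_def)
      qed
    qed
    then have "{max b 0<..<max b 0 + 1} \<in> null_sets lborel"
      by (subst AE_iff_null_sets) auto
    then show False by (auto simp: null_sets_def)
  qed
  obtain f where f: "f \<in> borel_measurable borel" "density lborel f \<le> D" "AE s in lborel. 0 < s \<longrightarrow> 0 < f s"
    using obtain_positive_density[of D] assms(7,8) D.real_distribution_axioms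
    unfolding F D_def[symmetric] by metis
  interpret spread_renewal D \<alpha> f
  proof
    show "AE s in D. 0 < s" unfolding D_def using assms(3) by (subst AE_distr_iff) auto
    show "integrable D (\<lambda>s. exp (\<alpha> * s))"
      unfolding D_def using assms(10) by (subst integrable_distr_eq) auto
  qed (use tail f assms(9) in auto)
  have \<mu>: "\<mu> = mean"
  proof -
    have "mean = (LINT s|distr M borel \<xi>. s)" unfolding mean_def by (simp only: D_def)
    then show ?thesis unfolding assms(6) by (subst (asm) integral_distr) auto
  qed
  have stat: "stationary_law F \<mu> = stat" unfolding F \<mu> by (rule stationary_law_eq)
  interpret S: real_distribution stat by (rule real_distribution_stat)
  obtain C \<kappa> :: real where C: "0 < C" and \<kappa>: "0 < \<kappa>" and
    rate: "\<And>\<phi> t x y. bounded_borel \<phi> \<Longrightarrow> (\<And>x. 0 \<le> \<phi> x) \<Longrightarrow> (\<And>x. \<phi> x \<le> 1) \<Longrightarrow> 0 \<le> t \<Longrightarrow>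
      evol t \<phi> x - evol t \<phi> y \<le> C * (V x + V y) * exp (- \<kappa> * t)"
    using obtain_exponential_rate by metis
  \<comment> \<open>Half of \<open>\<kappa>\<close> because the coupling needs decay at rate
    \<open>2 * \<beta>\<close>; the minimum with \<open>\<alpha>\<close> ensures
    \<open>\<beta> < \<alpha>\<close>.\<close>
  define \<beta> where "\<beta> = min \<kappa> \<alpha> / 2"
  have \<beta>: "0 < \<beta>" "\<beta> < \<alpha>" "2 * \<beta> \<le> \<kappa>" using \<kappa> alpha_pos by (auto simp: \<beta>_def)
  \<comment> \<open>The moment bound \<open>2 + B\<close> of the coupling lemma with
    \<open>B = C * (V b + V b')\<close>.\<close>
  define K where "K b b' = 2 + C * (V b + V b')" for b b'
  have V_pos: "0 < V b" for b using V_ge_1[of b] by simp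
  have K_nonneg: "0 \<le> K b b'" for b b' using C V_pos[of b] V_pos[of b'] by (simp add: K_def)
  have int_K: "integrable stat (K b)" for b
    unfolding K_def[abs_def] using integrable_V_stat by simp
  show ?thesis
  proof (intro exI[of _ \<beta>] exI[of _ K] conjI allI impI)
    show "0 < \<beta>" "\<beta> < \<alpha>" by (rule \<beta>)+
    have "(\<lambda>p. K (fst p) (snd p)) \<in> borel_measurable (borel \<Otimes>\<^sub>M borel)"
      unfolding K_def by measurable
    then show "(\<lambda>(b, b'). K b b') \<in> borel_measurable (restrict_space borel ({0..} \<times> {0..}))"
      by (intro measurable_restrict_space1) (simp add: borel_prod case_prod_beta)
    show "0 \<le> K b b'" for b b' by (rule K_nonneg)
  next
    fix b b' :: real
    let ?B = "C * (V b + V b')"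
    have "tv b b' t \<le> ?B * exp (- (2 * \<beta>) * t)" if "0 \<le> t" for t
    proof -
      have "tv b b' t \<le> ?B * exp (- \<kappa> * t)"
        unfolding tv_def
      proof (rule tv_dist_le[OF real_distribution_law real_distribution_law])
        fix A :: "real set" assume "A \<in> sets borel"
        then show "measure (law b t) A - measure (law b' t) A \<le> ?B * exp (- \<kappa> * t)"
          unfolding measure_law[OF \<open>A \<in> sets borel\<close>] by (intro rate that) auto
      qed
      also have "\<dots> \<le> ?B * exp (- (2 * \<beta>) * t)"
        using C V_pos[of b] V_pos[of b'] \<beta>(3) that by (intro mult_left_mono) (auto intro: mult_right_mono)
      finally show ?thesis .
    qed
    then show "\<exists>(N :: (real \<Rightarrow> real \<times> real) measure) Z Z'. successful_coupling F b b' N Z Z' \<and>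
         (\<integral>\<^sup>+\<omega>. exp_scaled \<beta> (coupling_time Z Z' \<omega>) \<partial>N) \<le> ennreal (K b b')"
      unfolding F K_def
      using C V_pos[of b] V_pos[of b'] by (intro successful_coupling_of_tv_bound \<beta>(1)) auto
  next
    fix b :: real
    show "set_integrable (stationary_law F \<mu>) {0..} (K b)"
      unfolding stat set_integrable_def
      by (rule integrable_mult_indicator) (simp_all add: int_K)
    fix t :: real assume t: "0 \<le> t"
    have "tv_dist (law b t) stat \<le> (LINT x|stat. C * (V b + V x) * exp (- \<kappa> * t))"
      by (rule tv_stat_le[OF rate t]) (use t in auto)
    also have "\<dots> \<le> (LINT x|stat. K b x * exp (- \<beta> * t))"
    proof (rule integral_mono)
      show "integrable stat (\<lambda>x. C * (V b + V x) * exp (- \<kappa> * t))" using integrable_V_stat by simp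
      show "integrable stat (\<lambda>x. K b x * exp (- \<beta> * t))" using int_K by simp
      have "\<beta> * t \<le> \<kappa> * t" using \<beta> t by (intro mult_right_mono) auto
      then show "C * (V b + V x) * exp (- \<kappa> * t) \<le> K b x * exp (- \<beta> * t)" for x
        using C V_pos[of b] V_pos[of x] K_nonneg[of b x] by (intro mult_mono) (auto simp: K_def)
    qed
    also have "\<dots> = (LINT b':{0..}|stat. K b b') * exp (- \<beta> * t)"
      using borel_measurable_integrable[OF int_K[of b]] by (simp add: integral_stat_atLeast_0)
    finally show "tv_dist (backward_renewal_law F b t) (stationary_law F \<mu>)
            \<le> (LINT b':{0..}|stationary_law F \<mu>. K b b') * exp (- \<beta> * t)"
      unfolding F[symmetric] stat .
  qed
qed

end
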